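(* Let $\varrho=h^4$, $\mathbf{C}_{M_h}=0.25\,\mathrm{diag}(\mathbf{M}_h)$, and let $$\mathcal{K}_h=\begin{bmatrix}\mathbf{M}_h\mathbf{C}_{M_h}^{-1}-\mathbf{I}&\mathbf{0}\\ \sqrt\varrho\,\mathbf{K}_h\mathbf{C}_{M_h}^{-1}&-\mathbf{I}\end{bmatrix}\begin{bmatrix}\mathbf{M}_h&\sqrt\varrho\,\mathbf{K}_h\\ \sqrt\varrho\,\mathbf{K}_h&-\mathbf{M}_h\end{bmatrix}$$ be the symmetric and positive definite Bramble--Pasciak system matrix. Then the inexact Bramble--Pasciak preconditioner $$\widetilde{\mathcal{P}}_{BP,h}=\begin{bmatrix}\mathbf{M}_h-0.25\,\mathrm{diag}(\mathbf{M}_h)&\mathbf{0}\\ \mathbf{0}&\mathrm{diag}(\mathbf{M}_h)\end{bmatrix}$$ is spectrally equivalent to $\mathcal{K}_h$ with constants independent of $h$. Consequently the preconditioned conjugate gradient (PCG) method with preconditioner $\widetilde{\mathcal{P}}_{BP,h}$ applied to the system $$\mathcal{K}_h\begin{bmatrix}\widetilde{\mathbf{p}}\\ \mathbf{u}\end{bmatrix}=\begin{bmatrix}\mathbf{0}\\ \mathbf{f}\end{bmatrix},\qquad\mathbf{f}\in\mathbb{R}^{N_h},$$ converges with an $h$-independent rate in asymptotically optimal complexity $\mathcal{O}(N_h\ln\varepsilon^{-1})$ for any fixed relative accuracy $\varepsilon\in(0,1)$.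
   Context: $\Omega\subset\mathbb{R}^d$, $d\in\{1,2,3\}$, is a bounded Lipschitz domain, decomposed admissibly into shape regular, globally quasi-uniform simplices of mesh size $h$. $V_h=\mathrm{span}\{\varphi_k\}_{k=1}^{N_h}\subset H^1_0(\Omega)$ is the space of continuous piecewise linear functions vanishing on $\partial\Omega$, with nodal basis $\varphi_k$; $\mathbf{M}_h[\ell,k]=\int_\Omega\varphi_k\varphi_\ell\,dx$ and $\mathbf{K}_h[\ell,k]=\int_\Omega\nabla\varphi_k\cdot\nabla\varphi_\ell\,dx$. $\mathrm{diag}(\mathbf{M}_h)$ is the diagonal part of $\mathbf{M}_h$ and $\mathbf{I}$ the identity. The choice of $\mathbf{C}_{M_h}$ ensures $\mathbf{C}_{M_h}<\mathbf{M}_h$ (in the sense of quadratic forms), uniformly: there are $h$-independent constants $1<\underline{c}_{CM}\le\overline{c}_{CM}$ with $\underline{c}_{CM}\mathbf{C}_{M_h}\le\mathbf{M}_h\le\overline{c}_{CM}\mathbf{C}_{M_h}$. Spectral equivalence of symmetric positive definite families $\mathcal{P}_h,\mathcal{Q}_h$ means $c_1(\mathcal{Q}_h\mathbf{v},\mathbf{v})\le(\mathcal{P}_h\mathbf{v},\mathbf{v})\le c_2(\mathcal{Q}_h\mathbf{v},\mathbf{v})$ for all $\mathbf{v}$, with $h$-independent $0<c_1\le c_2$. "$h$-independent rate" means that the PCG errors in the $\mathcal{K}_h$-energy norm $\|\mathbf{x}\|_{\mathcal{K}_h}=(\mathcal{K}_h\mathbf{x},\mathbf{x})^{1/2}$ satisfy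 $\|\mathbf{x}-\mathbf{x}^n\|_{\mathcal{K}_h}\le 2q^n\|\mathbf{x}-\mathbf{x}^0\|_{\mathcal{K}_h}$ with $q\in(0,1)$ independent of $h$. The complexity is the number of arithmetical operations needed to reduce the error by the factor $\varepsilon$, with constant in $\mathcal{O}$ independent of $h$; as usual for the Bramble--Pasciak method, the block $\mathbf{M}_h-\mathbf{C}_{M_h}$ need not be inverted, since it is a left factor of the first block row of $\mathcal{K}_h$: that row equals $(\mathbf{M}_h-\mathbf{C}_{M_h})\mathbf{C}_{M_h}^{-1}[\mathbf{M}_h,\ \sqrt\varrho\,\mathbf{K}_h]$. "Independent of $h$" allows dependence on $\Omega$ and the mesh-family regularity constants. *)

theory Defs
  imports
    "HOL-Analysis.Analysis"
    "Jordan_Normal_Form.Gauss_Jordan_Elimination"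
begin

section \<open>Bounded Lipschitz domains\<close>

text \<open>Near each boundary point the domain is the strict epigraph, in some direction \<open>\<nu>\<close>, of a
  Lipschitz function on the hyperplane orthogonal to \<open>\<nu>\<close>. In dimension one that hyperplane is
  \<open>{0}\<close>, and the bounded Lipschitz domains are the bounded open intervals.\<close>

definition lipschitz_boundary :: "'a::euclidean_space set \<Rightarrow> bool" where
  "lipschitz_boundary \<Omega> \<longleftrightarrow>
     (\<forall>x\<in>frontier \<Omega>. \<exists>\<nu> r L g.
        norm \<nu> = 1 \<and> 0 < r \<and> lipschitz_on L {y. inner y \<nu> = 0} (g :: 'a \<Rightarrow> real) \<and>
        (\<forall>y\<in>ball x r. y \<in> \<Omega> \<longleftrightarrow> g (y - inner y \<nu> *\<^sub>R \<nu>) < inner y \<nu>))"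

definition bounded_lipschitz_domain :: "'a::euclidean_space set \<Rightarrow> bool" where
  "bounded_lipschitz_domain \<Omega> \<longleftrightarrow>
     \<Omega> \<noteq> {} \<and> open \<Omega> \<and> connected \<Omega> \<and> bounded \<Omega> \<and> lipschitz_boundary \<Omega>"


section \<open>Simplicial meshes\<close>

definition admissible_mesh :: "'a::euclidean_space set \<Rightarrow> 'a set set \<Rightarrow> bool" where
  "admissible_mesh \<Omega> \<T> \<longleftrightarrow>
     triangulation \<T> \<and> (\<forall>\<tau>\<in>\<T>. int DIM('a) simplex \<tau>) \<and> \<Union>\<T> = closure \<Omega>"

definition mesh_size :: "'a::euclidean_space set set \<Rightarrow> real" where
  "mesh_size \<T> = Max (diameter ` \<T>)"

definition shape_regular :: "real \<Rightarrow> 'a::euclidean_space set set \<Rightarrow> bool" where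
  "shape_regular \<sigma> \<T> \<longleftrightarrow>
     (\<forall>\<tau>\<in>\<T>. \<exists>z r. 0 < r \<and> cball z r \<subseteq> \<tau> \<and> diameter \<tau> \<le> \<sigma> * r)"

definition quasi_uniform :: "real \<Rightarrow> 'a::euclidean_space set set \<Rightarrow> bool" where
  "quasi_uniform \<kappa> \<T> \<longleftrightarrow> (\<forall>\<tau>\<in>\<T>. mesh_size \<T> \<le> \<kappa> * diameter \<tau>)"

definition interior_nodes :: "'a::euclidean_space set \<Rightarrow> 'a set set \<Rightarrow> 'a set" where
  "interior_nodes \<Omega> \<T> = (\<Union>\<tau>\<in>\<T>. {x. x extreme_point_of \<tau>}) \<inter> \<Omega>"


section \<open>Continuous piecewise linear finite elements\<close>

text \<open>Finite element functions are extended by zero outside \<open>\<Omega>\<close>; since \<open>\<Omega>\<close> is open, this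
  includes the homogeneous Dirichlet condition on \<open>frontier \<Omega>\<close>.\<close>

definition p1_space :: "'a::euclidean_space set \<Rightarrow> 'a set set \<Rightarrow> ('a \<Rightarrow> real) set" where
  "p1_space \<Omega> \<T> =
     {v. continuous_on (closure \<Omega>) v \<and>
         (\<forall>\<tau>\<in>\<T>. \<exists>a b. \<forall>x\<in>\<tau>. v x = inner a x + b) \<and>
         (\<forall>x. x \<notin> \<Omega> \<longrightarrow> v x = 0)}"

text \<open>A mesh with an enumeration of its interior nodes and the corresponding nodal basis. Indices
  run over \<open>{..<num_dofs D}\<close>.\<close>

record 'a p1_discretization =
  elements :: "'a set set"
  num_dofs :: nat
  node :: "nat \<Rightarrow> 'a"
  hat :: "nat \<Rightarrow> 'a \<Rightarrow> real"

text \<open>All discretizations of \<open>\<Omega>\<close> with mesh regularity constants \<open>\<sigma>\<close> and \<open>\<kappa>\<close>, for every mesh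
  size. A quantity chosen before \<open>D \<in> p1_family \<Omega> \<sigma> \<kappa>\<close> is one that does not depend on \<open>h\<close>.\<close>

definition p1_family ::
  "'a::euclidean_space set \<Rightarrow> real \<Rightarrow> real \<Rightarrow> 'a p1_discretization set" where
  "p1_family \<Omega> \<sigma> \<kappa> =
     {D. admissible_mesh \<Omega> (elements D) \<and>
         shape_regular \<sigma> (elements D) \<and> quasi_uniform \<kappa> (elements D) \<and>
         bij_betw (node D) {..<num_dofs D} (interior_nodes \<Omega> (elements D)) \<and>
         (\<forall>k<num_dofs D. hat D k \<in> p1_space \<Omega> (elements D) \<and>
            (\<forall>l<num_dofs D. hat D k (node D l) = (if l = k then 1 else 0)))}"

abbreviation meshwidth :: "'a::euclidean_space p1_discretization \<Rightarrow> real" where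
  "meshwidth D \<equiv> mesh_size (elements D)"

text \<open>For a finite element function the gradient below is determined in the interior of every
  element; its value on the null set of element faces does not affect the Lebesgue integrals.\<close>

definition grad :: "('a::euclidean_space \<Rightarrow> real) \<Rightarrow> 'a \<Rightarrow> 'a" where
  "grad v x = (THE g. GDERIV v x :> g)"

definition mass_matrix :: "'a::euclidean_space set \<Rightarrow> 'a p1_discretization \<Rightarrow> real mat" where
  "mass_matrix \<Omega> D = Matrix.mat (num_dofs D) (num_dofs D)
     (\<lambda>(l, k). LINT x:\<Omega>|lebesgue. hat D k x * hat D l x)"

definition stiffness_matrix :: "'a::euclidean_space set \<Rightarrow> 'a p1_discretization \<Rightarrow> real mat" where
  "stiffness_matrix \<Omega> D = Matrix.mat (num_dofs D) (num_dofs D)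
     (\<lambda>(l, k). LINT x:\<Omega>|lebesgue. inner (grad (hat D k) x) (grad (hat D l) x))"


section \<open>Matrices\<close>

definition diag_part :: "real mat \<Rightarrow> real mat" where
  "diag_part A = Matrix.mat (dim_row A) (dim_col A) (\<lambda>(i, j). if i = j then A $$ (i, j) else 0)"

text \<open>Only used for invertible matrices; otherwise the value is unspecified.\<close>

definition mat_inv :: "real mat \<Rightarrow> real mat" where
  "mat_inv A = the (mat_inverse A)"

definition sym_pos_def :: "real mat \<Rightarrow> bool" where
  "sym_pos_def A \<longleftrightarrow> square_mat A \<and> transpose_mat A = A \<and>
     (\<forall>v\<in>carrier_vec (dim_row A). v \<noteq> 0\<^sub>v (dim_row A) \<longrightarrow> 0 < (A *\<^sub>v v) \<bullet> v)"

definition spectrally_equivalent ::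
  "'i set \<Rightarrow> ('i \<Rightarrow> real mat) \<Rightarrow> ('i \<Rightarrow> real mat) \<Rightarrow> bool" where
  "spectrally_equivalent I P Q \<longleftrightarrow>
     (\<forall>i\<in>I. sym_pos_def (P i) \<and> sym_pos_def (Q i) \<and> dim_row (P i) = dim_row (Q i)) \<and>
     (\<exists>c1 c2. 0 < c1 \<and> c1 \<le> c2 \<and>
        (\<forall>i\<in>I. \<forall>v\<in>carrier_vec (dim_row (Q i)).
           c1 * ((Q i *\<^sub>v v) \<bullet> v) \<le> (P i *\<^sub>v v) \<bullet> v \<and>
           (P i *\<^sub>v v) \<bullet> v \<le> c2 * ((Q i *\<^sub>v v) \<bullet> v)))"

definition energy_norm :: "real mat \<Rightarrow> real vec \<Rightarrow> real" where
  "energy_norm A v = sqrt ((A *\<^sub>v v) \<bullet> v)"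


section \<open>The Bramble--Pasciak system\<close>

definition bp_matrix :: "real \<Rightarrow> real mat \<Rightarrow> real mat \<Rightarrow> real mat \<Rightarrow> real mat" where
  "bp_matrix \<rho> M K C = (let n = dim_row M in
     four_block_mat (M * mat_inv C - 1\<^sub>m n) (0\<^sub>m n n) (sqrt \<rho> \<cdot>\<^sub>m (K * mat_inv C)) (- 1\<^sub>m n) *
     four_block_mat M (sqrt \<rho> \<cdot>\<^sub>m K) (sqrt \<rho> \<cdot>\<^sub>m K) (- M))"

definition bp_system :: "'a::euclidean_space set \<Rightarrow> 'a p1_discretization \<Rightarrow> real mat" where
  "bp_system \<Omega> D = (let M = mass_matrix \<Omega> D in
     bp_matrix (meshwidth D ^ 4) M (stiffness_matrix \<Omega> D) ((1/4) \<cdot>\<^sub>m diag_part M))"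

definition bp_precond :: "'a::euclidean_space set \<Rightarrow> 'a p1_discretization \<Rightarrow> real mat" where
  "bp_precond \<Omega> D = (let M = mass_matrix \<Omega> D; n = num_dofs D in
     four_block_mat (M - (1/4) \<cdot>\<^sub>m diag_part M) (0\<^sub>m n n) (0\<^sub>m n n) (diag_part M))"

definition bp_rhs :: "real vec \<Rightarrow> real vec" where
  "bp_rhs f = 0\<^sub>v (dim_vec f) @\<^sub>v f"


section \<open>The preconditioned conjugate gradient method\<close>

text \<open>The state consists of the iterate \<open>x\<close>, the residual \<open>r\<close>, the preconditioned residual \<open>z\<close> and
  the search direction \<open>p\<close>. Once \<open>r = 0\<close>, the convention \<open>0 / 0 = 0\<close> makes the iteration
  stationary, which replaces the usual termination test.\<close>

type_synonym pcg_state = "real vec \<times> real vec \<times> real vec \<times> real vec"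

definition pcg_init :: "real mat \<Rightarrow> real mat \<Rightarrow> real vec \<Rightarrow> real vec \<Rightarrow> pcg_state" where
  "pcg_init A P b x0 = (let r = b - A *\<^sub>v x0; z = mat_inv P *\<^sub>v r in (x0, r, z, z))"

fun pcg_step :: "real mat \<Rightarrow> real mat \<Rightarrow> pcg_state \<Rightarrow> pcg_state" where
  "pcg_step A P (x, r, z, p) =
     (let \<alpha> = (r \<bullet> z) / ((A *\<^sub>v p) \<bullet> p);
          x' = x + \<alpha> \<cdot>\<^sub>v p;
          r' = r - \<alpha> \<cdot>\<^sub>v (A *\<^sub>v p);
          z' = mat_inv P *\<^sub>v r';
          \<beta> = (r' \<bullet> z') / (r \<bullet> z)
      in (x', r', z', z' + \<beta> \<cdot>\<^sub>v p))"

definition pcg :: "real mat \<Rightarrow> real mat \<Rightarrow> real vec \<Rightarrow> real vec \<Rightarrow> nat \<Rightarrow> real vec" where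
  "pcg A P b x0 n = fst ((pcg_step A P ^^ n) (pcg_init A P b x0))"


section \<open>Counting arithmetical operations\<close>

text \<open>Straight-line programs over the reals: each instruction performs one arithmetical operation
  and appends its result to the memory, so that the number of operations is the length of the
  program. Operands are rational constants, named inputs, and results of earlier instructions.\<close>

datatype 'i operand = Const rat | Inp 'i | Reg nat

datatype arith_op = Plus | Minus | Times | Divide

type_synonym 'i program = "(arith_op \<times> 'i operand \<times> 'i operand) list"

fun operand_value :: "('i \<Rightarrow> real) \<Rightarrow> real list \<Rightarrow> 'i operand \<Rightarrow> real" where
  "operand_value env mem (Const c) = of_rat c"
| "operand_value env mem (Inp i) = env i"
| "operand_value env mem (Reg j) = (if j < length mem then mem ! j else 0)"

fun apply_op :: "arith_op \<Rightarrow> real \<Rightarrow> real \<Rightarrow> real" where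
  "apply_op Plus a b = a + b"
| "apply_op Minus a b = a - b"
| "apply_op Times a b = a * b"
| "apply_op Divide a b = a / b"

fun run_program :: "('i \<Rightarrow> real) \<Rightarrow> real list \<Rightarrow> 'i program \<Rightarrow> real list" where
  "run_program env mem [] = mem"
| "run_program env mem ((c, s, t) # is) =
     run_program env (mem @ [apply_op c (operand_value env mem s) (operand_value env mem t)]) is"

definition program_output ::
  "('i \<Rightarrow> real) \<Rightarrow> 'i program \<Rightarrow> 'i operand list \<Rightarrow> real vec" where
  "program_output env prog outs = vec_of_list (map (operand_value env (run_program env [] prog)) outs)"

text \<open>The inputs: the entries of the assembled finite element matrices, the mesh size, the right-hand
  side and the initial guess. In particular neither \<open>bp_system\<close> nor the inverse of \<open>bp_precond\<close> is
  available for free.\<close>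

datatype bp_input = Mass nat nat | Stiffness nat nat | Width | Load nat | Guess nat

fun bp_env ::
  "'a::euclidean_space set \<Rightarrow> 'a p1_discretization \<Rightarrow> real vec \<Rightarrow> real vec \<Rightarrow> bp_input \<Rightarrow> real" where
  "bp_env \<Omega> D f x0 (Mass i j) = mass_matrix \<Omega> D $$ (i, j)"
| "bp_env \<Omega> D f x0 (Stiffness i j) = stiffness_matrix \<Omega> D $$ (i, j)"
| "bp_env \<Omega> D f x0 Width = meshwidth D"
| "bp_env \<Omega> D f x0 (Load i) = vec_index f i"
| "bp_env \<Omega> D f x0 (Guess i) = vec_index x0 i"

text \<open>\<open>prog\<close> carries out the first \<open>n\<close> steps of PCG on \<open>D\<close>, for every right-hand side and every
  initial guess; the components of the \<open>m\<close>-th iterate are found at \<open>outs m\<close>.\<close>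

definition performs_pcg ::
  "'a::euclidean_space set \<Rightarrow> 'a p1_discretization \<Rightarrow> nat \<Rightarrow>
   bp_input program \<Rightarrow> (nat \<Rightarrow> bp_input operand list) \<Rightarrow> bool" where
  "performs_pcg \<Omega> D n prog outs \<longleftrightarrow>
     (\<forall>f\<in>carrier_vec (num_dofs D). \<forall>x0\<in>carrier_vec (2 * num_dofs D). \<forall>m\<le>n.
        program_output (bp_env \<Omega> D f x0) prog (outs m) =
        pcg (bp_system \<Omega> D) (bp_precond \<Omega> D) (bp_rhs f) x0 m)"

end

theory Submission
  imports Defs "Jordan_Normal_Form.Determinant"
begin

text \<open>
  On a simplex with barycentric coordinates \<open>\<lambda>\<^sub>i\<close>, exchanging two vertices shows that the integral of
  \<open>\<lambda>\<^sub>i\<^sup>2\<close> does not depend on \<open>i\<close>, and the affine map that moves the vertex \<open>j\<close> to the midpoint of the edge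
  \<open>i j\<close> maps the simplex onto one half of it, which forces the integral of \<open>\<lambda>\<^sub>i \<lambda>\<^sub>j\<close> to be half that of
  \<open>\<lambda>\<^sub>i\<^sup>2\<close>. So the element mass matrices are multiples of \<open>I + J\<close> (\<open>J\<close> the all-ones matrix), hence
  \<open>1/2 diag M \<le> M \<le> c diag M\<close>; since the gradients of \<open>\<lambda>\<^sub>i\<close> are bounded by the inverse inradius,
  also \<open>h\<^sup>2 K \<le> c diag M\<close>.

  For \<open>t = C\<^sup>-\<^sup>1 (M v + h\<^sup>2 K w)\<close> the quadratic form of the Bramble--Pasciak matrix at \<open>(v, w)\<close> is
  \<open>\<parallel>t - v\<parallel>\<^sub>C\<^sup>2 + ((M - C) v, v) + (M w, w)\<close>, from which both spectral bounds follow.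

  A step of PCG decreases the energy of the error at least as much as a step of preconditioned steepest
  descent, by the orthogonality of two consecutive search directions; this gives the factor
  \<open>sqrt (1 - c1 / c2)\<close> per step. The first block of \<open>P\<^sup>-\<^sup>1 A (v, w)\<close> is just \<open>t\<close>, so the preconditioned
  residual can be updated along with the residual and \<open>M - C\<close> is never inverted. Shape regularity
  bounds the number of elements at a node, hence the number of nonzero entries per row.
\<close>

unbundle no inner_syntax

section \<open>Second moments of barycentric coordinates\<close>

text \<open>The exponent in \<open>h ^ 4\<close> is the one that balances the scales:
  \<open>sqrt (h ^ 4) = h\<^sup>2\<close> compensates the loss of two powers of \<open>h\<close> in
  the inverse inequality, so \<open>M\<close>, \<open>h\<^sup>2 K\<close> and \<open>diag M\<close>
  compare element by element, with constants built from the dimension and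
  \<open>\<kappa> * \<sigma>\<close> alone. The factor 1/4 leaves room:
  \<open>1/2 diag M \<le> M\<close> reads \<open>2 C \<le> M\<close>, so \<open>M - C\<close>
  dominates both \<open>C\<close> and half of \<open>M\<close>. Two points shape the operation
  count. A single program has to serve all right-hand sides and initial guesses, so costs are stated
  for functions of these data. And the recurrence for the preconditioned residual must be started
  without a solve: this works because the first block \<open>0\<close> of the right-hand side is
  \<open>M - C\<close> applied to \<open>0\<close>. In the convergence proof, comparison with
  steepest descent keeps the argument within a single step; any factor below one that is independent
  of \<open>h\<close> gives the claimed rate.\<close>

lemma lborel_isometry_vec:
  assumes "CARD('n::finite) = DIM('a::euclidean_space)"
  shows "\<exists>(\<phi> :: 'a \<Rightarrow> real^'n) \<psi>. linear \<phi> \<and> linear \<psi> \<and>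
    (\<forall>x. \<psi> (\<phi> x) = x) \<and> (\<forall>y. \<phi> (\<psi> y) = y) \<and> distr lborel borel \<psi> = lborel"
proof -
  obtain e :: "'n \<Rightarrow> 'a" where e: "bij_betw e UNIV Basis"
    using assms finite_same_card_bij[of "UNIV::'n set" "Basis::'a set"] by auto
  define \<phi> :: "'a \<Rightarrow> real^'n" where "\<phi> x = (\<chi> i. inner x (e i))" for x
  define \<psi> :: "real^'n \<Rightarrow> 'a" where "\<psi> y = (\<Sum>i\<in>UNIV. (y $ i) *\<^sub>R e i)" for y
  have eB: "e i \<in> Basis" for i using e by (auto simp: bij_betw_def)
  have e_in: "inner (e i) (e j) = (if i = j then 1 else 0)" for i j
    using e eB[of i] eB[of j] by (auto simp: inner_Basis bij_betw_def dest: injD)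
  have lin: "linear \<phi>" "linear \<psi>"
    by (auto intro!: linearI simp: \<phi>_def \<psi>_def Finite_Cartesian_Product.vec_eq_iff inner_simps scaleR_left_distrib
        sum.distrib scaleR_sum_right)
  have pe: "inner (\<psi> y) (e j) = y $ j" for y j
    by (simp add: \<psi>_def inner_sum_left e_in if_distrib[where f="\<lambda>x. _ * x"] cong: if_cong)
  have id1: "\<phi> (\<psi> y) = y" for y
    by (simp add: \<phi>_def pe Finite_Cartesian_Product.vec_eq_iff)
  have id2: "\<psi> (\<phi> x) = x" for x
  proof -
    have "\<psi> (\<phi> x) = (\<Sum>i\<in>UNIV. inner x (e i) *\<^sub>R e i)" by (simp add: \<phi>_def \<psi>_def)
    also have "\<dots> = (\<Sum>b\<in>Basis. inner x b *\<^sub>R b)"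
      by (rule sum.reindex_bij_betw[OF e])
    finally show ?thesis by (simp add: euclidean_representation)
  qed
  have m: "\<psi> \<in> borel_measurable borel"
    using lin by (simp add: linear_continuous_on linear_conv_bounded_linear borel_measurable_continuous_onI)
  \<comment> \<open>Lebesgue measure is characterised by the volumes of boxes, and the preimage of a
    box is a box with the same side lengths, indexed differently.\<close>
  have "lborel = distr lborel borel \<psi>"
  proof (rule lborel_eqI)
    fix l u :: 'a assume lu: "\<And>b. b \<in> Basis \<Longrightarrow> inner l b \<le> inner u b"
    have pre: "\<psi> -` box l u = box (\<phi> l) (\<phi> u)"
    proof -
      have "\<psi> y \<in> box l u \<longleftrightarrow> (\<forall>i. inner l (e i) < inner (\<psi> y) (e i) \<and> inner (\<psi> y) (e i) < inner u (e i))" for y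
        using e unfolding mem_box bij_betw_def by (metis eB rangeE)
      then show ?thesis by (auto simp: pe mem_box_cart \<phi>_def)
    qed
    have "emeasure (distr lborel borel \<psi>) (box l u) = emeasure lborel (box (\<phi> l) (\<phi> u))"
      using m by (subst emeasure_distr) (auto simp: pre)
    also have "\<dots> = (\<Prod>b\<in>Basis. inner (\<phi> u - \<phi> l) b)"
      using lu eB by (subst emeasure_lborel_box) (auto simp: Basis_vec_def inner_axis \<phi>_def)
    also have "(\<Prod>b\<in>Basis. inner (\<phi> u - \<phi> l) b) = (\<Prod>i\<in>UNIV. (\<phi> u - \<phi> l) $ i)"
      by (simp add: Basis_vec_def UNION_singleton_eq_range prod.reindex inj_on_def axis_eq_axis inner_axis)
    also have "\<dots> = (\<Prod>i\<in>UNIV. inner (u - l) (e i))" by (simp add: \<phi>_def inner_simps)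
    also have "\<dots> = (\<Prod>b\<in>Basis. inner (u - l) b)" by (rule prod.reindex_bij_betw[OF e])
    finally show "emeasure (distr lborel borel \<psi>) (box l u) = (\<Prod>b\<in>Basis. inner (u - l) b)" .
  qed simp
  with lin id1 id2 show ?thesis by metis
qed

lemma integral_compact_lborel:
  fixes f :: "'a::euclidean_space \<Rightarrow> real"
  assumes "compact S" "continuous_on S f"
  shows "integral S f = (LINT x|lborel. indicator S x * f x)"
proof -
  have "set_integrable lborel S f"
    using borel_integrable_compact[OF assms] by (simp add: set_integrable_def)
  then show ?thesis by (subst set_borel_integral_eq_integral(2)[symmetric]) (auto simp: set_lebesgue_integral_def)
qed

text \<open>Pushing \<open>lborel\<close> forward moves the integral along a measure-preserving
  homeomorphism. Two such maps occur: the identification with coordinate vectors, and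
  translations.\<close>

lemma integral_compact_homeomorphism:
  fixes f :: "'a::euclidean_space \<Rightarrow> real" and \<phi> :: "'a \<Rightarrow> 'b::euclidean_space"
  assumes "continuous_on UNIV \<phi>" "continuous_on UNIV \<psi>" "\<And>x. \<psi> (\<phi> x) = x" "\<And>y. \<phi> (\<psi> y) = y"
    "distr lborel borel \<psi> = lborel" "compact S" "continuous_on S f"
  shows "integral S f = integral (\<phi> ` S) (f \<circ> \<psi>)"
proof -
  have c: "continuous_on X \<psi>" "continuous_on X' \<phi>" for X X'
    using assms(1,2) by (auto intro: continuous_on_subset)
  have S: "\<psi> ` \<phi> ` S = S" using assms(3) by (auto simp: image_image)
  have m: "\<psi> \<in> borel_measurable borel" using c by (simp add: borel_measurable_continuous_onI)
  have "(\<lambda>x. indicator S x *\<^sub>R f x) \<in> borel_measurable borel"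
    using borel_measurable_continuous_on_indicator[of S f] assms by (auto simp: compact_imp_closed borel_closed)
  then have m': "(\<lambda>x. indicator S x * f x) \<in> borel_measurable borel" by simp
  have "integral S f = (LINT x|distr lborel borel \<psi>. indicator S x * f x)"
    using integral_compact_lborel assms by simp
  also have "\<dots> = (LINT y|lborel. indicator S (\<psi> y) * f (\<psi> y))"
    using m m' by (subst integral_distr) auto
  also have "\<dots> = (LINT y|lborel. indicator (\<phi> ` S) y * (f \<circ> \<psi>) y)"
  proof -
    have "indicat_real S (\<psi> y) = indicator (\<phi> ` S) y" for y :: 'b
      using assms(3,4) by (metis image_eqI indicator_simps imageE)
    then show ?thesis by simp
  qed
  also have "\<dots> = integral (\<phi> ` S) (f \<circ> \<psi>)"
  proof (rule integral_compact_lborel[symmetric])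
    show "compact (\<phi> ` S)" using assms c by (intro compact_continuous_image)
    show "continuous_on (\<phi> ` S) (f \<circ> \<psi>)"
      by (rule continuous_on_compose) (use c S assms in auto)
  qed
  finally show ?thesis .
qed

text \<open>The library's change of variables is stated for \<open>real^'n\<close>; hence the index type.\<close>

lemma integral_linear_image_proportional_aux:
  fixes L :: "'a::euclidean_space \<Rightarrow> 'a"
  assumes card: "CARD('n::{finite,wellorder}) = DIM('a)" and L: "linear L"
  shows "\<exists>k\<ge>0. \<forall>S f. compact S \<and> continuous_on (L ` S) f \<longrightarrow>
    integral (L ` S) f = k * integral S (f \<circ> L :: 'a \<Rightarrow> real)"
proof -
  obtain \<phi> :: "'a \<Rightarrow> (real,'n) Finite_Cartesian_Product.vec" and \<psi> where lin: "linear \<phi>" "linear \<psi>"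
    and id: "\<And>x. \<psi> (\<phi> x) = x" "\<And>y. \<phi> (\<psi> y) = y" and d: "distr lborel borel \<psi> = lborel"
    using lborel_isometry_vec[OF card] by metis
  define L' where "L' = \<phi> \<circ> L \<circ> \<psi>"
  have L': "linear L'" unfolding L'_def by (intro linear_compose lin L)
  have c: "continuous_on X \<psi>" "continuous_on X' \<phi>" "continuous_on Y L" for X X' Y
    using lin L by (simp_all add: linear_continuous_on linear_conv_bounded_linear)
  have "integral (L ` S) f = \<bar>Determinants.det (matrix L')\<bar> * integral S (f \<circ> L)"
    if S: "compact S" and f: "continuous_on (L ` S) f" for S and f :: "'a \<Rightarrow> real"
  proof -
    have LS: "compact (L ` S)" using S c by (intro compact_continuous_image)
    have img: "\<phi> ` L ` S = L' ` \<phi> ` S" by (simp add: L'_def image_image id)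
    have cf: "continuous_on (L' ` \<phi> ` S) (f \<circ> \<psi>)"
      using f unfolding img[symmetric]
      by (intro continuous_on_compose c) (simp add: image_image id)
    have ai: "(f \<circ> \<psi>) absolutely_integrable_on (L' ` \<phi> ` S)"
      by (metis LS absolutely_integrable_continuous_real cf compact_continuous_image c(2) img absolutely_integrable_on_def
          borel_integrable_compact set_integrable_def integrable_completion borel_measurable_integrable)
    have "integral (L ` S) f = integral (L' ` \<phi> ` S) (f \<circ> \<psi>)"
      using integral_compact_homeomorphism[OF c(2,1) id d LS f] by (simp add: img)
    also have "\<dots> = \<bar>Determinants.det (matrix L')\<bar> * integral (\<phi> ` S) ((f \<circ> \<psi>) \<circ> L')"
    proof -
      \<comment> \<open>The determinant formula is for vector-valued integrands; the real function
        is read as a vector with one component.\<close>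
      define F :: "_ \<Rightarrow> (real,1) Finite_Cartesian_Product.vec"
        where "F = (\<lambda>x. \<chi> i. (f \<circ> \<psi>) x)"
      have "integral (L' ` \<phi> ` S) F = \<bar>Determinants.det (matrix L')\<bar> *\<^sub>R integral (\<phi> ` S) (F \<circ> L')"
        using ai by (intro integral_change_of_variables_linear L')
         (simp add: absolutely_integrable_on_1_iff F_def o_def)
      then have "integral (L' ` \<phi> ` S) F $ 1 = \<bar>Determinants.det (matrix L')\<bar> * integral (\<phi> ` S) (F \<circ> L') $ 1"
        by simp
      then show ?thesis by (simp add: integral_on_1_eq F_def o_def)
    qed
    also have "(f \<circ> \<psi>) \<circ> L' = (f \<circ> L) \<circ> \<psi>" by (auto simp: L'_def id)
    also have "integral (\<phi> ` S) ((f \<circ> L) \<circ> \<psi>) = integral S (f \<circ> L)"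
      by (rule integral_compact_homeomorphism[OF c(2,1) id d S, symmetric])
         (use f in \<open>intro continuous_on_compose c\<close>)
    finally show ?thesis .
  qed
  then show ?thesis by (meson abs_ge_zero)
qed

text \<open>The factor is the modulus of a determinant, but only its independence of
  \<open>S\<close> and \<open>f\<close> is kept: its value is found later by testing with the
  constant function 1. The restriction on the dimension enters here, through the index types
  \<open>1\<close>, \<open>2\<close> and \<open>3\<close>.\<close>

lemma integral_linear_image_proportional:
  fixes L :: "'a::euclidean_space \<Rightarrow> 'a"
  assumes "DIM('a) \<in> {1, 2, 3}" and "linear L"
  obtains k where "k \<ge> 0" "\<And>S f. compact S \<Longrightarrow> continuous_on (L ` S) f \<Longrightarrow>
    integral (L ` S) f = k * integral S (f \<circ> L :: 'a \<Rightarrow> real)"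
proof -
  have "CARD(1) = DIM('a) \<or> CARD(2) = DIM('a) \<or> CARD(3) = DIM('a)" using assms by auto
  then show ?thesis
    using that integral_linear_image_proportional_aux[where 'n=1, OF _ assms(2)]
      integral_linear_image_proportional_aux[where 'n=2, OF _ assms(2)]
      integral_linear_image_proportional_aux[where 'n=3, OF _ assms(2)]
    by (elim disjE) metis+
qed

text \<open>Translations preserve \<open>lborel\<close>, so the factor of the linear part also
  serves the affine map.\<close>

lemma integral_affine_image_proportional:
  fixes L :: "'a::euclidean_space \<Rightarrow> 'a"
  assumes "DIM('a) \<in> {1, 2, 3}" and L: "linear L" and T: "\<And>x. T x = L x + a"
  obtains k where "\<And>S f. compact S \<Longrightarrow> continuous_on (T ` S) f \<Longrightarrow>
    integral (T ` S) f = k * integral S (f \<circ> T :: 'a \<Rightarrow> real)"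
proof -
  obtain k where k: "\<And>S f. compact S \<Longrightarrow> continuous_on (L ` S) f \<Longrightarrow>
    integral (L ` S) f = k * integral S (f \<circ> L :: 'a \<Rightarrow> real)"
    using integral_linear_image_proportional[OF assms(1,2)] by metis
  have "integral (T ` S) f = k * integral S (f \<circ> T)"
    if S: "compact S" and f: "continuous_on (T ` S) f" for S and f :: "'a \<Rightarrow> real"
  proof -
    have cL: "continuous_on S L"
      using L by (simp add: linear_continuous_on linear_conv_bounded_linear)
    have img: "(\<lambda>x. x - a) ` T ` S = L ` S" "(\<lambda>x. x + a) ` L ` S = T ` S"
      by (auto simp: T image_image)
    have cT: "compact (T ` S)"
      unfolding img(2)[symmetric] by (intro compact_continuous_image cL S continuous_intros)
    have "distr lborel borel (\<lambda>x. x + a) = lborel"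
      using lborel_distr_plus[of a] by (simp add: add.commute cong: distr_cong)
    then have "integral (T ` S) f = integral ((\<lambda>x. x - a) ` T ` S) (f \<circ> (\<lambda>x. x + a))"
      by (intro integral_compact_homeomorphism cT f) (auto intro!: continuous_intros)
    also have "\<dots> = k * integral S (f \<circ> (\<lambda>x. x + a) \<circ> L)"
      unfolding img(1) using f by (intro k S continuous_on_compose continuous_intros) (simp add: img)
    finally show ?thesis by (simp add: o_def T)
  qed
  then show ?thesis by (rule that)
qed

lemma integrable_on_compact:
  fixes f :: "'a::euclidean_space \<Rightarrow> real"
  assumes "compact S" "continuous_on S f"
  shows "f integrable_on S"
  using set_borel_integral_eq_integral(1)[of S f] borel_integrable_compact[OF assms]
  by (simp add: set_integrable_def)

text \<open>Subtracting another vertex \<open>c0\<close> makes the remaining vertices linearly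
  independent; a linear functional can be prescribed on these differences, and its adjoint at 1 is
  the gradient. The value at \<open>c0\<close> fixes the additive constant.\<close>

lemma barycentric_coordinate_exists:
  fixes C :: "'a::euclidean_space set"
  assumes C: "\<not> affine_dependent C" "c \<in> C"
  shows "\<exists>g h. \<forall>c'\<in>C. inner g c' + h = (if c' = c then 1 else 0)"
proof (cases "C = {c}")
  case True
  then show ?thesis by (intro exI[of _ 0] exI[of _ 1]) auto
next
  case False
  then obtain c0 where c0: "c0 \<in> C" "c0 \<noteq> c" using C by auto
  have "independent ((\<lambda>x. - c0 + x) ` (C - {c0}))"
    using C affine_dependent_iff_dependent2[OF c0(1)] by auto
  from linear_independent_extend[OF this, of "\<lambda>v. if v = - c0 + c then 1 else 0"]
  obtain f :: "'a \<Rightarrow> real" where f: "linear f"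
    "\<And>x. x \<in> C - {c0} \<Longrightarrow> f (- c0 + x) = (if x = c then 1 else 0)" by auto
  have fi: "f x = inner (adjoint f 1) x" for x
    using adjoint_works[OF f(1), of x 1] by (simp add: inner_commute)
  have "inner (adjoint f 1) c' + - inner (adjoint f 1) c0 = (if c' = c then 1 else 0)" if "c' \<in> C" for c'
    using f(2)[of c'] that c0 by (cases "c' = c0") (auto simp: fi inner_simps)
  then show ?thesis by blast
qed

section \<open>Barycentric coordinates and their second moments on one simplex\<close>

locale simplex_coordinates =
  fixes C :: "'a::euclidean_space set" and g :: "'a \<Rightarrow> 'a" and h :: "'a \<Rightarrow> real"
  assumes fin: "finite C"
    and delta: "\<And>c c'. c \<in> C \<Longrightarrow> c' \<in> C \<Longrightarrow> inner (g c) c' + h c = (if c' = c then 1 else 0)"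
begin

definition lam :: "'a \<Rightarrow> 'a \<Rightarrow> real" where "lam c x = inner (g c) x + h c"

lemma lam_comb:
  assumes "c \<in> C" "sum u C = 1"
  shows "lam c (\<Sum>c'\<in>C. u c' *\<^sub>R c') = u c"
proof -
  have "lam c (\<Sum>c'\<in>C. u c' *\<^sub>R c') = (\<Sum>c'\<in>C. u c' * (inner (g c) c' + h c))"
    by (simp add: lam_def inner_sum_right distrib_left sum.distrib assms(2) flip: sum_distrib_right)
  also have "\<dots> = (\<Sum>c'\<in>C. if c' = c then u c' else 0)"
    using delta assms by (intro sum.cong) auto
  finally show ?thesis using assms fin by simp
qed

text \<open>\<open>lam\<close> recovers the weights of any convex representation of
  \<open>x\<close>, so these affine functions inherit the properties of the weights on the
  hull.\<close>

lemma hull_lam: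
  assumes "x \<in> convex hull C"
  shows "c \<in> C \<Longrightarrow> 0 \<le> lam c x" "(\<Sum>c\<in>C. lam c x) = 1" "(\<Sum>c\<in>C. lam c x *\<^sub>R c) = x"
proof -
  from assms obtain u where u: "\<forall>c\<in>C. 0 \<le> u c" "sum u C = 1" "(\<Sum>c\<in>C. u c *\<^sub>R c) = x"
    by (auto simp: convex_hull_finite[OF fin])
  then have "lam c x = u c" if "c \<in> C" for c using lam_comb[OF that u(2)] by simp
  then show "c \<in> C \<Longrightarrow> 0 \<le> lam c x" "(\<Sum>c\<in>C. lam c x) = 1" "(\<Sum>c\<in>C. lam c x *\<^sub>R c) = x"
    using u by auto
qed

lemma lam_le_1: "x \<in> convex hull C \<Longrightarrow> c \<in> C \<Longrightarrow> lam c x \<le> 1"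
  using hull_lam[of x] fin member_le_sum[of c C "\<lambda>c. lam c x"] by auto

lemma affine_eq_lam:
  assumes "x \<in> convex hull C"
  shows "inner a x + b = (\<Sum>c\<in>C. (inner a c + b) * lam c x)"
proof -
  have "inner a x + b = inner a (\<Sum>c\<in>C. lam c x *\<^sub>R c) + b * (\<Sum>c\<in>C. lam c x)"
    using hull_lam[OF assms] by simp
  also have "\<dots> = (\<Sum>c\<in>C. inner a c * lam c x + b * lam c x)"
    by (simp add: inner_sum_right sum_distrib_left sum.distrib mult.commute)
  also have "\<dots> = (\<Sum>c\<in>C. (inner a c + b) * lam c x)"
    by (simp add: distrib_right)
  finally show ?thesis .
qed

lemma continuous_lam [continuous_intros]: "continuous_on S (lam c)"
  unfolding lam_def[abs_def] by (intro continuous_intros)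

lemma compact_hull: "compact (convex hull C)"
  using fin by (simp add: finite_imp_compact_convex_hull)

text \<open>Motion parallel to the edge from \<open>j\<close> to \<open>i\<close> trades weight of
  \<open>j\<close> for weight of \<open>i\<close> and affects no other vertex. Both maps of the
  simplex used below move points this way.\<close>

lemma lam_move:
  assumes "i \<in> C" "j \<in> C" "c \<in> C"
  shows "lam c (x + t *\<^sub>R (i - j)) = lam c x + t * ((if c = i then 1 else 0) - (if c = j then 1 else 0))"
proof -
  have "inner (g c) (i - j) = (inner (g c) i + h c) - (inner (g c) j + h c)" by (simp add: inner_simps)
  then have "inner (g c) (i - j) = (if c = i then 1 else 0) - (if c = j then 1 else 0)"
    using delta assms by auto
  then show ?thesis by (simp add: lam_def inner_add_right)
qed

lemma hull_move:
  assumes "i \<in> C" "j \<in> C" "i \<noteq> j" and x: "x \<in> convex hull C" and t: "- lam i x \<le> t" "t \<le> lam j x"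
  shows "x + t *\<^sub>R (i - j) \<in> convex hull C"
proof -
  define u where "u c = lam c x + t * ((if c = i then 1 else 0) - (if c = j then 1 else 0))" for c
  have su: "sum f C = f i + f j + sum f (C - {i, j})" for f :: "'a \<Rightarrow> 'b::real_vector"
    using sum.subset_diff[of "{i, j}" C f] assms fin by (simp add: add.commute)
  have "0 \<le> u c" if "c \<in> C" for c using hull_lam(1)[OF x that] t assms(3) by (auto simp: u_def)
  moreover have "sum u C = 1" using hull_lam(2)[OF x] assms(3) by (simp add: su u_def)
  moreover have "(\<Sum>c\<in>C. u c *\<^sub>R c) = x + t *\<^sub>R (i - j)"
  proof -
    have "(\<Sum>c\<in>C. u c *\<^sub>R c) = (\<Sum>c\<in>C. lam c x *\<^sub>R c) + t *\<^sub>R (i - j)"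
      using assms(3) by (simp add: su u_def algebra_simps)
    then show ?thesis using hull_lam(3)[OF x] by simp
  qed
  ultimately show ?thesis by (auto simp: convex_hull_finite[OF fin])
qed

text \<open>With \<open>v = i - j\<close> one family covers both maps: \<open>r = -1\<close>,
  \<open>s = 1\<close> exchanges the vertices \<open>i\<close> and \<open>j\<close>, while
  \<open>r = 0\<close>, \<open>s = 1/2\<close> sends \<open>j\<close> to the midpoint of the
  edge.\<close>

lemma affine_move_integral:
  assumes "DIM('a) \<in> {1, 2, 3}"
  obtains k where "\<And>S f. compact S \<Longrightarrow> continuous_on UNIV f \<Longrightarrow>
    integral ((\<lambda>x. x + (r * lam i x + s * lam j x) *\<^sub>R v) ` S) f =
      k * integral S (\<lambda>x. f (x + (r * lam i x + s * lam j x) *\<^sub>R v) :: real)"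
proof -
  define w where "w = r *\<^sub>R g i + s *\<^sub>R g j"
  define L where "L x = x + inner w x *\<^sub>R v" for x
  define T where "T x = x + (r * lam i x + s * lam j x) *\<^sub>R v" for x
  have "linear L" by (rule linearI) (auto simp: L_def inner_simps algebra_simps)
  moreover have "T x = L x + (r * h i + s * h j) *\<^sub>R v" for x
    by (simp add: T_def L_def lam_def w_def inner_simps algebra_simps)
  ultimately obtain k where k: "\<And>S f. compact S \<Longrightarrow> continuous_on (T ` S) f \<Longrightarrow>
    integral (T ` S) f = k * integral S (f \<circ> T :: 'a \<Rightarrow> real)"
    using integral_affine_image_proportional[OF assms, of L T] by blast
  show ?thesis
  proof (rule that)
    fix S :: "'a set" and f :: "'a \<Rightarrow> real" assume "compact S" "continuous_on UNIV f"
    with k[of S f] show "integral ((\<lambda>x. x + (r * lam i x + s * lam j x) *\<^sub>R v) ` S) f =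
      k * integral S (\<lambda>x. f (x + (r * lam i x + s * lam j x) *\<^sub>R v))"
      by (auto simp: T_def[abs_def] o_def intro: continuous_on_subset)
  qed
qed

text \<open>Exchanging two vertices preserves volume; the map \<open>half\<close>, which sends \<open>j\<close> to the midpoint of
  \<open>i\<close> and \<open>j\<close>, maps the simplex onto the half where \<open>lam j \<le> lam i\<close>, hence halves volumes.\<close>

lemma second_moments_pair:
  assumes dim: "DIM('a) \<in> {1, 2, 3}" and vol: "0 < measure lebesgue (convex hull C)"
    and ij: "i \<in> C" "j \<in> C" "i \<noteq> j"
  defines "\<tau> \<equiv> convex hull C"
  shows "integral \<tau> (\<lambda>x. lam i x * lam j x) = integral \<tau> (\<lambda>x. lam j x * lam j x) / 2"
    and "integral \<tau> (\<lambda>x. lam i x * lam i x) = integral \<tau> (\<lambda>x. lam j x * lam j x)"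
proof -
  define swap where "swap x = x + ((-1) * lam i x + 1 * lam j x) *\<^sub>R (i - j)" for x
  define half where "half x = x + (0 * lam i x + (1/2) * lam j x) *\<^sub>R (i - j)" for x
  obtain k where k: "\<And>S f. compact S \<Longrightarrow> continuous_on UNIV f \<Longrightarrow>
    integral (swap ` S) f = k * integral S (\<lambda>x. f (swap x) :: real)"
    using affine_move_integral[OF dim, of "-1" i 1 j "i - j"] unfolding swap_def by blast
  obtain k' where k': "\<And>S f. compact S \<Longrightarrow> continuous_on UNIV f \<Longrightarrow>
    integral (half ` S) f = k' * integral S (\<lambda>x. f (half x) :: real)"
    using affine_move_integral[OF dim, of 0 i "1/2" j "i - j"] unfolding half_def by blast
  have C\<tau>: "compact \<tau>" using compact_hull by (simp add: \<tau>_def)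
  have lam_swap: "lam i (swap x) = lam j x" "lam j (swap x) = lam i x" for x
    using ij lam_move[OF ij(1,2)] by (simp_all add: swap_def)
  have lam_half: "lam i (half x) = lam i x + lam j x / 2" "lam j (half x) = lam j x / 2" for x
    using ij lam_move[OF ij(1,2)] by (simp_all add: half_def)
  have swap_in: "swap x \<in> \<tau>" if "x \<in> \<tau>" for x
    unfolding swap_def \<tau>_def using that hull_lam(1)[of x] ij by (intro hull_move) (auto simp: \<tau>_def)
  have swap2: "swap (swap x) = x" for x
    unfolding swap_def[of "swap x"] lam_swap by (simp add: swap_def algebra_simps)
  have swap_\<tau>: "swap ` \<tau> = \<tau>" using swap_in swap2 by (metis image_subsetI subsetI subset_antisym imageI)
  define H where "H = {x \<in> \<tau>. lam j x \<le> lam i x}"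
  have half_\<tau>: "half ` \<tau> = H"
  proof (intro equalityI subsetI)
    fix y assume "y \<in> half ` \<tau>"
    then obtain x where x: "x \<in> \<tau>" "y = half x" by auto
    have "half x \<in> \<tau>" unfolding half_def \<tau>_def
      using x hull_lam(1)[of x i] hull_lam(1)[of x j] ij by (intro hull_move) (auto simp: \<tau>_def)
    moreover have "0 \<le> lam i x" using x hull_lam(1)[of x] ij by (simp add: \<tau>_def)
    ultimately show "y \<in> H" using x lam_half[of x] by (simp add: H_def)
  next
    fix y assume y: "y \<in> H"
    \<comment> \<open>The preimage doubles the \<open>j\<close>-weight of \<open>y\<close> at the
      expense of its \<open>i\<close>-weight, which is possible because
      \<open>lam j y \<le> lam i y\<close> in \<open>H\<close>.\<close>
    define x where "x = y + (- lam j y) *\<^sub>R (i - j)"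
    have "0 \<le> lam j y" using y hull_lam(1)[of y] ij by (simp add: H_def \<tau>_def)
    then have "x \<in> \<tau>" unfolding x_def \<tau>_def using y ij by (intro hull_move) (auto simp: H_def \<tau>_def)
    moreover have "lam j x = 2 * lam j y" using ij lam_move[OF ij(1,2,2), of y "- lam j y"] by (simp add: x_def)
    then have "half x = y" by (simp add: half_def) (simp add: x_def)
    ultimately show "y \<in> half ` \<tau>" by blast
  qed
  have swap_H: "swap ` H = {x \<in> \<tau>. lam i x \<le> lam j x}"
  proof (intro equalityI subsetI)
    fix y assume "y \<in> swap ` H"
    then show "y \<in> {x \<in> \<tau>. lam i x \<le> lam j x}" using swap_in lam_swap by (auto simp: H_def)
  next
    fix y assume "y \<in> {x \<in> \<tau>. lam i x \<le> lam j x}"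
    then have "swap y \<in> H" using swap_in lam_swap by (auto simp: H_def)
    then show "y \<in> swap ` H" by (metis swap2 imageI)
  qed
  have "H = \<tau> \<inter> {x. lam j x \<le> lam i x}" by (auto simp: H_def)
  moreover have "closed {x. lam j x \<le> lam i x}"
    by (intro closed_Collect_le continuous_intros)
  ultimately have CH: "compact H" using C\<tau> by (simp add: compact_Int_closed)
  have C_swap: "continuous_on UNIV swap" unfolding swap_def[abs_def] by (intro continuous_intros)
  have CsH: "compact (swap ` H)" by (rule compact_continuous_image[OF continuous_on_subset[OF C_swap] CH]) simp
  have vol1: "integral \<tau> (\<lambda>x. 1) = measure lebesgue \<tau>"
    using C\<tau> by (simp add: lmeasure_integral lmeasurable_compact)
  \<comment> \<open>The exchange maps the simplex onto itself, so testing with 1 yields the factor;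
    positive volume permits the division.\<close>
  have k1: "k = 1" using k[OF C\<tau>, of "\<lambda>x. 1"] swap_\<tau> vol1 vol by (simp add: \<tau>_def)
  have null: "negligible (H \<inter> swap ` H)"
  proof -
    have "inner (g i - g j) i + (h i - h j) = 1" "inner (g i - g j) j + (h i - h j) = -1"
      using delta[of i i] delta[of i j] delta[of j i] delta[of j j] ij by (auto simp: inner_diff_left)
    then have "g i - g j \<noteq> 0" by auto
    then have "negligible {x. inner (g i - g j) x = h j - h i}" by (intro negligible_hyperplane) auto
    moreover have "H \<inter> swap ` H \<subseteq> {x. inner (g i - g j) x = h j - h i}"
      unfolding swap_H unfolding H_def by (auto simp: lam_def inner_diff_left)
    ultimately show ?thesis by (rule negligible_subset)
  qed
  have union: "\<tau> = H \<union> swap ` H" unfolding swap_H by (auto simp: H_def)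
  \<comment> \<open>The exchange swaps the two halves, so an invariant \<open>f\<close> has the same
    integral over both, and \<open>H\<close> is the image of the simplex under
    \<open>half\<close>.\<close>
  have sym: "integral \<tau> f = 2 * k' * integral \<tau> (\<lambda>x. f (half x))"
    if f: "continuous_on UNIV f" "\<And>x. f (swap x) = f x" for f :: "'a \<Rightarrow> real"
  proof -
    have "integral \<tau> f = integral H f + integral (swap ` H) f"
      unfolding union using null CH CsH f(1)
      by (intro integral_Un integrable_on_compact) (auto intro: continuous_on_subset)
    also have "integral (swap ` H) f = integral H f" using k[OF CH f(1)] k1 f(2) by simp
    also have "integral H f = k' * integral \<tau> (\<lambda>x. f (half x))" using k'[OF C\<tau> f(1)] by (simp add: half_\<tau>)
    finally show ?thesis by simp
  qed
  have k'1: "2 * k' = 1" using sym[of "\<lambda>x. 1"] vol1 vol by (simp add: \<tau>_def)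
  have int: "f integrable_on \<tau>" if "continuous_on UNIV f" for f :: "'a \<Rightarrow> real"
    using that C\<tau> by (auto intro: integrable_on_compact continuous_on_subset)
  let ?ij = "integral \<tau> (\<lambda>x. lam i x * lam j x)" and ?jj = "integral \<tau> (\<lambda>x. lam j x * lam j x)"
  \<comment> \<open>The product of the two coordinates is invariant under the exchange. Pulled back
    by \<open>half\<close> it becomes a combination of the same two moments, an equation to be
    solved for \<open>?ij\<close>.\<close>
  have "?ij = integral \<tau> (\<lambda>x. lam i (half x) * lam j (half x))"
    using sym[of "\<lambda>x. lam i x * lam j x"] k'1 by (simp add: continuous_intros lam_swap mult.commute)
  also have "\<dots> = integral \<tau> (\<lambda>x. (lam i x * lam j x) * (1/2) + (lam j x * lam j x) * (1/4))"
    by (simp add: lam_half algebra_simps)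
  also have "\<dots> = ?ij * (1/2) + ?jj * (1/4)"
    by (subst integral_add) (auto intro!: int continuous_intros)
  finally show "?ij = ?jj / 2" by simp
  have "integral \<tau> (\<lambda>x. lam j x * lam j x) = integral \<tau> (\<lambda>x. lam j (swap x) * lam j (swap x))"
    using k[OF C\<tau>, of "\<lambda>x. lam j x * lam j x"] by (simp add: swap_\<tau> k1 continuous_intros)
  then show "integral \<tau> (\<lambda>x. lam i x * lam i x) = ?jj" by (simp add: lam_swap)
qed

text \<open>The volume comes from squaring the identity that the coordinates sum to one:
  \<open>m\<close> diagonal terms \<open>a\<close> and \<open>m * (m - 1)\<close> mixed terms
  \<open>a / 2\<close>, with \<open>m\<close> the number of vertices. It later trades the volumes in
  the stiffness matrix for the mass scale \<open>a\<close>.\<close>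

lemma second_moments:
  assumes dim: "DIM('a) \<in> {1, 2, 3}" and vol: "0 < measure lebesgue (convex hull C)"
  obtains a where "0 < a"
    and "\<And>i j. i \<in> C \<Longrightarrow> j \<in> C \<Longrightarrow>
      integral (convex hull C) (\<lambda>x. lam i x * lam j x) = (if i = j then a else a / 2)"
    and "measure lebesgue (convex hull C) = real (card C) * (real (card C) + 1) / 2 * a"
proof -
  let ?\<tau> = "convex hull C"
  have "C \<noteq> {}" using vol by auto
  then obtain c0 where c0: "c0 \<in> C" by auto
  define a where "a = integral ?\<tau> (\<lambda>x. lam c0 x * lam c0 x)"
  have aj: "integral ?\<tau> (\<lambda>x. lam j x * lam j x) = a" if "j \<in> C" for j
    using second_moments_pair(2)[OF dim vol c0 that] by (cases "j = c0") (auto simp: a_def)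
  have mom: "integral ?\<tau> (\<lambda>x. lam i x * lam j x) = (if i = j then a else a / 2)"
    if "i \<in> C" "j \<in> C" for i j
    using second_moments_pair(1)[OF dim vol that] aj that by auto
  have int: "(\<lambda>x. lam i x * lam j x) integrable_on ?\<tau>" for i j
    by (intro integrable_on_compact compact_hull continuous_intros)
  have "measure lebesgue ?\<tau> = integral ?\<tau> (\<lambda>x. 1)"
    using compact_hull by (simp add: lmeasure_integral lmeasurable_compact)
  also have "\<dots> = integral ?\<tau> (\<lambda>x. \<Sum>i\<in>C. \<Sum>j\<in>C. lam i x * lam j x)"
    by (rule integral_cong) (simp add: hull_lam flip: sum_product)
  also have "\<dots> = (\<Sum>i\<in>C. \<Sum>j\<in>C. integral ?\<tau> (\<lambda>x. lam i x * lam j x))"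
    using fin int by (simp add: integral_sum integrable_sum)
  also have "\<dots> = (\<Sum>i\<in>C. \<Sum>j\<in>C. a / 2 + (if i = j then a / 2 else 0))"
    using mom by (intro sum.cong refl) auto
  also have "\<dots> = (\<Sum>i\<in>C. real (card C) * a / 2 + a / 2)"
    using fin by (intro sum.cong refl) (simp add: sum.distrib sum.delta)
  also have "\<dots> = real (card C) * (real (card C) + 1) / 2 * a" by (simp add: algebra_simps add_divide_distrib)
  finally have m: "measure lebesgue ?\<tau> = real (card C) * (real (card C) + 1) / 2 * a" .
  moreover have "0 < a"
  proof -
    have "0 \<le> real (card C) * (real (card C) + 1) / 2" by simp
    then show ?thesis using vol unfolding m by (meson mult_nonneg_nonpos not_less)
  qed
  ultimately show ?thesis using that mom by blast
qed

end


section \<open>Energy decrease of the preconditioned conjugate gradient method\<close>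

lemma sym_form_commute:
  fixes A :: "real mat"
  assumes "A \<in> carrier_mat m m" "transpose_mat A = A" "x \<in> carrier_vec m" "y \<in> carrier_vec m"
  shows "(A *\<^sub>v x) \<bullet> y = (A *\<^sub>v y) \<bullet> x"
  using assms transpose_vec_mult_scalar[of A m m x y]
  by (metis comm_scalar_prod mult_mat_vec_carrier)

text \<open>A negative leading coefficient contradicts nonnegativity at a large \<open>t\<close>,
  and a positive one is handled by the minimiser \<open>- b / c\<close>. The case
  \<open>c = 0\<close> occurs, since the forms to which this is applied may be only
  semidefinite.\<close>

lemma real_quadratic_discriminant:
  fixes a b c :: real
  assumes "\<And>t. 0 \<le> a + 2 * t * b + t\<^sup>2 * c"
  shows "b\<^sup>2 \<le> a * c"
proof (cases "c = 0")
  case True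
  have "b = 0"
  proof (rule ccontr)
    assume "b \<noteq> 0"
    \<comment> \<open>At this \<open>t\<close> the expression \<open>a + 2 * t * b\<close> equals
      -1.\<close>
    with assms[of "- (a + 1) / (2 * b)"] True show False by (simp add: field_simps)
  qed
  then show ?thesis using True by simp
next
  case False
  have "c \<ge> 0"
  proof (rule ccontr)
    assume "\<not> c \<ge> 0"
    then have c: "c < 0" by simp
    \<comment> \<open>Chosen so that \<open>t * (-c)\<close> exceeds
      \<open>\<bar>a\<bar> + 2 * \<bar>b\<bar>\<close>; since \<open>t \<ge> 1\<close>, the
      quadratic term then outweighs the others.\<close>
    define t where "t = 1 + \<bar>a\<bar> / (-c) + 2 * \<bar>b\<bar> / (-c)"
    have "0 \<le> \<bar>a\<bar> / (-c)" "0 \<le> 2 * \<bar>b\<bar> / (-c)" using c by (simp_all add: divide_nonneg_neg)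
    then have t: "t \<ge> 1" by (simp add: t_def)
    have t2: "t * (-c) = -c + \<bar>a\<bar> + 2 * \<bar>b\<bar>" using c by (simp add: t_def field_simps)
    have "t\<^sup>2 * (-c) = t * (-c) + t * \<bar>a\<bar> + 2 * t * \<bar>b\<bar>"
    proof -
      have "t\<^sup>2 * (-c) = t * (t * (-c))" by (simp add: power2_eq_square)
      also have "\<dots> = t * (-c) + t * \<bar>a\<bar> + 2 * t * \<bar>b\<bar>" by (subst t2) (simp add: algebra_simps)
      finally show ?thesis .
    qed
    moreover have "\<bar>a\<bar> \<le> t * \<bar>a\<bar>" "2 * t * b \<le> 2 * t * \<bar>b\<bar>"
      using t by (auto simp: mult_le_cancel_right1 mult_left_mono)
    moreover have "0 < t * (-c)" using t c by (simp add: mult_pos_neg)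
    ultimately show False using assms[of t] by linarith
  qed
  with False have c: "c > 0" by simp
  have "0 \<le> c * (a + 2 * (- b / c) * b + (- b / c)\<^sup>2 * c)" using assms[of "- b / c"] c by (intro mult_nonneg_nonneg) auto
  also have "\<dots> = a * c - b\<^sup>2" using c by (simp add: field_simps power2_eq_square)
  finally show ?thesis by simp
qed

lemma sym_form_add_smult:
  fixes A :: "real mat"
  assumes A: "A \<in> carrier_mat m m" "transpose_mat A = A" and v: "x \<in> carrier_vec m" "y \<in> carrier_vec m"
  shows "(A *\<^sub>v (x + t \<cdot>\<^sub>v y)) \<bullet> (x + t \<cdot>\<^sub>v y) =
    (A *\<^sub>v x) \<bullet> x + 2 * t * ((A *\<^sub>v x) \<bullet> y) + t\<^sup>2 * ((A *\<^sub>v y) \<bullet> y)"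
proof -
  have c: "A *\<^sub>v x \<in> carrier_vec m" "A *\<^sub>v y \<in> carrier_vec m" using A v by auto
  have "A *\<^sub>v (x + t \<cdot>\<^sub>v y) = A *\<^sub>v x + t \<cdot>\<^sub>v (A *\<^sub>v y)"
    using A v by (simp add: mult_add_distrib_mat_vec[of _ m m] mult_mat_vec[of _ m m])
  then show ?thesis using c v sym_form_commute[OF A v]
    by (simp add: add_scalar_prod_distrib[of _ m] scalar_prod_add_distrib[of _ m] power2_eq_square algebra_simps)
qed

lemma psd_form_cauchy_schwarz:
  assumes A: "A \<in> carrier_mat m m" "transpose_mat A = A"
    and psd: "\<And>v. v \<in> carrier_vec m \<Longrightarrow> 0 \<le> (A *\<^sub>v v) \<bullet> (v :: real vec)"
    and x: "x \<in> carrier_vec m" and y: "y \<in> carrier_vec m"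
  shows "((A *\<^sub>v x) \<bullet> y)\<^sup>2 \<le> ((A *\<^sub>v x) \<bullet> x) * ((A *\<^sub>v y) \<bullet> y)"
proof (rule real_quadratic_discriminant)
  fix t :: real
  show "0 \<le> (A *\<^sub>v x) \<bullet> x + 2 * t * ((A *\<^sub>v x) \<bullet> y) + t\<^sup>2 * ((A *\<^sub>v y) \<bullet> y)"
    using psd[of "x + t \<cdot>\<^sub>v y"] x y by (simp add: sym_form_add_smult[OF A x y])
qed

lemma sym_pos_def_nonneg:
  assumes "sym_pos_def A" "A \<in> carrier_mat m m" "v \<in> carrier_vec m"
  shows "0 \<le> (A *\<^sub>v v) \<bullet> v"
  using assms by (cases "v = 0\<^sub>v m") (auto simp: sym_pos_def_def less_imp_le)

text \<open>Definiteness excludes a kernel, so the Gauss-Jordan inverse behind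
  \<open>mat_inv\<close> exists and the unspecified case of that definition does not arise.\<close>

lemma sym_pos_def_inverse:
  assumes spd: "sym_pos_def P" and P: "P \<in> carrier_mat m m"
  shows "mat_inv P \<in> carrier_mat m m" "P * mat_inv P = 1\<^sub>m m" "mat_inv P * P = 1\<^sub>m m"
proof -
  have "det P \<noteq> 0"
  proof
    assume "det P = 0"
    then obtain v where v: "v \<in> carrier_vec m" "v \<noteq> 0\<^sub>v m" "P *\<^sub>v v = 0\<^sub>v m"
      using det_0_iff_vec_prod_zero_field[OF P] by auto
    then have "(P *\<^sub>v v) \<bullet> v = 0" by simp
    then show False using spd v P by (auto simp: sym_pos_def_def)
  qed
  then have "P \<in> Units (ring_mat TYPE(real) m ())" by (rule det_non_zero_imp_unit[OF P])
  then have "mat_inverse P \<noteq> None" using mat_inverse(1)[OF P, of "()"] by blast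
  then have "mat_inverse P = Some (mat_inv P)" by (auto simp: mat_inv_def)
  from mat_inverse(2)[OF P this]
  show "mat_inv P \<in> carrier_mat m m" "P * mat_inv P = 1\<^sub>m m" "mat_inv P * P = 1\<^sub>m m" by auto
qed

text \<open>Unlike the textbook invariants of the conjugate gradient method, these mention the current
  state only. The last one says that \<open>p - z\<close>, a multiple of the previous search direction, is
  \<open>A\<close>-orthogonal to \<open>p\<close>.\<close>

definition pcg_inv :: "real mat \<Rightarrow> real mat \<Rightarrow> nat \<Rightarrow> real vec \<Rightarrow> pcg_state \<Rightarrow> bool" where
  "pcg_inv A P m b = (\<lambda>(x, r, z, p).
     x \<in> carrier_vec m \<and> p \<in> carrier_vec m \<and> r = b - A *\<^sub>v x \<and> z = mat_inv P *\<^sub>v r \<and>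
     r \<bullet> p = r \<bullet> z \<and> (A *\<^sub>v p) \<bullet> z = (A *\<^sub>v p) \<bullet> p)"

locale pcg_setting =
  fixes A P :: "real mat" and m :: nat and c1 c2 :: real
  assumes spd: "sym_pos_def A" "sym_pos_def P"
    and carrier: "A \<in> carrier_mat m m" "P \<in> carrier_mat m m"
    and c: "0 < c1" "c1 \<le> c2"
    and lower: "\<And>v. v \<in> carrier_vec m \<Longrightarrow> c1 * ((A *\<^sub>v v) \<bullet> v) \<le> (P *\<^sub>v v) \<bullet> v"
    and upper: "\<And>v. v \<in> carrier_vec m \<Longrightarrow> (P *\<^sub>v v) \<bullet> v \<le> c2 * ((A *\<^sub>v v) \<bullet> v)"
begin

lemma sym: "transpose_mat A = A" "transpose_mat P = P"
  using spd by (auto simp: sym_pos_def_def)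

lemma P_inv: "mat_inv P \<in> carrier_mat m m" "r \<in> carrier_vec m \<Longrightarrow> P *\<^sub>v (mat_inv P *\<^sub>v r) = r"
  using sym_pos_def_inverse[OF spd(2) carrier(2)] carrier
  by (auto simp flip: assoc_mult_mat_vec[of _ m m _ m])

lemma A_zero: "v \<in> carrier_vec m \<Longrightarrow> (A *\<^sub>v v) \<bullet> v = 0 \<Longrightarrow> v = 0\<^sub>v m"
  using spd(1) carrier by (force simp: sym_pos_def_def)

lemma P_zero: "v \<in> carrier_vec m \<Longrightarrow> (P *\<^sub>v v) \<bullet> v = 0 \<Longrightarrow> v = 0\<^sub>v m"
  using spd(2) carrier by (force simp: sym_pos_def_def)

text \<open>This covers the iteration after convergence, where the definition divides by zero. Since
  \<open>r = P z\<close>, a vanishing \<open>r \<bullet> z\<close> gives \<open>z = 0\<close>; the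
  orthogonality in the invariant then turns the energy of \<open>p\<close> into
  \<open>(A *\<^sub>v p) \<bullet> z = 0\<close>.\<close>

lemma pcg_inv_zero:
  assumes "pcg_inv A P m b (x, r, z, p)" "b \<in> carrier_vec m" "r \<bullet> z = 0 \<or> p = 0\<^sub>v m"
  shows "r = 0\<^sub>v m" "z = 0\<^sub>v m" "p = 0\<^sub>v m"
proof -
  have r: "r \<in> carrier_vec m" "z \<in> carrier_vec m" "P *\<^sub>v z = r" "p \<in> carrier_vec m"
    using assms carrier P_inv by (auto simp: pcg_inv_def)
  have "r \<bullet> z = 0" using assms r by (auto simp: pcg_inv_def)
  then show z: "z = 0\<^sub>v m" using P_zero[of z] r by simp
  then show "r = 0\<^sub>v m" using r carrier by auto
  have "(A *\<^sub>v p) \<bullet> p = 0" using assms z carrier r by (simp add: pcg_inv_def split: prod.splits)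
  then show "p = 0\<^sub>v m" using A_zero r by blast
qed

lemma pcg_inv_init:
  assumes "b \<in> carrier_vec m" "x0 \<in> carrier_vec m"
  shows "pcg_inv A P m b (pcg_init A P b x0)"
  using assms carrier P_inv by (auto simp: pcg_inv_def pcg_init_def Let_def)

text \<open>The new residual is orthogonal to \<open>p\<close> by the choice of
  \<open>\<alpha>\<close> and to \<open>z\<close> by the invariant; symmetry of \<open>P\<close>
  turns the latter into orthogonality of \<open>r\<close> and \<open>z'\<close>. Then
  \<open>\<beta>\<close> is exactly the value that makes \<open>p'\<close>
  \<open>A\<close>-orthogonal to \<open>p\<close>.\<close>

lemma pcg_inv_step:
  assumes inv: "pcg_inv A P m b s" and b: "b \<in> carrier_vec m"
  shows "pcg_inv A P m b (pcg_step A P s)"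
proof -
  obtain x r z p where s: "s = (x, r, z, p)" by (cases s)
  have C: "x \<in> carrier_vec m" "r \<in> carrier_vec m" "z \<in> carrier_vec m" "p \<in> carrier_vec m"
    and r: "r = b - A *\<^sub>v x" and z: "z = mat_inv P *\<^sub>v r"
    and rp: "r \<bullet> p = r \<bullet> z" and Ap: "(A *\<^sub>v p) \<bullet> z = (A *\<^sub>v p) \<bullet> p"
    using inv b carrier P_inv by (auto simp: pcg_inv_def s)
  have CA: "A *\<^sub>v v \<in> carrier_vec m" "mat_inv P *\<^sub>v v \<in> carrier_vec m" if "v \<in> carrier_vec m" for v
    using carrier P_inv that by auto
  define \<alpha> where "\<alpha> = (r \<bullet> z) / ((A *\<^sub>v p) \<bullet> p)"
  define x' where "x' = x + \<alpha> \<cdot>\<^sub>v p"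
  define r' where "r' = r - \<alpha> \<cdot>\<^sub>v (A *\<^sub>v p)"
  define z' where "z' = mat_inv P *\<^sub>v r'"
  define \<beta> where "\<beta> = (r' \<bullet> z') / (r \<bullet> z)"
  define p' where "p' = z' + \<beta> \<cdot>\<^sub>v p"
  have C': "x' \<in> carrier_vec m" "r' \<in> carrier_vec m" "z' \<in> carrier_vec m" "p' \<in> carrier_vec m"
    using C CA by (auto simp: x'_def r'_def z'_def p'_def)
  have step: "pcg_step A P s = (x', r', z', p')"
    by (simp add: s Let_def \<alpha>_def x'_def r'_def z'_def \<beta>_def p'_def)
  have r'_eq: "r' = b - A *\<^sub>v x'"
    unfolding r'_def x'_def r using C carrier b
    by (auto simp: mult_add_distrib_mat_vec[of _ m m] mult_mat_vec[of _ m m])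
  have "r' \<bullet> p' = r' \<bullet> z' \<and> (A *\<^sub>v p') \<bullet> z' = (A *\<^sub>v p') \<bullet> p'"
  proof (cases "r \<bullet> z = 0 \<or> p = 0\<^sub>v m")
    case True
    \<comment> \<open>After convergence the quotients with zero denominator only multiply zero
      vectors.\<close>
    then have zero: "r = 0\<^sub>v m" "z = 0\<^sub>v m" "p = 0\<^sub>v m"
      using pcg_inv_zero inv b unfolding s by blast+
    have "p' = z'" using C' by (auto simp: p'_def zero)
    then show ?thesis by simp
  next
    case False
    then have rz: "r \<bullet> z \<noteq> 0" and pAp: "(A *\<^sub>v p) \<bullet> p \<noteq> 0" using A_zero C by auto
    then have a0: "\<alpha> \<noteq> 0" by (simp add: \<alpha>_def)
    have r'p: "r' \<bullet> p = 0" using C CA pAp rp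
      by (simp add: r'_def minus_scalar_prod_distrib[of _ m] smult_scalar_prod_distrib[of _ m] \<alpha>_def)
    have r'z: "r' \<bullet> z = 0" using C CA pAp Ap
      by (simp add: r'_def minus_scalar_prod_distrib[of _ m] smult_scalar_prod_distrib[of _ m] \<alpha>_def)
    have rz': "r \<bullet> z' = 0"
    proof -
      have "r \<bullet> z' = (P *\<^sub>v z) \<bullet> z'" using P_inv C z by simp
      also have "\<dots> = (P *\<^sub>v z') \<bullet> z" using sym_form_commute[of P m z z'] carrier sym C C' by simp
      also have "P *\<^sub>v z' = r'" using P_inv C' by (simp add: z'_def)
      finally show ?thesis using r'z by simp
    qed
    have "r' \<bullet> z' = r \<bullet> z' - \<alpha> * ((A *\<^sub>v p) \<bullet> z')"
      using C CA C' by (subst r'_def) (simp add: minus_scalar_prod_distrib[of _ m] smult_scalar_prod_distrib[of _ m])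
    \<comment> \<open>Solving the residual update for \<open>A p\<close> expresses this product
      through residuals; it is the term that \<open>\<beta>\<close> cancels.\<close>
    then have Apz': "(A *\<^sub>v p) \<bullet> z' = - (r' \<bullet> z') / \<alpha>" using rz' a0 by (simp add: field_simps)
    have p'z': "v \<bullet> p' = v \<bullet> z' + \<beta> * (v \<bullet> p)" if "v \<in> carrier_vec m" for v
      using that C' C by (simp add: p'_def scalar_prod_add_distrib[of _ m])
    have "(A *\<^sub>v p') \<bullet> p = (A *\<^sub>v p) \<bullet> p'" using sym_form_commute carrier sym C C' by blast
    also have "\<dots> = (A *\<^sub>v p) \<bullet> z' + \<beta> * ((A *\<^sub>v p) \<bullet> p)" using p'z' CA C by simp
    also have "\<dots> = 0" using rz pAp by (simp add: Apz' \<beta>_def \<alpha>_def)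
    finally show ?thesis using p'z'[OF C'(2)] p'z'[OF CA(1)[OF C'(4)]] r'p by simp
  qed
  then show ?thesis using C' r'_eq unfolding step pcg_inv_def by (simp add: z'_def)
qed

text \<open>The exact line search lowers the energy by \<open>\<alpha> * (r \<bullet> z)\<close>.
  The lower spectral bound gives \<open>c1 \<le> \<alpha>\<close>, the upper one
  \<open>(A *\<^sub>v e) \<bullet> e \<le> c2 * (r \<bullet> z)\<close>, and the two combine to the
  factor.\<close>

lemma energy_decrease:
  assumes inv: "pcg_inv A P m b s" and b: "b \<in> carrier_vec m"
    and X: "X \<in> carrier_vec m" "A *\<^sub>v X = b"
  defines "e \<equiv> X - fst s" and "e' \<equiv> X - fst (pcg_step A P s)"
  shows "(A *\<^sub>v e') \<bullet> e' \<le> (1 - c1 / c2) * ((A *\<^sub>v e) \<bullet> e)"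
proof -
  obtain x r z p where s: "s = (x, r, z, p)" by (cases s)
  have C: "x \<in> carrier_vec m" "r \<in> carrier_vec m" "z \<in> carrier_vec m" "p \<in> carrier_vec m"
    and r: "r = b - A *\<^sub>v x" and z: "z = mat_inv P *\<^sub>v r"
    and rp: "r \<bullet> p = r \<bullet> z" and Ap: "(A *\<^sub>v p) \<bullet> z = (A *\<^sub>v p) \<bullet> p"
    using inv b carrier P_inv by (auto simp: pcg_inv_def s)
  define \<alpha> where "\<alpha> = (r \<bullet> z) / ((A *\<^sub>v p) \<bullet> p)"
  have eC: "e \<in> carrier_vec m" using C X by (simp add: e_def s)
  have Ae: "A *\<^sub>v e = r" using C X carrier
    by (simp add: e_def s r mult_minus_distrib_mat_vec[of _ m m])
  have Pz: "P *\<^sub>v z = r" using P_inv C z by simp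
  have "e' = e + (- \<alpha>) \<cdot>\<^sub>v p" using C X by (auto simp: e'_def e_def s Let_def \<alpha>_def)
  then have Qe': "(A *\<^sub>v e') \<bullet> e' = (A *\<^sub>v e) \<bullet> e - 2 * \<alpha> * (r \<bullet> z) + \<alpha>\<^sup>2 * ((A *\<^sub>v p) \<bullet> p)"
    using sym_form_add_smult[OF carrier(1) sym(1) eC C(4), of "-\<alpha>"] Ae rp by simp
  have nn: "0 \<le> (A *\<^sub>v v) \<bullet> v" "0 \<le> (P *\<^sub>v v) \<bullet> v" if "v \<in> carrier_vec m" for v
    using that sym_pos_def_nonneg carrier spd by blast+
  have rz0: "0 \<le> r \<bullet> z" using nn(2)[OF C(3)] Pz by simp
  \<comment> \<open>Cauchy-Schwarz for the form of \<open>P\<close>, applied to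
    \<open>A e = r = P z\<close>.\<close>
  have Qe: "(A *\<^sub>v e) \<bullet> e \<le> c2 * (r \<bullet> z)"
  proof -
    let ?q = "(A *\<^sub>v e) \<bullet> e"
    have "?q = (P *\<^sub>v z) \<bullet> e" by (simp add: Ae Pz)
    then have "?q\<^sup>2 \<le> ((P *\<^sub>v z) \<bullet> z) * ((P *\<^sub>v e) \<bullet> e)"
      using psd_form_cauchy_schwarz[OF carrier(2) sym(2) nn(2) C(3) eC] by simp
    also have "\<dots> \<le> (r \<bullet> z) * (c2 * ?q)"
      unfolding Pz by (intro mult_left_mono upper eC rz0)
    finally have "?q * ?q \<le> ?q * (c2 * (r \<bullet> z))" by (simp add: power2_eq_square mult_ac)
    then show ?thesis using nn(1)[OF eC] c rz0
      by (cases "?q = 0") (auto simp: mult_le_cancel_left)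
  qed
  show ?thesis
  proof (cases "r \<bullet> z = 0")
    case True
    then show ?thesis using Qe' Qe nn(1)[OF eC] by (simp add: \<alpha>_def)
  next
    case False
    then have rz: "0 < r \<bullet> z" using rz0 by simp
    have p0: "p \<noteq> 0\<^sub>v m" using False rp C by auto
    then have pAp: "0 < (A *\<^sub>v p) \<bullet> p" using spd(1) C carrier by (auto simp: sym_pos_def_def)
    \<comment> \<open>Here the conjugacy of directions is used: \<open>p\<close> is the part of
      \<open>z\<close> that is \<open>A\<close>-orthogonal to the previous direction, hence not
      larger than \<open>z\<close> in energy, so its step length is at least that of steepest
      descent.\<close>
    have "((A *\<^sub>v p) \<bullet> z)\<^sup>2 \<le> ((A *\<^sub>v p) \<bullet> p) * ((A *\<^sub>v z) \<bullet> z)"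
      by (rule psd_form_cauchy_schwarz[OF carrier(1) sym(1) nn(1) C(4,3)])
    then have "(A *\<^sub>v p) \<bullet> p \<le> (A *\<^sub>v z) \<bullet> z" using pAp by (simp add: Ap power2_eq_square)
    then have "c1 * ((A *\<^sub>v p) \<bullet> p) \<le> c1 * ((A *\<^sub>v z) \<bullet> z)" using c by simp
    also have "\<dots> \<le> r \<bullet> z" using lower[OF C(3)] Pz by simp
    finally have "c1 \<le> (r \<bullet> z) / ((A *\<^sub>v p) \<bullet> p)" using pAp by (simp add: field_simps)
    then have "c1 * (r \<bullet> z) \<le> \<alpha> * (r \<bullet> z)" using rz unfolding \<alpha>_def by (intro mult_right_mono) auto
    moreover have "(A *\<^sub>v e') \<bullet> e' = (A *\<^sub>v e) \<bullet> e - \<alpha> * (r \<bullet> z)"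
      unfolding Qe' using pAp by (simp add: \<alpha>_def power2_eq_square)
    moreover have "c1 / c2 * ((A *\<^sub>v e) \<bullet> e) \<le> c1 * (r \<bullet> z)"
      using mult_left_mono[OF Qe, of "c1 / c2"] c by simp
    ultimately show ?thesis by (simp add: algebra_simps)
  qed
qed

lemma pcg_inv_iterate:
  assumes "b \<in> carrier_vec m" "x0 \<in> carrier_vec m"
  shows "pcg_inv A P m b ((pcg_step A P ^^ n) (pcg_init A P b x0))"
  using assms by (induction n) (auto intro: pcg_inv_init pcg_inv_step)

lemma pcg_converges:
  assumes b: "b \<in> carrier_vec m" "x0 \<in> carrier_vec m" and X: "X \<in> carrier_vec m" "A *\<^sub>v X = b"
  shows "energy_norm A (X - pcg A P b x0 n) \<le> sqrt (1 - c1 / c2) ^ n * energy_norm A (X - x0)"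
proof (induction n)
  case 0
  show ?case by (simp add: pcg_def pcg_init_def Let_def)
next
  case (Suc n)
  let ?s = "(pcg_step A P ^^ n) (pcg_init A P b x0)"
  have "energy_norm A (X - pcg A P b x0 (Suc n)) \<le>
    sqrt ((1 - c1 / c2) * ((A *\<^sub>v (X - fst ?s)) \<bullet> (X - fst ?s)))"
    unfolding energy_norm_def pcg_def using energy_decrease[OF pcg_inv_iterate[OF b] b(1) X] by simp
  also have "\<dots> = sqrt (1 - c1 / c2) * energy_norm A (X - pcg A P b x0 n)"
    by (simp add: energy_norm_def pcg_def real_sqrt_mult)
  also have "\<dots> \<le> sqrt (1 - c1 / c2) * (sqrt (1 - c1 / c2) ^ n * energy_norm A (X - x0))"
    using c by (intro mult_left_mono Suc.IH) auto
  finally show ?case by simp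
qed

end


section \<open>The Bramble--Pasciak matrices\<close>

text \<open>\<open>(C *\<^sub>v y) \<bullet> y\<close> is the squared dual \<open>C\<close>-norm of
  \<open>A x\<close>; in matrix terms, \<open>A \<le> c C\<close> implies
  \<open>A C\<^sup>-\<^sup>1 A \<le> c A\<close>. Cauchy-Schwarz for \<open>A\<close> leaves the
  quantity on both sides, and one factor cancels.\<close>

lemma dual_form_bound:
  fixes A C :: "real mat"
  assumes A: "A \<in> carrier_mat n n" "transpose_mat A = A"
    and psd: "\<And>v. v \<in> carrier_vec n \<Longrightarrow> 0 \<le> (A *\<^sub>v v) \<bullet> v"
    and C: "\<And>v. v \<in> carrier_vec n \<Longrightarrow> 0 \<le> (C *\<^sub>v v) \<bullet> v"
    and AC: "\<And>v. v \<in> carrier_vec n \<Longrightarrow> (A *\<^sub>v v) \<bullet> v \<le> c * ((C *\<^sub>v v) \<bullet> v)"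
    and x: "x \<in> carrier_vec n" and y: "y \<in> carrier_vec n" and eq: "C *\<^sub>v y = A *\<^sub>v x"
    and c: "0 \<le> c"
  shows "(C *\<^sub>v y) \<bullet> y \<le> c * ((A *\<^sub>v x) \<bullet> x)"
proof -
  let ?q = "(C *\<^sub>v y) \<bullet> y"
  have "?q * ?q = ((A *\<^sub>v x) \<bullet> y)\<^sup>2" by (simp add: eq power2_eq_square)
  also have "\<dots> \<le> ((A *\<^sub>v x) \<bullet> x) * ((A *\<^sub>v y) \<bullet> y)"
    by (rule psd_form_cauchy_schwarz[OF A psd x y])
  also have "\<dots> \<le> ((A *\<^sub>v x) \<bullet> x) * (c * ?q)" by (intro mult_left_mono AC y psd x)
  finally have "?q * ?q \<le> ?q * (c * ((A *\<^sub>v x) \<bullet> x))" by (simp add: mult_ac)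
  moreover have "0 \<le> c * ((A *\<^sub>v x) \<bullet> x)" using psd[OF x] c by simp
  ultimately show ?thesis using C[OF y] by (cases "?q = 0") (auto simp: mult_le_cancel_left)
qed

lemma transpose_eq_if_form_commute:
  fixes A :: "real mat"
  assumes A: "A \<in> carrier_mat n n"
    and comm: "\<And>x y. x \<in> carrier_vec n \<Longrightarrow> y \<in> carrier_vec n \<Longrightarrow> (A *\<^sub>v x) \<bullet> y = (A *\<^sub>v y) \<bullet> x"
  shows "transpose_mat A = A"
proof (rule eq_matI)
  fix i j assume "i < dim_row A" "j < dim_col A"
  then have ij: "i < n" "j < n" using A by auto
  have e: "(A *\<^sub>v unit_vec n k) \<bullet> unit_vec n l = A $$ (l, k)" if "k < n" "l < n" for k l
    using A that by simp
  show "transpose_mat A $$ (i, j) = A $$ (i, j)"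
    using comm[of "unit_vec n i" "unit_vec n j"] ij A e by simp
qed (use A in auto)

text \<open>The interface between linear algebra and finite elements. The sums are the form of
  \<open>C\<close>, whose entries are \<open>M $$ (i, i) / 4\<close>: thus \<open>M_lower\<close>
  says \<open>2 C \<le> M\<close>, and \<open>K_upper\<close> is the inverse inequality in scaled
  form. One \<open>c\<close> serves both upper bounds.\<close>

locale fem_matrices =
  fixes n :: nat and M K :: "real mat" and h c :: real
  assumes M: "M \<in> carrier_mat n n" "transpose_mat M = M"
    and K: "K \<in> carrier_mat n n" "transpose_mat K = K"
    and diag_pos: "\<And>i. i < n \<Longrightarrow> 0 < M $$ (i, i)"
    and c_pos: "0 < c"
    and M_lower: "\<And>v. v \<in> carrier_vec n \<Longrightarrow> 2 * (\<Sum>i<n. M $$ (i, i) / 4 * (v $ i)\<^sup>2) \<le> (M *\<^sub>v v) \<bullet> v"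
    and M_upper: "\<And>v. v \<in> carrier_vec n \<Longrightarrow> (M *\<^sub>v v) \<bullet> v \<le> c * (\<Sum>i<n. M $$ (i, i) / 4 * (v $ i)\<^sup>2)"
    and K_nonneg: "\<And>v. v \<in> carrier_vec n \<Longrightarrow> 0 \<le> (K *\<^sub>v v) \<bullet> v"
    and K_upper: "\<And>v. v \<in> carrier_vec n \<Longrightarrow>
      h\<^sup>2 * ((K *\<^sub>v v) \<bullet> v) \<le> c * (\<Sum>i<n. M $$ (i, i) / 4 * (v $ i)\<^sup>2)"
begin

definition C :: "real mat" where "C = (1/4) \<cdot>\<^sub>m diag_part M"

definition E :: "real mat" where
  "E = Matrix.mat n n (\<lambda>(i, j). if i = j then 4 / M $$ (i, i) else 0)"

definition A :: "real mat" where "A = bp_matrix (h ^ 4) M K ((1/4) \<cdot>\<^sub>m diag_part M)"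

definition P :: "real mat" where "P = four_block_mat (M - (1/4) \<cdot>\<^sub>m diag_part M) (0\<^sub>m n n) (0\<^sub>m n n) (diag_part M)"

text \<open>The first block row of the indefinite right factor in \<open>bp_matrix\<close>, with
  \<open>h\<^sup>2\<close> for \<open>sqrt \<rho>\<close>; applying \<open>E\<close> to it gives the
  vector called \<open>t\<close> throughout.\<close>

definition rho_load :: "real vec \<Rightarrow> real vec \<Rightarrow> real vec" where
  "rho_load v w = M *\<^sub>v v + h\<^sup>2 \<cdot>\<^sub>v (K *\<^sub>v w)"

lemma dims: "C \<in> carrier_mat n n" "E \<in> carrier_mat n n" "diag_part M \<in> carrier_mat n n"
  using M by (auto simp: diag_part_def E_def C_def)

lemma diag_mult_vec: "v \<in> carrier_vec n \<Longrightarrow> i < n \<Longrightarrow> (diag_part M *\<^sub>v v) $ i = M $$ (i, i) * v $ i"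
  using M by (simp add: diag_part_def scalar_prod_def row_def if_distrib[where f="\<lambda>x. x * _"] cong: if_cong)

lemma C_mult_vec: "v \<in> carrier_vec n \<Longrightarrow> i < n \<Longrightarrow> (C *\<^sub>v v) $ i = M $$ (i, i) / 4 * v $ i"
  using dims(3) diag_mult_vec[of v i] unfolding C_def
  by (simp add: smult_scalar_prod_distrib[of _ n])

lemma E_mult_vec: "v \<in> carrier_vec n \<Longrightarrow> i < n \<Longrightarrow> (E *\<^sub>v v) $ i = 4 / M $$ (i, i) * v $ i"
  by (simp add: E_def scalar_prod_def row_def if_distrib[where f="\<lambda>x. x * _"] cong: if_cong)

lemma C_form: "v \<in> carrier_vec n \<Longrightarrow> (C *\<^sub>v v) \<bullet> v = (\<Sum>i<n. M $$ (i, i) / 4 * (v $ i)\<^sup>2)"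
  unfolding scalar_prod_def lessThan_atLeast0
  by (intro sum.cong) (auto simp: C_mult_vec power2_eq_square simp del: index_mult_mat_vec)

lemma diag_form: "v \<in> carrier_vec n \<Longrightarrow> (diag_part M *\<^sub>v v) \<bullet> v = 4 * ((C *\<^sub>v v) \<bullet> v)"
  unfolding scalar_prod_def sum_distrib_left
  by (intro sum.cong) (auto simp: diag_mult_vec C_mult_vec simp del: index_mult_mat_vec)

lemma C_sym: "transpose_mat C = C"
  using M by (intro eq_matI) (auto simp: diag_part_def C_def)

lemma C_nonneg: "v \<in> carrier_vec n \<Longrightarrow> 0 \<le> (C *\<^sub>v v) \<bullet> v"
  unfolding C_form by (intro sum_nonneg mult_nonneg_nonneg) (auto intro!: divide_nonneg_pos less_imp_le[OF diag_pos])

lemma C_pos: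
  assumes v: "v \<in> carrier_vec n" "v \<noteq> 0\<^sub>v n"
  shows "0 < (C *\<^sub>v v) \<bullet> v"
proof -
  obtain i where i: "i < n" "v $ i \<noteq> 0" using v by (metis eq_vecI carrier_vecD index_zero_vec)
  then have "0 < M $$ (i, i) / 4 * (v $ i)\<^sup>2" using diag_pos by simp
  also have "\<dots> \<le> (C *\<^sub>v v) \<bullet> v"
    unfolding C_form[OF v(1)] using i less_imp_le[OF diag_pos]
    by (intro member_le_sum[of i "{..<n}" "\<lambda>i. M $$ (i, i) / 4 * (v $ i)\<^sup>2"]) auto
  finally show ?thesis .
qed

lemma CE: "C * E = 1\<^sub>m n" "E * C = 1\<^sub>m n"
proof -
  have "(C * E) $$ (i, j) = (if i = j then 1 else 0)" "(E * C) $$ (i, j) = (if i = j then 1 else 0)"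
    if ij: "i < n" "j < n" for i j
  proof -
    have "(C * E) $$ (i, j) = (\<Sum>k = 0..<n. C $$ (i, k) * E $$ (k, j))"
      using ij dims by (simp add: scalar_prod_def)
    also have "\<dots> = (\<Sum>k = 0..<n. if k = j then (if i = j then 1 else 0) else 0)"
      using ij M diag_pos[of j] by (intro sum.cong) (auto simp: E_def C_def diag_part_def)
    finally show "(C * E) $$ (i, j) = (if i = j then 1 else 0)" using ij by simp
    have "(E * C) $$ (i, j) = (\<Sum>k = 0..<n. E $$ (i, k) * C $$ (k, j))"
      using ij dims by (simp add: scalar_prod_def)
    also have "\<dots> = (\<Sum>k = 0..<n. if k = j then (if i = j then 1 else 0) else 0)"
      using ij M diag_pos[of j] by (intro sum.cong) (auto simp: E_def C_def diag_part_def)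
    finally show "(E * C) $$ (i, j) = (if i = j then 1 else 0)" using ij by simp
  qed
  then show "C * E = 1\<^sub>m n" "E * C = 1\<^sub>m n"
    using dims by (auto intro!: eq_matI)
qed

lemma mv_carrier [simp]: "B \<in> carrier_mat n n \<Longrightarrow> x \<in> carrier_vec n \<Longrightarrow> B *\<^sub>v x \<in> carrier_vec n"
  by (rule mult_mat_vec_carrier)

lemma minus_mat_carrier [simp]: "B \<in> carrier_mat n n \<Longrightarrow> B' \<in> carrier_mat n n \<Longrightarrow> B - B' \<in> carrier_mat n n"
  by (rule minus_carrier_mat)

lemma mat_inv_C: "mat_inv C = E"
proof -
  have "sym_pos_def C" using C_sym C_pos dims by (auto simp: sym_pos_def_def)
  note inv = sym_pos_def_inverse[OF this dims(1)]
  have "mat_inv C = (E * C) * mat_inv C" using inv CE by simp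
  also have "\<dots> = E * (C * mat_inv C)" by (rule assoc_mult_mat[OF dims(2,1) inv(1)])
  also have "\<dots> = E" using inv dims by simp
  finally show ?thesis .
qed

lemma sqrt_h_power4: "sqrt (h ^ 4) = h\<^sup>2"
  using real_sqrt_abs[of "h\<^sup>2"] by (simp flip: power_mult)

lemma A_carrier: "A \<in> carrier_mat (n + n) (n + n)"
  using M K dims by (auto simp: A_def C_def[symmetric] bp_matrix_def Let_def mat_inv_C)

lemma P_carrier: "P \<in> carrier_mat (n + n) (n + n)"
  using M dims by (auto simp: P_def)

lemma E_inverse: "g \<in> carrier_vec n \<Longrightarrow> C *\<^sub>v (E *\<^sub>v g) = g"
  using CE dims by (simp flip: assoc_mult_mat_vec[of _ n n _ n])

text \<open>Since \<open>C t\<close> is the first block row, the factor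
  \<open>M C\<^sup>-\<^sup>1 - I\<close> turns it into \<open>M t - C t\<close>, which shows
  \<open>M - C\<close> as a left factor. Both the energy identities and the operation count start
  from this formula.\<close>

lemma A_mult_vec:
  assumes v: "v \<in> carrier_vec n" and w: "w \<in> carrier_vec n"
  defines "t \<equiv> E *\<^sub>v rho_load v w"
  shows "A *\<^sub>v (v @\<^sub>v w) = (M *\<^sub>v t - C *\<^sub>v t) @\<^sub>v (h\<^sup>2 \<cdot>\<^sub>v (K *\<^sub>v t) - h\<^sup>2 \<cdot>\<^sub>v (K *\<^sub>v v) + M *\<^sub>v w)"
proof -
  define g where "g = rho_load v w"
  have sm: "(a \<cdot>\<^sub>m B) *\<^sub>v x = a \<cdot>\<^sub>v (B *\<^sub>v x)" if "B \<in> carrier_mat n n" "x \<in> carrier_vec n" for a x and B :: "real mat"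
    using that by (intro eq_vecI) auto
  have g: "g \<in> carrier_vec n" "t \<in> carrier_vec n" "C *\<^sub>v t = g"
    using v w M K dims E_inverse by (auto simp: g_def t_def rho_load_def)
  have q: "h\<^sup>2 \<cdot>\<^sub>v (K *\<^sub>v v) + (- M) *\<^sub>v w \<in> carrier_vec n" using v w M K by auto
  have zero: "0\<^sub>m n n *\<^sub>v x = 0\<^sub>v n" if "x \<in> carrier_vec n" for x :: "real vec"
    using that by (intro eq_vecI) auto
  have blocks: "four_block_mat (M * E - 1\<^sub>m n) (0\<^sub>m n n) (h\<^sup>2 \<cdot>\<^sub>m (K * E)) (- 1\<^sub>m n) \<in> carrier_mat (n + n) (n + n)"
    "four_block_mat M (h\<^sup>2 \<cdot>\<^sub>m K) (h\<^sup>2 \<cdot>\<^sub>m K) (- M) \<in> carrier_mat (n + n) (n + n)"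
    using M K dims by auto
  have "A *\<^sub>v (v @\<^sub>v w) = four_block_mat (M * E - 1\<^sub>m n) (0\<^sub>m n n) (h\<^sup>2 \<cdot>\<^sub>m (K * E)) (- 1\<^sub>m n) *\<^sub>v
     (four_block_mat M (h\<^sup>2 \<cdot>\<^sub>m K) (h\<^sup>2 \<cdot>\<^sub>m K) (- M) *\<^sub>v (v @\<^sub>v w))"
    using M v w assoc_mult_mat_vec[OF blocks, of "v @\<^sub>v w"]
    by (simp add: A_def C_def[symmetric] bp_matrix_def Let_def mat_inv_C sqrt_h_power4)
  also have "four_block_mat M (h\<^sup>2 \<cdot>\<^sub>m K) (h\<^sup>2 \<cdot>\<^sub>m K) (- M) *\<^sub>v (v @\<^sub>v w) =
     g @\<^sub>v (h\<^sup>2 \<cdot>\<^sub>v (K *\<^sub>v v) + (- M) *\<^sub>v w)"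
    using M K v w by (subst four_block_mat_mult_vec[of _ n n _ n _ n]) (auto simp: g_def rho_load_def sm)
  also have "four_block_mat (M * E - 1\<^sub>m n) (0\<^sub>m n n) (h\<^sup>2 \<cdot>\<^sub>m (K * E)) (- 1\<^sub>m n) *\<^sub>v \<dots> =
    ((M * E - 1\<^sub>m n) *\<^sub>v g + 0\<^sub>m n n *\<^sub>v (h\<^sup>2 \<cdot>\<^sub>v (K *\<^sub>v v) + (- M) *\<^sub>v w)) @\<^sub>v
    (h\<^sup>2 \<cdot>\<^sub>m (K * E) *\<^sub>v g + (- 1\<^sub>m n) *\<^sub>v (h\<^sup>2 \<cdot>\<^sub>v (K *\<^sub>v v) + (- M) *\<^sub>v w))"
    using M K dims g q by (intro four_block_mat_mult_vec[of _ n n _ n _ n]) auto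
  also have "(M * E - 1\<^sub>m n) *\<^sub>v g + 0\<^sub>m n n *\<^sub>v (h\<^sup>2 \<cdot>\<^sub>v (K *\<^sub>v v) + (- M) *\<^sub>v w) = M *\<^sub>v t - C *\<^sub>v t"
    using M K dims g q by (simp add: zero minus_mult_distrib_mat_vec[of _ n n] t_def g_def[symmetric])
  also have "h\<^sup>2 \<cdot>\<^sub>m (K * E) *\<^sub>v g + (- 1\<^sub>m n) *\<^sub>v (h\<^sup>2 \<cdot>\<^sub>v (K *\<^sub>v v) + (- M) *\<^sub>v w) =
     h\<^sup>2 \<cdot>\<^sub>v (K *\<^sub>v t) - h\<^sup>2 \<cdot>\<^sub>v (K *\<^sub>v v) + M *\<^sub>v w"
  proof -
    have "h\<^sup>2 \<cdot>\<^sub>m (K * E) *\<^sub>v g = h\<^sup>2 \<cdot>\<^sub>v (K *\<^sub>v t)"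
      using K dims g by (simp add: sm t_def g_def[symmetric])
    moreover have "(- M) *\<^sub>v w = - (M *\<^sub>v w)" using M w by simp
    moreover have "(- 1\<^sub>m n) *\<^sub>v x = - x" if "x \<in> carrier_vec n" for x :: "real vec" using that by simp
    moreover have "- (a + - b) = b - a" if "a \<in> carrier_vec n" "b \<in> carrier_vec n" for a b :: "real vec"
      using that by (intro eq_vecI) auto
    ultimately show ?thesis using M K w v g q by (intro eq_vecI) auto
  qed
  finally show ?thesis .
qed

lemma P_mult_vec:
  assumes v: "v \<in> carrier_vec n" and w: "w \<in> carrier_vec n"
  shows "P *\<^sub>v (v @\<^sub>v w) = (M *\<^sub>v v - C *\<^sub>v v) @\<^sub>v (diag_part M *\<^sub>v w)"
  unfolding P_def C_def[symmetric] using mult_mat_vec_split[of "M - C" n "diag_part M" n v w] M dims v w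
  by (simp add: minus_mult_distrib_mat_vec[of _ n n])

lemma split_vec:
  assumes "x \<in> carrier_vec (n + n)"
  obtains v w where "v \<in> carrier_vec n" "w \<in> carrier_vec n" "x = v @\<^sub>v w"
  using assms that[of "vec_first x n" "vec_last x n"] by (auto simp: vec_first_last_append)

lemmas scalar_prod_linear =
  add_scalar_prod_distrib[of _ n] scalar_prod_add_distrib[of _ n]
  minus_scalar_prod_distrib[of _ n] scalar_prod_minus_distrib[of _ n]
  smult_scalar_prod_distrib[of _ n] scalar_prod_smult_distrib[of _ n]

lemma form_commute:
  "B \<in> carrier_mat n n \<Longrightarrow> transpose_mat B = B \<Longrightarrow> x \<in> carrier_vec n \<Longrightarrow> y \<in> carrier_vec n \<Longrightarrow>
    (B *\<^sub>v x) \<bullet> y = (B *\<^sub>v y) \<bullet> (x :: real vec)"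
  by (rule sym_form_commute)

text \<open>Inserting \<open>C t' = M v' + h\<^sup>2 K w'\<close> merges the terms
  \<open>(M t) \<bullet> v'\<close> and \<open>h\<^sup>2 (K t) \<bullet> w'\<close> into
  \<open>(C t) \<bullet> t'\<close>. In this shape symmetry is visible, and \<open>A_sym\<close>
  reads it off instead of multiplying blocks.\<close>

lemma A_bilinear:
  assumes v: "v \<in> carrier_vec n" "w \<in> carrier_vec n" and v': "v' \<in> carrier_vec n" "w' \<in> carrier_vec n"
  defines "t \<equiv> E *\<^sub>v rho_load v w" and "t' \<equiv> E *\<^sub>v rho_load v' w'"
  shows "(A *\<^sub>v (v @\<^sub>v w)) \<bullet> (v' @\<^sub>v w') = (C *\<^sub>v t) \<bullet> t' - (M *\<^sub>v v) \<bullet> v' - h\<^sup>2 * ((K *\<^sub>v w) \<bullet> v')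
    - h\<^sup>2 * ((K *\<^sub>v w') \<bullet> v) + (M *\<^sub>v w) \<bullet> w'"
proof -
  have L: "rho_load v w \<in> carrier_vec n" "rho_load v' w' \<in> carrier_vec n"
    using v v' M K by (auto simp: rho_load_def)
  have t: "t \<in> carrier_vec n" "t' \<in> carrier_vec n" using L dims by (auto simp: t_def t'_def)
  have Ct: "C *\<^sub>v t = M *\<^sub>v v + h\<^sup>2 \<cdot>\<^sub>v (K *\<^sub>v w)" "C *\<^sub>v t' = M *\<^sub>v v' + h\<^sup>2 \<cdot>\<^sub>v (K *\<^sub>v w')"
    using E_inverse L by (auto simp: t_def t'_def rho_load_def)
  have car: "B *\<^sub>v x \<in> carrier_vec n" if "B \<in> carrier_mat n n" "x \<in> carrier_vec n" for x and B :: "real mat"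
    using that by simp
  note carriers = v v' t car[OF M(1)] car[OF K(1)] car[OF dims(1)]
  have "(A *\<^sub>v (v @\<^sub>v w)) \<bullet> (v' @\<^sub>v w') =
    (M *\<^sub>v t - C *\<^sub>v t) \<bullet> v' + (h\<^sup>2 \<cdot>\<^sub>v (K *\<^sub>v t) - h\<^sup>2 \<cdot>\<^sub>v (K *\<^sub>v v) + M *\<^sub>v w) \<bullet> w'"
    unfolding A_mult_vec[OF v, folded t_def]
    by (rule scalar_prod_append[of _ n _ n]) (use carriers in auto)
  also have "\<dots> = (M *\<^sub>v t) \<bullet> v' - (C *\<^sub>v t) \<bullet> v' + h\<^sup>2 * ((K *\<^sub>v t) \<bullet> w') - h\<^sup>2 * ((K *\<^sub>v v) \<bullet> w') + (M *\<^sub>v w) \<bullet> w'"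
    using carriers by (simp add: scalar_prod_linear)
  also have "(C *\<^sub>v t) \<bullet> v' = (M *\<^sub>v v) \<bullet> v' + h\<^sup>2 * ((K *\<^sub>v w) \<bullet> v')"
    unfolding Ct using carriers by (simp add: scalar_prod_linear)
  also have "(M *\<^sub>v t) \<bullet> v' = (C *\<^sub>v t) \<bullet> t' - h\<^sup>2 * ((K *\<^sub>v t) \<bullet> w')"
  proof -
    have "(C *\<^sub>v t) \<bullet> t' = (C *\<^sub>v t') \<bullet> t" using form_commute[OF dims(1) C_sym] t by blast
    also have "\<dots> = (M *\<^sub>v v') \<bullet> t + h\<^sup>2 * ((K *\<^sub>v w') \<bullet> t)"
      unfolding Ct using carriers by (simp add: scalar_prod_linear)
    finally show ?thesis using form_commute[OF M t(1) v'(1)] form_commute[OF K t(1) v'(2)] by simp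
  qed
  also have "(K *\<^sub>v v) \<bullet> w' = (K *\<^sub>v w') \<bullet> v" by (rule form_commute[OF K v(1) v'(2)])
  finally show ?thesis by (simp add: algebra_simps)
qed

lemma A_sym: "transpose_mat A = A"
proof (rule transpose_eq_if_form_commute[OF A_carrier])
  fix x y :: "real vec" assume "x \<in> carrier_vec (n + n)" "y \<in> carrier_vec (n + n)"
  then obtain v w v' w' where x: "x = v @\<^sub>v w" "y = v' @\<^sub>v w'" and
    c: "v \<in> carrier_vec n" "w \<in> carrier_vec n" "v' \<in> carrier_vec n" "w' \<in> carrier_vec n"
    by (metis split_vec)
  have t: "E *\<^sub>v rho_load a b \<in> carrier_vec n" if "a \<in> carrier_vec n" "b \<in> carrier_vec n" for a b
    using that dims M K by (auto simp: rho_load_def)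
  show "(A *\<^sub>v x) \<bullet> y = (A *\<^sub>v y) \<bullet> x"
    unfolding x A_bilinear[OF c] A_bilinear[OF c(3,4,1,2)]
    using form_commute[OF M c(1,3)] form_commute[OF M c(2,4)]
      form_commute[OF dims(1) C_sym t[OF c(1,2)] t[OF c(3,4)]] by simp
qed

text \<open>Completing the square in \<open>t\<close>: twice \<open>(C t) \<bullet> v\<close>
  supplies the two mixed terms in \<open>K\<close> and one surplus \<open>(M v) \<bullet> v\<close>,
  which is added back.\<close>

lemma A_form:
  assumes v: "v \<in> carrier_vec n" "w \<in> carrier_vec n"
  defines "t \<equiv> E *\<^sub>v rho_load v w"
  shows "(A *\<^sub>v (v @\<^sub>v w)) \<bullet> (v @\<^sub>v w) = (C *\<^sub>v (t - v)) \<bullet> (t - v) +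
     ((M *\<^sub>v v) \<bullet> v - (C *\<^sub>v v) \<bullet> v) + (M *\<^sub>v w) \<bullet> w"
proof -
  have L: "rho_load v w \<in> carrier_vec n" using v M K by (auto simp: rho_load_def)
  have t: "t \<in> carrier_vec n" using L dims by (auto simp: t_def)
  have Ct: "C *\<^sub>v t = M *\<^sub>v v + h\<^sup>2 \<cdot>\<^sub>v (K *\<^sub>v w)" using E_inverse L by (auto simp: t_def rho_load_def)
  have car: "B *\<^sub>v x \<in> carrier_vec n" if "B \<in> carrier_mat n n" "x \<in> carrier_vec n" for x and B :: "real mat"
    using that by simp
  note carriers = v t car[OF M(1)] car[OF K(1)] car[OF dims(1)]
  have "(C *\<^sub>v (t - v)) \<bullet> (t - v) = (C *\<^sub>v t) \<bullet> t - 2 * ((C *\<^sub>v t) \<bullet> v) + (C *\<^sub>v v) \<bullet> v"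
    using form_commute[OF dims(1) C_sym v(1) t] carriers
    by (simp add: mult_minus_distrib_mat_vec[OF dims(1)] scalar_prod_linear)
  moreover have "(C *\<^sub>v t) \<bullet> v = (M *\<^sub>v v) \<bullet> v + h\<^sup>2 * ((K *\<^sub>v w) \<bullet> v)"
    unfolding Ct using carriers by (simp add: scalar_prod_linear)
  ultimately show ?thesis unfolding A_bilinear[OF v v] t_def[symmetric] by simp
qed

lemma P_form:
  assumes v: "v \<in> carrier_vec n" "w \<in> carrier_vec n"
  shows "(P *\<^sub>v (v @\<^sub>v w)) \<bullet> (v @\<^sub>v w) = ((M *\<^sub>v v) \<bullet> v - (C *\<^sub>v v) \<bullet> v) + 4 * ((C *\<^sub>v w) \<bullet> w)"
proof -
  have "(P *\<^sub>v (v @\<^sub>v w)) \<bullet> (v @\<^sub>v w) = (M *\<^sub>v v - C *\<^sub>v v) \<bullet> v + (diag_part M *\<^sub>v w) \<bullet> w"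
    unfolding P_mult_vec[OF v] by (rule scalar_prod_append[of _ n _ n]) (use v M dims in auto)
  then show ?thesis using diag_form[OF v(2)] v M dims by (simp add: minus_scalar_prod_distrib[of _ n])
qed

text \<open>The square in \<open>A_form\<close> is dropped; the factor 2 comes from
  \<open>diag M = 4 C \<le> 2 M\<close>.\<close>

lemma P_le_A:
  assumes "x \<in> carrier_vec (n + n)"
  shows "(P *\<^sub>v x) \<bullet> x \<le> 2 * ((A *\<^sub>v x) \<bullet> x)"
proof -
  obtain v w where v: "v \<in> carrier_vec n" "w \<in> carrier_vec n" and x: "x = v @\<^sub>v w"
    using split_vec[OF assms] .
  have t: "E *\<^sub>v rho_load v w - v \<in> carrier_vec n" using v dims M K by (auto simp: rho_load_def)
  show ?thesis unfolding x P_form[OF v] A_form[OF v]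
    using C_nonneg[OF t] C_nonneg[OF v(1)] M_lower[OF v(1)] M_lower[OF v(2)] by (simp add: C_form[OF v(1)] C_form[OF v(2)])
qed

text \<open>\<open>t - v\<close> splits into \<open>y1\<close> and \<open>y2\<close>, which
  represent \<open>(M - C) v\<close> and \<open>h\<^sup>2 K w\<close> in the
  \<open>C\<close>-product. The dual bound applies to each with the same \<open>c\<close>, because
  both matrices are at most \<open>c C\<close>.\<close>

lemma A_le_P:
  assumes "x \<in> carrier_vec (n + n)"
  shows "(A *\<^sub>v x) \<bullet> x \<le> (2 * c\<^sup>2 + 3 * c + 1) * ((P *\<^sub>v x) \<bullet> x)"
proof -
  obtain v w where v: "v \<in> carrier_vec n" "w \<in> carrier_vec n" and x: "x = v @\<^sub>v w"
    using split_vec[OF assms] .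
  define t where "t = E *\<^sub>v rho_load v w"
  define y1 where "y1 = E *\<^sub>v ((M - C) *\<^sub>v v)"
  define y2 where "y2 = E *\<^sub>v ((h\<^sup>2 \<cdot>\<^sub>m K) *\<^sub>v w)"
  have car: "B *\<^sub>v x \<in> carrier_vec n" if "B \<in> carrier_mat n n" "x \<in> carrier_vec n" for x and B :: "real mat"
    using that by simp
  have S: "M - C \<in> carrier_mat n n" "h\<^sup>2 \<cdot>\<^sub>m K \<in> carrier_mat n n" using M K dims by auto
  have sm: "(a \<cdot>\<^sub>m B) *\<^sub>v x = a \<cdot>\<^sub>v (B *\<^sub>v x)" if "B \<in> carrier_mat n n" "x \<in> carrier_vec n" for a x and B :: "real mat"
    using that by (intro eq_vecI) auto
  have S_sym: "transpose_mat (M - C) = M - C" "transpose_mat (h\<^sup>2 \<cdot>\<^sub>m K) = h\<^sup>2 \<cdot>\<^sub>m K"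
    using M K dims C_sym by (auto intro!: eq_matI simp: diag_part_def C_def) (metis carrier_matD index_transpose_mat(1))+
  have S_form: "((M - C) *\<^sub>v u) \<bullet> u = (M *\<^sub>v u) \<bullet> u - (C *\<^sub>v u) \<bullet> u" if "u \<in> carrier_vec n" for u
    using that M dims car by (simp add: minus_mult_distrib_mat_vec[of _ n n] minus_scalar_prod_distrib[of _ n])
  have K_form: "((h\<^sup>2 \<cdot>\<^sub>m K) *\<^sub>v u) \<bullet> u = h\<^sup>2 * ((K *\<^sub>v u) \<bullet> u)" if "u \<in> carrier_vec n" for u
    using that K car by (simp add: sm smult_scalar_prod_distrib[of _ n])
  have y: "y1 \<in> carrier_vec n" "y2 \<in> carrier_vec n" using v S dims by (auto simp: y1_def y2_def)
  have Cy: "C *\<^sub>v y1 = (M - C) *\<^sub>v v" "C *\<^sub>v y2 = (h\<^sup>2 \<cdot>\<^sub>m K) *\<^sub>v w"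
    unfolding y1_def y2_def using v S by (auto intro!: E_inverse)
  have "E *\<^sub>v (C *\<^sub>v v) = v" using CE dims v by (simp flip: assoc_mult_mat_vec[of _ n n _ n])
  moreover have "y1 + y2 = t - E *\<^sub>v (C *\<^sub>v v)"
  proof -
    have "y1 + y2 = E *\<^sub>v ((M - C) *\<^sub>v v + (h\<^sup>2 \<cdot>\<^sub>m K) *\<^sub>v w)"
      unfolding y1_def y2_def using v S dims by (simp add: mult_add_distrib_mat_vec[of _ n n])
    also have "(M - C) *\<^sub>v v + (h\<^sup>2 \<cdot>\<^sub>m K) *\<^sub>v w = rho_load v w - C *\<^sub>v v"
      using v M K dims car sm by (intro eq_vecI) (auto simp: rho_load_def minus_mult_distrib_mat_vec[of _ n n])
    also have "E *\<^sub>v \<dots> = t - E *\<^sub>v (C *\<^sub>v v)"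
      unfolding t_def using v M K dims by (intro mult_minus_distrib_mat_vec) (auto simp: rho_load_def)
    finally show ?thesis .
  qed
  ultimately have ty: "t - v = y1 + y2" by simp
  have cs: "0 \<le> c" using c_pos by simp
  have b1: "(C *\<^sub>v y1) \<bullet> y1 \<le> c * ((M *\<^sub>v v) \<bullet> v - (C *\<^sub>v v) \<bullet> v)"
    unfolding S_form[OF v(1), symmetric]
  proof (rule dual_form_bound[OF S(1) S_sym(1) _ C_nonneg _ v(1) y(1) Cy(1) cs])
    fix u :: "real vec" assume u: "u \<in> carrier_vec n"
    show "0 \<le> ((M - C) *\<^sub>v u) \<bullet> u" "((M - C) *\<^sub>v u) \<bullet> u \<le> c * ((C *\<^sub>v u) \<bullet> u)"
      unfolding S_form[OF u] using M_lower[OF u] M_upper[OF u] C_nonneg[OF u] by (auto simp: C_form[OF u])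
  qed
  have b2: "(C *\<^sub>v y2) \<bullet> y2 \<le> c * (h\<^sup>2 * ((K *\<^sub>v w) \<bullet> w))"
    unfolding K_form[OF v(2), symmetric]
  proof (rule dual_form_bound[OF S(2) S_sym(2) _ C_nonneg _ v(2) y(2) Cy(2) cs])
    fix u :: "real vec" assume u: "u \<in> carrier_vec n"
    show "0 \<le> ((h\<^sup>2 \<cdot>\<^sub>m K) *\<^sub>v u) \<bullet> u" "((h\<^sup>2 \<cdot>\<^sub>m K) *\<^sub>v u) \<bullet> u \<le> c * ((C *\<^sub>v u) \<bullet> u)"
      unfolding K_form[OF u] using K_nonneg[OF u] K_upper[OF u] by (auto simp: C_form[OF u])
  qed
  have "c * (h\<^sup>2 * ((K *\<^sub>v w) \<bullet> w)) \<le> c * (c * ((C *\<^sub>v w) \<bullet> w))"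
    using K_upper[OF v(2)] cs by (intro mult_left_mono) (auto simp: C_form[OF v(2)])
  with b2 have b2': "(C *\<^sub>v y2) \<bullet> y2 \<le> c\<^sup>2 * ((C *\<^sub>v w) \<bullet> w)" by (simp add: power2_eq_square mult_ac)
  \<comment> \<open>Parallelogram law, with the term in \<open>y1 - y2\<close> discarded.\<close>
  have "(C *\<^sub>v (y1 + y2)) \<bullet> (y1 + y2) \<le> 2 * ((C *\<^sub>v y1) \<bullet> y1) + 2 * ((C *\<^sub>v y2) \<bullet> y2)"
  proof -
    have "(C *\<^sub>v (y1 + (-1) \<cdot>\<^sub>v y2)) \<bullet> (y1 + (-1) \<cdot>\<^sub>v y2) \<ge> 0" using y by (intro C_nonneg) auto
    then show ?thesis using sym_form_add_smult[OF dims(1) C_sym y, of "-1"] sym_form_add_smult[OF dims(1) C_sym y, of 1] by simp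
  qed
  moreover have "(M *\<^sub>v w) \<bullet> w \<le> c * ((C *\<^sub>v w) \<bullet> w)" using M_upper[OF v(2)] by (simp add: C_form[OF v(2)])
  ultimately have "(A *\<^sub>v x) \<bullet> x \<le> (2 * c + 1) * ((M *\<^sub>v v) \<bullet> v - (C *\<^sub>v v) \<bullet> v) + (2 * c\<^sup>2 + c) * ((C *\<^sub>v w) \<bullet> w)"
    unfolding x A_form[OF v] t_def[symmetric] ty using b1 b2' by (simp add: algebra_simps)
  \<comment> \<open>The sum of the two coefficients serves as a crude common bound.\<close>
  also have "\<dots> \<le> (2 * c\<^sup>2 + 3 * c + 1) * ((M *\<^sub>v v) \<bullet> v - (C *\<^sub>v v) \<bullet> v) + (2 * c\<^sup>2 + 3 * c + 1) * (4 * ((C *\<^sub>v w) \<bullet> w))"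
  proof (rule add_mono; rule mult_mono)
    show "0 \<le> (M *\<^sub>v v) \<bullet> v - (C *\<^sub>v v) \<bullet> v" using M_lower[OF v(1)] C_nonneg[OF v(1)] by (auto simp: C_form[OF v(1)])
  qed (use cs C_nonneg[OF v(2)] in auto)
  also have "\<dots> = (2 * c\<^sup>2 + 3 * c + 1) * ((P *\<^sub>v x) \<bullet> x)" unfolding x P_form[OF v] by (simp add: distrib_left)
  finally show ?thesis .
qed

lemma P_spd: "sym_pos_def P"
proof -
  have sym: "transpose_mat P = P"
    unfolding P_def C_def[symmetric] using M dims C_sym
    by (subst transpose_four_block_mat[of _ n n _ n _ n])
      (auto intro!: cong_four_block_mat eq_matI simp: diag_part_def C_def, (metis carrier_matD index_transpose_mat(1))+)
  have "0 < (P *\<^sub>v x) \<bullet> x" if x: "x \<in> carrier_vec (n + n)" "x \<noteq> 0\<^sub>v (n + n)" for x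
  proof -
    obtain v w where v: "v \<in> carrier_vec n" "w \<in> carrier_vec n" and xs: "x = v @\<^sub>v w"
      using split_vec[OF x(1)] .
    have "v \<noteq> 0\<^sub>v n \<or> w \<noteq> 0\<^sub>v n" using x(2) by (auto simp: xs intro!: eq_vecI)
    then have "0 < (C *\<^sub>v v) \<bullet> v + (C *\<^sub>v w) \<bullet> w"
      using C_pos C_nonneg v by (metis add_pos_nonneg add_nonneg_pos)
    then show ?thesis unfolding xs P_form[OF v] using M_lower[OF v(1)] C_nonneg[OF v(1)] C_nonneg[OF v(2)]
      by (simp add: C_form[OF v(1)])
  qed
  then show ?thesis using sym P_carrier by (auto simp: sym_pos_def_def)
qed

text \<open>Definiteness is inherited from \<open>P\<close> through \<open>P_le_A\<close>.\<close>

lemma A_spd: "sym_pos_def A"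
proof -
  have "0 < (A *\<^sub>v x) \<bullet> x" if x: "x \<in> carrier_vec (n + n)" "x \<noteq> 0\<^sub>v (n + n)" for x
    using P_le_A[OF x(1)] P_spd x P_carrier by (force simp: sym_pos_def_def)
  then show ?thesis using A_sym A_carrier by (auto simp: sym_pos_def_def)
qed

sublocale pcg_setting A P "n + n" "1 / (2 * c\<^sup>2 + 3 * c + 1)" 2
proof
  have c1: "1 \<le> 2 * c\<^sup>2 + 3 * c + 1" using c_pos by simp
  then show "0 < 1 / (2 * c\<^sup>2 + 3 * c + 1)" "1 / (2 * c\<^sup>2 + 3 * c + 1) \<le> 2" by (auto simp: divide_le_eq)
  show "1 / (2 * c\<^sup>2 + 3 * c + 1) * ((A *\<^sub>v v) \<bullet> v) \<le> (P *\<^sub>v v) \<bullet> v" if "v \<in> carrier_vec (n + n)" for v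
    using A_le_P[OF that] c1 by (simp add: divide_le_eq mult.commute)
qed (use A_spd P_spd A_carrier P_carrier P_le_A in auto)

end


section \<open>Costs of straight-line programs\<close>

lemma length_run_program [simp]: "length (run_program e mem p) = length mem + length p"
  by (induction e mem p rule: run_program.induct) auto

lemma run_program_append: "run_program e mem (p @ q) = run_program e (run_program e mem p) q"
  by (induction e mem p rule: run_program.induct) auto

lemma nth_run_program: "j < length mem \<Longrightarrow> run_program e mem p ! j = mem ! j"
  by (induction e mem p rule: run_program.induct) (auto simp: nth_append)

definition extends :: "nat \<Rightarrow> 'i program \<Rightarrow> 'i program \<Rightarrow> bool" where
  "extends k p p' \<longleftrightarrow> (\<exists>q. p' = p @ q \<and> length q \<le> k)"

lemma extends_refl: "extends k p p"
  by (auto simp: extends_def)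

lemma extends_trans: "extends k p p' \<Longrightarrow> extends l p' p'' \<Longrightarrow> extends (k + l) p p''"
  by (force simp: extends_def)

lemma extends_mono: "extends k p p' \<Longrightarrow> k \<le> l \<Longrightarrow> extends l p p'"
  by (force simp: extends_def)

text \<open>\<open>W\<close> collects the data on which one and the same program must work, later
  the pairs of right-hand side and initial guess; computed quantities are therefore functions on
  \<open>W\<close>.\<close>

locale program_family =
  fixes W :: "'w set" and env :: "'w \<Rightarrow> 'i \<Rightarrow> real"
begin

text \<open>A register beyond the end of a program would read 0 now and another value once the program is
  extended; it is excluded here.\<close>

definition available :: "'i program \<Rightarrow> ('w \<Rightarrow> real) \<Rightarrow> bool" where
  "available p F \<longleftrightarrow> (\<exists>a. (\<forall>j. a = Reg j \<longrightarrow> j < length p) \<and>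
     (\<forall>w\<in>W. operand_value (env w) (run_program (env w) [] p) a = F w))"

text \<open>Quantifying over all extensions of \<open>p\<close> makes costs additive.\<close>

definition cost :: "'i program \<Rightarrow> nat \<Rightarrow> ('w \<Rightarrow> real) \<Rightarrow> bool" where
  "cost p k F \<longleftrightarrow> (\<forall>l p'. extends l p p' \<longrightarrow> (\<exists>p''. extends k p' p'' \<and> available p'' F))"

lemma available_const: "available p (\<lambda>w. of_rat c)"
  unfolding available_def by (rule exI[of _ "Const c"]) auto

lemma available_input: "available p (\<lambda>w. env w i)"
  unfolding available_def by (rule exI[of _ "Inp i"]) auto

lemma available_cong: "(\<And>w. w \<in> W \<Longrightarrow> F w = G w) \<Longrightarrow> available p F \<Longrightarrow> available p G"
  unfolding available_def by metis

lemma available_extends: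
  assumes "available p F" "extends k p p'"
  shows "available p' F"
proof -
  from assms obtain a q where a: "\<And>j. a = Reg j \<Longrightarrow> j < length p" and p': "p' = p @ q"
    and F: "\<And>w. w \<in> W \<Longrightarrow> operand_value (env w) (run_program (env w) [] p) a = F w"
    unfolding available_def extends_def by blast
  show ?thesis unfolding available_def
    using a F by (intro exI[of _ a], cases a) (auto simp: p' run_program_append nth_run_program)
qed

lemma available_op:
  assumes "available p F" "available p G"
  shows "\<exists>p'. extends 1 p p' \<and> available p' (\<lambda>w. apply_op c (F w) (G w))"
proof -
  from assms obtain a b where
    a: "\<And>w. w \<in> W \<Longrightarrow> operand_value (env w) (run_program (env w) [] p) a = F w" and
    b: "\<And>w. w \<in> W \<Longrightarrow> operand_value (env w) (run_program (env w) [] p) b = G w"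
    unfolding available_def by blast
  have "available (p @ [(c, a, b)]) (\<lambda>w. apply_op c (F w) (G w))"
    unfolding available_def
    by (rule exI[of _ "Reg (length p)"]) (auto simp: run_program_append nth_append a b)
  moreover have "extends 1 p (p @ [(c, a, b)])" by (auto simp: extends_def)
  ultimately show ?thesis by blast
qed

lemma cost_extends: "cost p k F \<Longrightarrow> extends l p p' \<Longrightarrow> cost p' k F"
  unfolding cost_def by (meson extends_trans)

lemma cost_mono: "cost p k F \<Longrightarrow> k \<le> l \<Longrightarrow> cost p l F"
  unfolding cost_def by (meson extends_mono)

lemma cost_cong: "(\<And>w. w \<in> W \<Longrightarrow> F w = G w) \<Longrightarrow> cost p k F \<Longrightarrow> cost p k G"
  unfolding cost_def using available_cong[of F G] by blast

lemma cost_available: "available p F \<Longrightarrow> cost p 0 F"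
  unfolding cost_def by (meson available_extends extends_refl)

lemma cost_const: "cost p 0 (\<lambda>w. of_rat c)"
  by (rule cost_available[OF available_const])

lemma cost_input: "cost p 0 (\<lambda>w. env w i)"
  by (rule cost_available[OF available_input])

lemma cost_obtain:
  assumes "cost p k F"
  obtains p' where "extends k p p'" "available p' F"
  using assms extends_refl unfolding cost_def by blast

lemma cost_apply_op:
  assumes F: "cost p k F" and G: "cost p l G"
  shows "cost p (k + l + 1) (\<lambda>w. apply_op c (F w) (G w))"
  unfolding cost_def
proof (intro allI impI)
  fix m p1 assume "extends m p p1"
  with F G have "cost p1 k F" "cost p1 l G" by (auto intro: cost_extends)
  then obtain p2 where p2: "extends k p1 p2" "available p2 F" "cost p2 l G"
    by (meson cost_obtain cost_extends)
  then obtain p3 where p3: "extends l p2 p3" "available p3 G" by (meson cost_obtain)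
  with p2 obtain p4 where "extends 1 p3 p4" "available p4 (\<lambda>w. apply_op c (F w) (G w))"
    using available_op[of p3 F G c] available_extends by blast
  then show "\<exists>p4. extends (k + l + 1) p1 p4 \<and> available p4 (\<lambda>w. apply_op c (F w) (G w))"
    using p2 p3 extends_trans by blast
qed

lemma cost_add: "cost p k F \<Longrightarrow> cost p l G \<Longrightarrow> cost p (k + l + 1) (\<lambda>w. F w + G w)"
  using cost_apply_op[of p k F l G Plus] by simp

lemma cost_minus: "cost p k F \<Longrightarrow> cost p l G \<Longrightarrow> cost p (k + l + 1) (\<lambda>w. F w - G w)"
  using cost_apply_op[of p k F l G Minus] by simp

lemma cost_times: "cost p k F \<Longrightarrow> cost p l G \<Longrightarrow> cost p (k + l + 1) (\<lambda>w. F w * G w)"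
  using cost_apply_op[of p k F l G Times] by simp

lemma cost_divide: "cost p k F \<Longrightarrow> cost p l G \<Longrightarrow> cost p (k + l + 1) (\<lambda>w. F w / G w)"
  using cost_apply_op[of p k F l G Divide] by simp

lemma cost_sum:
  assumes "finite J" "\<And>j. j \<in> J \<Longrightarrow> cost p k (F j)"
  shows "cost p (card J * (k + 1)) (\<lambda>w. \<Sum>j\<in>J. F j w)"
  using assms
proof (induction J rule: finite_induct)
  case empty
  then show ?case using cost_const[of p 0] by simp
next
  case (insert j J)
  then have "cost p k (F j)" "cost p (card J * (k + 1)) (\<lambda>w. \<Sum>j\<in>J. F j w)" by auto
  note cost_add[OF this]
  moreover have "k + card J * (k + 1) + 1 = card (insert j J) * (k + 1)" using insert by simp
  moreover have "(\<lambda>w. \<Sum>j\<in>insert j J. F j w) = (\<lambda>w. F j w + (\<Sum>j\<in>J. F j w))"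
    using insert(1,2) by simp
  ultimately show ?case by simp
qed

text \<open>Each value is computed on top of the previous ones and all remain readable at the end.
  Vectors stored in this way can be reused without charge, which a \<open>cost\<close> bound for
  each entry alone would not give.\<close>

lemma cost_family:
  assumes "\<And>i. i < (n::nat) \<Longrightarrow> cost p k (F i)"
  shows "\<exists>p'. extends (n * k) p p' \<and> (\<forall>i<n. available p' (F i))"
  using assms
proof (induction n)
  case 0
  then show ?case using extends_refl by auto
next
  case (Suc n)
  then obtain p1 where p1: "extends (n * k) p p1" "\<forall>i<n. available p1 (F i)" by auto
  have "cost p1 k (F n)" using Suc.prems p1(1) cost_extends by blast
  then obtain p2 where p2: "extends k p1 p2" "available p2 (F n)" by (rule cost_obtain)
  have "extends (Suc n * k) p p2" using extends_trans[OF p1(1) p2(1)] by (simp add: add.commute)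
  moreover have "available p2 (F i)" if "i < Suc n" for i
    using that p1(2) p2(2) available_extends[OF _ p2(1)] by (cases "i = n") auto
  ultimately show ?case by blast
qed

end


section \<open>PCG as a straight-line program\<close>

lemma (in program_family) cost_mult_sum:
  assumes "finite J" "card J \<le> s" "\<And>j. j \<in> J \<Longrightarrow> available p (F j)"
  shows "cost p (2 * s) (\<lambda>w. \<Sum>j\<in>J. env w (g j) * F j w)"
proof -
  have "cost p 1 (\<lambda>w. env w (g j) * F j w)" if "j \<in> J" for j
    using cost_times[OF cost_input[of p "g j"] cost_available[OF assms(3)[OF that]]] by simp
  then have "cost p (card J * (1 + 1)) (\<lambda>w. \<Sum>j\<in>J. env w (g j) * F j w)"
    by (rule cost_sum[OF assms(1)])
  then show ?thesis by (rule cost_mono) (use assms(2) in simp)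
qed

text \<open>\<open>J i\<close> is the sparsity pattern of row \<open>i\<close>, with at most
  \<open>s\<close> entries. \<open>n_pos\<close> lets a step absorb its two scalar divisions into a
  multiple of \<open>n\<close>.\<close>

locale fem_program = fem_matrices n M K h c + program_family W env
  for n M K h c and W :: "(real vec \<times> real vec) set" and env :: "real vec \<times> real vec \<Rightarrow> bp_input \<Rightarrow> real" +
  fixes s :: nat and J :: "nat \<Rightarrow> nat set"
  assumes W: "W = carrier_vec n \<times> carrier_vec (n + n)"
    and env: "\<And>i j w. env w (Mass i j) = M $$ (i, j)" "\<And>i j w. env w (Stiffness i j) = K $$ (i, j)"
      "\<And>w. env w Width = h" "\<And>i w. env w (Load i) = fst w $ i" "\<And>i w. env w (Guess i) = snd w $ i"
    and J: "\<And>i. i < n \<Longrightarrow> J i \<subseteq> {..<n}" "\<And>i. i < n \<Longrightarrow> card (J i) \<le> s"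
      "\<And>i j. i < n \<Longrightarrow> j < n \<Longrightarrow> j \<notin> J i \<Longrightarrow> M $$ (i, j) = 0 \<and> K $$ (i, j) = 0"
    and n_pos: "0 < n"
begin

definition available_vec :: "bp_input program \<Rightarrow> (real vec \<times> real vec \<Rightarrow> real vec) \<Rightarrow> bool" where
  "available_vec p X \<longleftrightarrow> (\<forall>i<n + n. available p (\<lambda>w. X w $ i))"

lemma available_vec_extends: "available_vec p X \<Longrightarrow> extends k p p' \<Longrightarrow> available_vec p' X"
  unfolding available_vec_def using available_extends by blast

lemma available_vecD: "available_vec p X \<Longrightarrow> i < n + n \<Longrightarrow> available p (\<lambda>w. X w $ i)"
  unfolding available_vec_def by blast

lemma cost_vec:
  assumes "\<And>i. i < n + n \<Longrightarrow> cost p k (\<lambda>w. X w $ i)"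
  obtains p' where "extends ((n + n) * k) p p'" "available_vec p' X"
  using cost_family[of "n + n" p k "\<lambda>i w. X w $ i"] assms unfolding available_vec_def by blast

lemma row_sum:
  assumes "i < n" "v \<in> carrier_vec n"
  shows "(M *\<^sub>v v) $ i = (\<Sum>j\<in>J i. M $$ (i, j) * v $ j)" "(K *\<^sub>v v) $ i = (\<Sum>j\<in>J i. K $$ (i, j) * v $ j)"
proof -
  have "(\<Sum>j = 0..<n. B $$ (i, j) * v $ j) = (\<Sum>j\<in>J i. B $$ (i, j) * v $ j)"
    if "\<And>j. j < n \<Longrightarrow> j \<notin> J i \<Longrightarrow> B $$ (i, j) = 0" for B :: "real mat"
    using J(1)[OF assms(1)] that by (intro sum.mono_neutral_right) auto
  then show "(M *\<^sub>v v) $ i = (\<Sum>j\<in>J i. M $$ (i, j) * v $ j)" "(K *\<^sub>v v) $ i = (\<Sum>j\<in>J i. K $$ (i, j) * v $ j)"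
    using J(3) assms M K by (auto simp: scalar_prod_def)
qed

lemma cost_row:
  assumes "i < n" "\<And>j. j < n \<Longrightarrow> available p (F j)"
  shows "cost p (2 * s) (\<lambda>w. \<Sum>j\<in>J i. M $$ (i, j) * F j w)"
    and "cost p (2 * s) (\<lambda>w. \<Sum>j\<in>J i. K $$ (i, j) * F j w)"
  using cost_mult_sum[of "J i" s p F "\<lambda>j. Mass i j"] cost_mult_sum[of "J i" s p F "\<lambda>j. Stiffness i j"]
    assms J(1,2)[of i] finite_subset[of "J i" "{..<n}"] by (auto simp: env)

lemma cost_h2: "cost p 1 (\<lambda>w. h\<^sup>2)"
  using cost_times[OF cost_input[of p Width] cost_input[of p Width]] by (simp add: env power2_eq_square)

lemma cost_diag: "cost p 0 (\<lambda>w. M $$ (i, i))"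
  using cost_input[of p "Mass i i"] by (simp add: env)

text \<open>The result is verified by applying \<open>P\<close> to it: the factor
  \<open>M - C\<close> is already present in the argument and cancels, and only the diagonal block
  calls for a division.\<close>

lemma P_inv_mult:
  assumes t: "t \<in> carrier_vec n" and u: "u \<in> carrier_vec n"
  shows "mat_inv P *\<^sub>v ((M *\<^sub>v t - C *\<^sub>v t) @\<^sub>v u) = t @\<^sub>v Matrix.vec n (\<lambda>i. u $ i / M $$ (i, i))"
proof -
  define y where "y = Matrix.vec n (\<lambda>i. u $ i / M $$ (i, i))"
  have y: "y \<in> carrier_vec n" by (simp add: y_def)
  have "diag_part M *\<^sub>v y = u"
  proof (rule eq_vecI)
    show "dim_vec (diag_part M *\<^sub>v y) = dim_vec u" using u dims by auto
    fix i assume "i < dim_vec u"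
    then have i: "i < n" using u by auto
    show "(diag_part M *\<^sub>v y) $ i = u $ i"
      unfolding diag_mult_vec[OF y i] using i diag_pos[OF i] by (simp add: y_def)
  qed
  then have "(M *\<^sub>v t - C *\<^sub>v t) @\<^sub>v u = P *\<^sub>v (t @\<^sub>v y)" using P_mult_vec[OF t y] by simp
  moreover have "mat_inv P *\<^sub>v (P *\<^sub>v (t @\<^sub>v y)) = t @\<^sub>v y"
    using sym_pos_def_inverse[OF P_spd P_carrier] P_carrier t y
    by (simp flip: assoc_mult_mat_vec[of _ "n + n" "n + n" _ "n + n"])
  ultimately show ?thesis by (simp add: y_def)
qed

text \<open>Per index: \<open>4 * s + 5\<close> operations for \<open>t\<close>,
  \<open>2 * s + 3\<close> for the first block of \<open>A X\<close>, \<open>6 * s + 6\<close> for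
  the second, and one division by the diagonal. With \<open>t\<close> stored, the first block of the
  preconditioned product costs nothing more.\<close>

lemma apply_cost:
  assumes X: "available_vec p X" "\<And>w. w \<in> W \<Longrightarrow> X w \<in> carrier_vec (n + n)"
  obtains p' where "extends (n * (12 * s + 15)) p p'"
    "available_vec p' (\<lambda>w. A *\<^sub>v X w)" "available_vec p' (\<lambda>w. mat_inv P *\<^sub>v (A *\<^sub>v X w))"
proof -
  define X1 where "X1 w = Matrix.vec n (\<lambda>i. X w $ i)" for w
  define X2 where "X2 w = Matrix.vec n (\<lambda>i. X w $ (n + i))" for w
  have X12: "X1 w \<in> carrier_vec n" "X2 w \<in> carrier_vec n" for w by (auto simp: X1_def X2_def)
  have Xs: "X w = X1 w @\<^sub>v X2 w" if "w \<in> W" for w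
    using X(2)[OF that] by (intro eq_vecI) (auto simp: X1_def X2_def)
  have a1: "available p (\<lambda>w. X1 w $ j)" "available p (\<lambda>w. X2 w $ j)" if "j < n" for j
    using available_vecD[OF X(1), of j] available_vecD[OF X(1), of "n + j"] that by (auto simp: X1_def X2_def)
  define T where "T w = E *\<^sub>v rho_load (X1 w) (X2 w)" for w
  have T: "T w \<in> carrier_vec n" for w using dims X12 M K by (auto simp: T_def rho_load_def)
  define U where "U w = h\<^sup>2 \<cdot>\<^sub>v (K *\<^sub>v T w) - h\<^sup>2 \<cdot>\<^sub>v (K *\<^sub>v X1 w) + M *\<^sub>v X2 w" for w
  have U: "U w \<in> carrier_vec n" for w using X12 M K T by (auto simp: U_def)
  have AX: "A *\<^sub>v X w = (M *\<^sub>v T w - C *\<^sub>v T w) @\<^sub>v U w" if "w \<in> W" for w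
    unfolding Xs[OF that] A_mult_vec[OF X12] by (simp add: T_def U_def)
  have "cost p (4 * s + 5) (\<lambda>w. T w $ i)" if i: "i < n" for i
  proof -
    have "T w $ i = of_rat 4 / M $$ (i, i) * ((\<Sum>j\<in>J i. M $$ (i, j) * X1 w $ j) + h\<^sup>2 * (\<Sum>j\<in>J i. K $$ (i, j) * X2 w $ j))" for w
    proof -
      have "rho_load (X1 w) (X2 w) $ i = (M *\<^sub>v X1 w) $ i + h\<^sup>2 * (K *\<^sub>v X2 w) $ i"
        using i K M by (simp add: rho_load_def)
      then show ?thesis
        using X12 M K unfolding T_def by (subst E_mult_vec[OF _ i]) (simp_all add: row_sum[OF i] rho_load_def del: index_mult_mat_vec)
    qed
    moreover have "cost p (0 + 0 + 1 + (2 * s + (1 + 2 * s + 1) + 1) + 1)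
      (\<lambda>w. of_rat 4 / M $$ (i, i) * ((\<Sum>j\<in>J i. M $$ (i, j) * X1 w $ j) + h\<^sup>2 * (\<Sum>j\<in>J i. K $$ (i, j) * X2 w $ j)))"
      by (intro cost_add cost_times cost_divide cost_const cost_diag cost_h2 cost_row i a1)
    ultimately show ?thesis by (simp add: eval_nat_numeral add.assoc)
  qed
  from cost_family[of n p _ "\<lambda>i w. T w $ i", OF this] obtain p1 where
    p1: "extends (n * (4 * s + 5)) p p1" and T1: "\<And>i. i < n \<Longrightarrow> available p1 (\<lambda>w. T w $ i)" by auto
  note a2 = a1[THEN available_extends, OF _ p1]
  have "cost p1 (2 * s + 3) (\<lambda>w. (M *\<^sub>v T w - C *\<^sub>v T w) $ i)" if i: "i < n" for i
  proof -
    have "(M *\<^sub>v T w - C *\<^sub>v T w) $ i = (\<Sum>j\<in>J i. M $$ (i, j) * T w $ j) - M $$ (i, i) / of_rat 4 * T w $ i" for w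
      using i dims M row_sum(1)[OF i T] C_mult_vec[OF T i] by (simp del: index_mult_mat_vec)
    moreover have "cost p1 (2 * s + (0 + 0 + 1 + 0 + 1) + 1)
      (\<lambda>w. (\<Sum>j\<in>J i. M $$ (i, j) * T w $ j) - M $$ (i, i) / of_rat 4 * T w $ i)"
      by (intro cost_minus cost_times cost_divide cost_const cost_diag cost_row cost_available i T1)
    ultimately show ?thesis by (simp add: eval_nat_numeral add.assoc)
  qed
  from cost_family[of n p1 _ "\<lambda>i w. (M *\<^sub>v T w - C *\<^sub>v T w) $ i", OF this] obtain p2 where
    p2: "extends (n * (2 * s + 3)) p1 p2" and S2: "\<And>i. i < n \<Longrightarrow> available p2 (\<lambda>w. (M *\<^sub>v T w - C *\<^sub>v T w) $ i)" by auto
  note T2 = T1[THEN available_extends, OF _ p2] and a3 = a2[THEN available_extends, OF _ p2]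
  have "cost p2 (6 * s + 6) (\<lambda>w. U w $ i)" if i: "i < n" for i
  proof -
    have "U w $ i = h\<^sup>2 * (\<Sum>j\<in>J i. K $$ (i, j) * T w $ j) - h\<^sup>2 * (\<Sum>j\<in>J i. K $$ (i, j) * X1 w $ j)
      + (\<Sum>j\<in>J i. M $$ (i, j) * X2 w $ j)" for w
      using i M K row_sum[OF i X12(1)] row_sum[OF i X12(2)] row_sum[OF i T]
      by (simp add: U_def del: index_mult_mat_vec) 
    moreover have "cost p2 ((1 + 2 * s + 1) + (1 + 2 * s + 1) + 1 + 2 * s + 1)
      (\<lambda>w. h\<^sup>2 * (\<Sum>j\<in>J i. K $$ (i, j) * T w $ j) - h\<^sup>2 * (\<Sum>j\<in>J i. K $$ (i, j) * X1 w $ j)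
      + (\<Sum>j\<in>J i. M $$ (i, j) * X2 w $ j))"
      by (intro cost_add cost_minus cost_times cost_h2 cost_row i T2 a3)
    ultimately show ?thesis by (simp add: eval_nat_numeral add.assoc)
  qed
  from cost_family[of n p2 _ "\<lambda>i w. U w $ i", OF this] obtain p3 where
    p3: "extends (n * (6 * s + 6)) p2 p3" and U3: "\<And>i. i < n \<Longrightarrow> available p3 (\<lambda>w. U w $ i)" by auto
  note T3 = T2[THEN available_extends, OF _ p3] and S3 = S2[THEN available_extends, OF _ p3]
  have "cost p3 1 (\<lambda>w. U w $ i / M $$ (i, i))" if i: "i < n" for i
    using cost_divide[OF cost_available[OF U3[OF i]] cost_diag[of p3 i]] by simp
  from cost_family[of n p3 _ "\<lambda>i w. U w $ i / M $$ (i, i)", OF this] obtain p4 where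
    p4: "extends n p3 p4" and V4: "\<And>i. i < n \<Longrightarrow> available p4 (\<lambda>w. U w $ i / M $$ (i, i))" by auto
  note T4 = T3[THEN available_extends, OF _ p4] and S4 = S3[THEN available_extends, OF _ p4]
    and U4 = U3[THEN available_extends, OF _ p4]
  have "extends (n * (12 * s + 15)) p p4"
    using extends_trans[OF extends_trans[OF extends_trans[OF p1 p2] p3] p4]
    by (rule extends_mono) (simp add: algebra_simps)
  moreover have "available_vec p4 (\<lambda>w. A *\<^sub>v X w)"
    unfolding available_vec_def
  proof (intro allI impI)
    fix i assume i: "i < n + n"
    have ex: "(A *\<^sub>v X w) $ i = (if i < n then (M *\<^sub>v T w - C *\<^sub>v T w) $ i else U w $ (i - n))" if "w \<in> W" for w
      unfolding AX[OF that] using i M U[of w] dims by (simp del: index_mult_mat_vec)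
    show "available p4 (\<lambda>w. (A *\<^sub>v X w) $ i)"
    proof (cases "i < n")
      case True
      show ?thesis by (rule available_cong[OF _ S4[OF True]]) (use ex True in auto)
    next
      case False
      show ?thesis by (rule available_cong[OF _ U4[of "i - n"]]) (use ex False i in auto)
    qed
  qed
  moreover have "available_vec p4 (\<lambda>w. mat_inv P *\<^sub>v (A *\<^sub>v X w))"
    unfolding available_vec_def
  proof (intro allI impI)
    fix i assume i: "i < n + n"
    have ex: "(mat_inv P *\<^sub>v (A *\<^sub>v X w)) $ i = (if i < n then T w $ i else U w $ (i - n) / M $$ (i - n, i - n))" if "w \<in> W" for w
      unfolding AX[OF that] P_inv_mult[OF T U] using i T[of w] by simp
    show "available p4 (\<lambda>w. (mat_inv P *\<^sub>v (A *\<^sub>v X w)) $ i)"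
    proof (cases "i < n")
      case True
      show ?thesis by (rule available_cong[OF _ T4[OF True]]) (use ex True in auto)
    next
      case False
      show ?thesis by (rule available_cong[OF _ V4[of "i - n"]]) (use ex False i in auto)
    qed
  qed
  ultimately show ?thesis by (rule that)
qed

lemma cost_scalar_prod:
  assumes "available_vec p X" "available_vec p Y" "\<And>w. w \<in> W \<Longrightarrow> Y w \<in> carrier_vec (n + n)"
  shows "cost p (4 * n) (\<lambda>w. X w \<bullet> Y w)"
proof -
  have "cost p 1 (\<lambda>w. X w $ i * Y w $ i)" if "i \<in> {0..<n + n}" for i
    using cost_times[OF cost_available cost_available] assms that by (simp add: available_vec_def)
  \<comment> \<open>One multiplication and one addition for each of the \<open>2 * n\<close>
    components.\<close>
  then have "cost p (card {0..<n + n} * (1 + 1)) (\<lambda>w. \<Sum>i = 0..<n + n. X w $ i * Y w $ i)"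
    by (intro cost_sum) auto
  then have "cost p (4 * n) (\<lambda>w. \<Sum>i = 0..<n + n. X w $ i * Y w $ i)" by (rule cost_mono) simp
  then show ?thesis by (rule cost_cong[rotated]) (use assms(3)[THEN carrier_vecD] in \<open>auto simp: scalar_prod_def\<close>)
qed

lemma cost_axpy:
  assumes "available_vec p X" "available_vec p Y" "available p a"
    and "\<And>w. w \<in> W \<Longrightarrow> X w \<in> carrier_vec (n + n)" "\<And>w. w \<in> W \<Longrightarrow> Y w \<in> carrier_vec (n + n)"
    and Z: "(\<forall>w\<in>W. Z w = X w + a w \<cdot>\<^sub>v Y w) \<or> (\<forall>w\<in>W. Z w = X w - a w \<cdot>\<^sub>v Y w)"
  obtains p' where "extends (4 * n) p p'" "available_vec p' Z"
proof -
  have "cost p 2 (\<lambda>w. Z w $ i)" if i: "i < n + n" for i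
  proof (cases "\<forall>w\<in>W. Z w = X w - a w \<cdot>\<^sub>v Y w")
    case True
    have "cost p 2 (\<lambda>w. X w $ i - a w * Y w $ i)"
      using cost_minus[OF cost_available cost_times[OF cost_available cost_available], of p "\<lambda>w. X w $ i" a "\<lambda>w. Y w $ i"]
        assms i by (simp add: available_vec_def eval_nat_numeral)
    then show ?thesis by (rule cost_cong[rotated]) (use True assms(4,5)[THEN carrier_vecD] i in simp)
  next
    case False
    then have F: "\<forall>w\<in>W. Z w = X w + a w \<cdot>\<^sub>v Y w" using Z by blast
    have "cost p 2 (\<lambda>w. X w $ i + a w * Y w $ i)"
      using cost_add[OF cost_available cost_times[OF cost_available cost_available], of p "\<lambda>w. X w $ i" a "\<lambda>w. Y w $ i"]
        assms i by (simp add: available_vec_def eval_nat_numeral)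
    then show ?thesis by (rule cost_cong[rotated]) (use F assms(4,5)[THEN carrier_vecD] i in simp)
  qed
  from cost_vec[OF this] obtain p' where "extends ((n + n) * 2) p p'" "available_vec p' Z" .
  then show ?thesis by (intro that) (auto elim: extends_mono)
qed

definition state :: "nat \<Rightarrow> real vec \<times> real vec \<Rightarrow> pcg_state" where
  "state k = (\<lambda>(f, x0). (pcg_step A P ^^ k) (pcg_init A P (bp_rhs f) x0))"

definition iter :: "nat \<Rightarrow> real vec \<times> real vec \<Rightarrow> real vec" where "iter k w = fst (state k w)"
definition resid :: "nat \<Rightarrow> real vec \<times> real vec \<Rightarrow> real vec" where "resid k w = fst (snd (state k w))"
definition presid :: "nat \<Rightarrow> real vec \<times> real vec \<Rightarrow> real vec" where "presid k w = fst (snd (snd (state k w)))"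
definition direct :: "nat \<Rightarrow> real vec \<times> real vec \<Rightarrow> real vec" where "direct k w = snd (snd (snd (state k w)))"

definition available_state :: "bp_input program \<Rightarrow> nat \<Rightarrow> bool" where
  "available_state p k \<longleftrightarrow> available_vec p (iter k) \<and> available_vec p (resid k) \<and>
     available_vec p (presid k) \<and> available_vec p (direct k)"

lemma rhs_carrier: "f \<in> carrier_vec n \<Longrightarrow> bp_rhs f \<in> carrier_vec (n + n)"
  by (auto simp: bp_rhs_def)

lemma state_carrier:
  assumes "w \<in> W"
  shows "iter k w \<in> carrier_vec (n + n)" "resid k w \<in> carrier_vec (n + n)"
    "presid k w \<in> carrier_vec (n + n)" "direct k w \<in> carrier_vec (n + n)"
    "presid k w = mat_inv P *\<^sub>v resid k w"
  using pcg_inv_iterate[of "bp_rhs (fst w)" "snd w" k] assms rhs_carrier[of "fst w"] A_carrier P_inv(1)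
  by (auto simp: W pcg_inv_def iter_def resid_def presid_def direct_def state_def split: prod.splits)

text \<open>Only the third equation departs from \<open>pcg_step\<close>: by linearity, applying
  \<open>mat_inv P\<close> to the new residual becomes an update with a vector that
  \<open>apply_cost\<close> delivers.\<close>

lemma state_Suc:
  fixes k w
  assumes w: "w \<in> W"
  defines "\<alpha> \<equiv> (resid k w \<bullet> presid k w) / ((A *\<^sub>v direct k w) \<bullet> direct k w)"
    and "\<beta> \<equiv> (resid (Suc k) w \<bullet> presid (Suc k) w) / (resid k w \<bullet> presid k w)"
  shows "iter (Suc k) w = iter k w + \<alpha> \<cdot>\<^sub>v direct k w"
    and "resid (Suc k) w = resid k w - \<alpha> \<cdot>\<^sub>v (A *\<^sub>v direct k w)"
    and "presid (Suc k) w = presid k w - \<alpha> \<cdot>\<^sub>v (mat_inv P *\<^sub>v (A *\<^sub>v direct k w))"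
    and "direct (Suc k) w = presid (Suc k) w + \<beta> \<cdot>\<^sub>v direct k w"
proof -
  have st: "state k w = (iter k w, resid k w, presid k w, direct k w)"
    by (simp add: iter_def resid_def presid_def direct_def)
  have step: "state (Suc k) w = pcg_step A P (state k w)"
    by (simp add: state_def split: prod.splits)
  show "iter (Suc k) w = iter k w + \<alpha> \<cdot>\<^sub>v direct k w"
    and r: "resid (Suc k) w = resid k w - \<alpha> \<cdot>\<^sub>v (A *\<^sub>v direct k w)"
    by (simp_all add: iter_def[of "Suc k"] resid_def[of "Suc k"] step st Let_def \<alpha>_def)
  show "direct (Suc k) w = presid (Suc k) w + \<beta> \<cdot>\<^sub>v direct k w"
    unfolding \<beta>_def by (simp add: direct_def[of "Suc k"] presid_def[of "Suc k"] resid_def[of "Suc k"] step st Let_def)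
  show "presid (Suc k) w = presid k w - \<alpha> \<cdot>\<^sub>v (mat_inv P *\<^sub>v (A *\<^sub>v direct k w))"
    unfolding state_carrier(5)[OF w] r using state_carrier[OF w, of k] A_carrier P_inv(1)
    by (simp add: mult_minus_distrib_mat_vec[of _ "n + n" "n + n"] mult_mat_vec[of _ "n + n" "n + n"])
qed

lemma step_cost:
  assumes "available_state p k"
  obtains p' where "extends (n * (12 * s + 49)) p p'" "available_state p' (Suc k)"
proof -
  have av: "available_vec p (iter k)" "available_vec p (resid k)"
     "available_vec p (presid k)" "available_vec p (direct k)"
    using assms by (auto simp: available_state_def)
  have car: "A *\<^sub>v direct k w \<in> carrier_vec (n + n)" "mat_inv P *\<^sub>v (A *\<^sub>v direct k w) \<in> carrier_vec (n + n)"
    if "w \<in> W" for w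
    using state_carrier[OF that] A_carrier P_inv(1) by auto
  from apply_cost[OF av(4)] state_carrier(4) obtain p1 where p1: "extends (n * (12 * s + 15)) p p1"
    and Ap: "available_vec p1 (\<lambda>w. A *\<^sub>v direct k w)" "available_vec p1 (\<lambda>w. mat_inv P *\<^sub>v (A *\<^sub>v direct k w))"
    by metis
  note av1 = av[THEN available_vec_extends, OF p1]
  define \<alpha> where "\<alpha> w = (resid k w \<bullet> presid k w) / ((A *\<^sub>v direct k w) \<bullet> direct k w)" for w
  have "cost p1 (4 * n + 4 * n + 1) \<alpha>"
    unfolding \<alpha>_def using av1 Ap state_carrier by (intro cost_divide cost_scalar_prod) auto
  then obtain p2 where p2: "extends (4 * n + 4 * n + 1) p1 p2" and \<alpha>: "available p2 \<alpha>" by (rule cost_obtain)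
  note av2 = av1[THEN available_vec_extends, OF p2] Ap[THEN available_vec_extends, OF p2]
  obtain p3 where p3: "extends (4 * n) p2 p3" and x: "available_vec p3 (iter (Suc k))"
    by (rule cost_axpy[OF av2(1,4) \<alpha>, of "iter (Suc k)"]) (use state_carrier state_Suc(1) in \<open>auto simp: \<alpha>_def\<close>)
  note av3 = av2[THEN available_vec_extends, OF p3] and \<alpha>3 = available_extends[OF \<alpha> p3]
  obtain p4 where p4: "extends (4 * n) p3 p4" and r: "available_vec p4 (resid (Suc k))"
    by (rule cost_axpy[OF av3(2,5) \<alpha>3, of "resid (Suc k)"]) (use state_carrier car state_Suc(2) in \<open>auto simp: \<alpha>_def\<close>)
  note av4 = av3[THEN available_vec_extends, OF p4] and \<alpha>4 = available_extends[OF \<alpha>3 p4]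
  obtain p5 where p5: "extends (4 * n) p4 p5" and z: "available_vec p5 (presid (Suc k))"
    by (rule cost_axpy[OF av4(3,6) \<alpha>4, of "presid (Suc k)"]) (use state_carrier car state_Suc(3) in \<open>auto simp: \<alpha>_def\<close>)
  note av5 = av4[THEN available_vec_extends, OF p5] and r5 = available_vec_extends[OF r p5]
  define \<beta> where "\<beta> w = (resid (Suc k) w \<bullet> presid (Suc k) w) / (resid k w \<bullet> presid k w)" for w
  have "cost p5 (4 * n + 4 * n + 1) \<beta>"
    unfolding \<beta>_def using av5 r5 z state_carrier by (intro cost_divide cost_scalar_prod) auto
  then obtain p6 where p6: "extends (4 * n + 4 * n + 1) p5 p6" and \<beta>: "available p6 \<beta>" by (rule cost_obtain)
  obtain p7 where p7: "extends (4 * n) p6 p7" and d: "available_vec p7 (direct (Suc k))"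
    by (rule cost_axpy[OF available_vec_extends[OF z p6] available_vec_extends[OF av5(4) p6] \<beta>, of "direct (Suc k)"])
      (use state_carrier state_Suc(4) in \<open>auto simp: \<beta>_def\<close>)
  \<comment> \<open>Four vector updates cost \<open>16 * n\<close>, four scalar products
    \<open>16 * n\<close>, two divisions 2; with the \<open>15 * n\<close> of
    \<open>apply_cost\<close> this is at most \<open>49 * n\<close>, apart from the term in
    \<open>s\<close>.\<close>
  have "extends (n * (12 * s + 49)) p p7"
    using extends_trans[OF extends_trans[OF extends_trans[OF extends_trans[OF extends_trans[OF extends_trans[OF p1 p2] p3] p4] p5] p6] p7]
    by (rule extends_mono) (use n_pos in \<open>simp add: algebra_simps\<close>)
  moreover have "available_state p7 (Suc k)"
    unfolding available_state_def
    using x r5 z d p4 p5 p6 p7 by (meson available_vec_extends)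
  ultimately show ?thesis by (rule that)
qed

text \<open>The right-hand side fits the pattern of \<open>P_inv_mult\<close> because its first
  block is \<open>M - C\<close> applied to \<open>0\<close>; its preconditioned image then has first
  block \<open>0\<close>.\<close>

lemma state_0:
  assumes w: "w \<in> W"
  shows "iter 0 w = snd w"
    and "resid 0 w = bp_rhs (fst w) - A *\<^sub>v snd w"
    and "presid 0 w = (0\<^sub>v n @\<^sub>v Matrix.vec n (\<lambda>i. fst w $ i / M $$ (i, i))) - mat_inv P *\<^sub>v (A *\<^sub>v snd w)"
    and "direct 0 w = presid 0 w"
proof -
  show "iter 0 w = snd w" and r: "resid 0 w = bp_rhs (fst w) - A *\<^sub>v snd w" and "direct 0 w = presid 0 w"
    by (simp_all add: iter_def resid_def direct_def presid_def state_def pcg_init_def Let_def split: prod.splits)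
  have w': "fst w \<in> carrier_vec n" "snd w \<in> carrier_vec (n + n)" using w by (auto simp: W)
  have "B *\<^sub>v 0\<^sub>v n = 0\<^sub>v n" if "B \<in> carrier_mat n n" for B :: "real mat"
    using that by (intro eq_vecI) (auto simp: scalar_prod_def)
  then have "bp_rhs (fst w) = (M *\<^sub>v 0\<^sub>v n - C *\<^sub>v 0\<^sub>v n) @\<^sub>v fst w"
    using w' M dims by (simp add: bp_rhs_def)
  then have "mat_inv P *\<^sub>v bp_rhs (fst w) = 0\<^sub>v n @\<^sub>v Matrix.vec n (\<lambda>i. fst w $ i / M $$ (i, i))"
    using P_inv_mult[OF _ w'(1), of "0\<^sub>v n"] by simp
  then show "presid 0 w = (0\<^sub>v n @\<^sub>v Matrix.vec n (\<lambda>i. fst w $ i / M $$ (i, i))) - mat_inv P *\<^sub>v (A *\<^sub>v snd w)"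
    unfolding state_carrier(5)[OF w] r using w' A_carrier P_inv(1) rhs_carrier
    by (simp add: mult_minus_distrib_mat_vec[of _ "n + n" "n + n"])
qed

lemma init_cost:
  obtains p where "length p \<le> n * (12 * s + 49)" "available_state p 0"
proof -
  have x: "available_vec [] snd"
    unfolding available_vec_def using available_input[of "[]" "Guess i" for i] by (simp add: env)
  have W': "snd w \<in> carrier_vec (n + n)" "fst w \<in> carrier_vec n" if "w \<in> W" for w using that by (auto simp: W)
  from apply_cost[OF x] W' obtain p1 where p1: "extends (n * (12 * s + 15)) [] p1"
    and Ax: "available_vec p1 (\<lambda>w. A *\<^sub>v snd w)" "available_vec p1 (\<lambda>w. mat_inv P *\<^sub>v (A *\<^sub>v snd w))"
    by metis
  have car: "dim_vec (A *\<^sub>v snd w) = n + n" "dim_vec (mat_inv P *\<^sub>v (A *\<^sub>v snd w)) = n + n" for w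
    using A_carrier P_inv(1) by auto
  have "cost p1 1 (\<lambda>w. resid 0 w $ i)" if i: "i < n + n" for i
  proof -
    have "cost p1 0 (\<lambda>w. bp_rhs (fst w) $ i)"
    proof (cases "i < n")
      case True
      have "cost p1 0 (\<lambda>w. of_rat 0)" by (rule cost_const)
      then show ?thesis by (rule cost_cong[rotated]) (use True W'(2)[THEN carrier_vecD] in \<open>auto simp: bp_rhs_def\<close>)
    next
      case False
      have "cost p1 0 (\<lambda>w. env w (Load (i - n)))" by (rule cost_input)
      then show ?thesis by (rule cost_cong[rotated]) (use False W'(2)[THEN carrier_vecD] i in \<open>auto simp: bp_rhs_def env\<close>)
    qed
    from cost_minus[OF this cost_available[OF available_vecD[OF Ax(1) i]]]
    have "cost p1 1 (\<lambda>w. bp_rhs (fst w) $ i - (A *\<^sub>v snd w) $ i)" by simp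
    then show ?thesis by (rule cost_cong[rotated]) (use state_0(2) car i in \<open>auto simp del: index_mult_mat_vec\<close>)
  qed
  from cost_vec[OF this] obtain p2 where p2: "extends ((n + n) * 1) p1 p2" and r: "available_vec p2 (resid 0)" .
  note Ax2 = available_vec_extends[OF Ax(2) p2]
  have "cost p2 2 (\<lambda>w. presid 0 w $ i)" if i: "i < n + n" for i
  proof -
    have "cost p2 1 (\<lambda>w. (0\<^sub>v n @\<^sub>v Matrix.vec n (\<lambda>i. fst w $ i / M $$ (i, i))) $ i)"
    proof (cases "i < n")
      case True
      have "cost p2 0 (\<lambda>w. of_rat 0)" by (rule cost_const)
      then have "cost p2 1 (\<lambda>w. of_rat 0)" by (rule cost_mono) simp
      then show ?thesis by (rule cost_cong[rotated]) (use True in auto)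
    next
      case False
      have "cost p2 1 (\<lambda>w. env w (Load (i - n)) / M $$ (i - n, i - n))"
        using cost_divide[OF cost_input cost_diag] by simp
      then show ?thesis by (rule cost_cong[rotated]) (use False i in \<open>auto simp: env\<close>)
    qed
    from cost_minus[OF this cost_available[OF available_vecD[OF Ax2 i]]]
    have "cost p2 2 (\<lambda>w. (0\<^sub>v n @\<^sub>v Matrix.vec n (\<lambda>i. fst w $ i / M $$ (i, i))) $ i - (mat_inv P *\<^sub>v (A *\<^sub>v snd w)) $ i)"
      by (simp add: eval_nat_numeral)
    then show ?thesis by (rule cost_cong[rotated]) (use state_0(3) car i in \<open>auto simp del: index_mult_mat_vec\<close>)
  qed
  from cost_vec[OF this] obtain p3 where p3: "extends ((n + n) * 2) p2 p3" and z: "available_vec p3 (presid 0)" .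
  \<comment> \<open>The actual count \<open>12 * s + 21\<close> per index is rounded up to the
    budget of one step, so that \<open>k\<close> steps cost \<open>k + 1\<close> budgets in
    all.\<close>
  have "extends (n * (12 * s + 49)) [] p3"
    using extends_trans[OF extends_trans[OF p1 p2] p3] by (rule extends_mono) (simp add: algebra_simps)
  then have "length p3 \<le> n * (12 * s + 49)" by (auto simp: extends_def)
  moreover have "available_vec p3 snd" using x p1 p2 p3 by (meson available_vec_extends)
  then have "available_vec p3 (iter 0)"
    unfolding available_vec_def by (auto elim!: available_cong[rotated] simp: state_0(1))
  moreover have "available_vec p3 (direct 0)"
    using z unfolding available_vec_def by (auto elim!: available_cong[rotated] simp: state_0(4))
  ultimately show ?thesis using z available_vec_extends[OF r p3] by (intro that) (auto simp: available_state_def)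
qed

text \<open>Memory is only appended to, so earlier iterates stay readable in the longer program, and
  one program can output all of them.\<close>

lemma iterates_cost:
  "\<exists>p. length p \<le> n * (12 * s + 49) * (k + 1) \<and> available_state p k \<and> (\<forall>m\<le>k. available_vec p (iter m))"
proof (induction k)
  case 0
  obtain p where "length p \<le> n * (12 * s + 49)" "available_state p 0" by (rule init_cost)
  then show ?case by (auto simp: available_state_def)
next
  case (Suc k)
  then obtain p where p: "length p \<le> n * (12 * s + 49) * (k + 1)" "available_state p k" "\<forall>m\<le>k. available_vec p (iter m)"
    by auto
  obtain p' where p': "extends (n * (12 * s + 49)) p p'" "available_state p' (Suc k)" by (rule step_cost[OF p(2)])
  have "length p' \<le> n * (12 * s + 49) * (Suc k + 1)" using p(1) p'(1) by (auto simp: extends_def algebra_simps)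
  moreover have "available_vec p' (iter m)" if "m \<le> Suc k" for m
    using that p(3) p' available_vec_extends[OF _ p'(1)] by (cases "m = Suc k") (auto simp: available_state_def)
  ultimately show ?case using p' by blast
qed

lemma pcg_program:
  "\<exists>p outs. length p \<le> n * (12 * s + 49) * (k + 1) \<and>
     (\<forall>f\<in>carrier_vec n. \<forall>x0\<in>carrier_vec (n + n). \<forall>m\<le>k.
        program_output (env (f, x0)) p (outs m) = pcg A P (bp_rhs f) x0 m)"
proof -
  obtain p where p: "length p \<le> n * (12 * s + 49) * (k + 1)" "\<forall>m\<le>k. available_vec p (iter m)"
    using iterates_cost by blast
  have "\<exists>a. \<forall>w\<in>W. operand_value (env w) (run_program (env w) [] p) a = iter m w $ i" if "m \<le> k" "i < n + n" for m i
    using p(2) that unfolding available_vec_def available_def by blast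
  then obtain a where a: "\<And>m i w. m \<le> k \<Longrightarrow> i < n + n \<Longrightarrow> w \<in> W \<Longrightarrow>
      operand_value (env w) (run_program (env w) [] p) (a m i) = iter m w $ i" by metis
  have "program_output (env (f, x0)) p (map (a m) [0..<n + n]) = pcg A P (bp_rhs f) x0 m"
    if "f \<in> carrier_vec n" "x0 \<in> carrier_vec (n + n)" "m \<le> k" for f x0 m
  proof -
    have w: "(f, x0) \<in> W" using that by (auto simp: W)
    have "iter m (f, x0) = pcg A P (bp_rhs f) x0 m" by (simp add: iter_def state_def pcg_def)
    then show ?thesis
      using a[OF that(3) _ w] state_carrier(1)[OF w, of m]
      by (intro eq_vecI) (auto simp: program_output_def vec_of_list_index simp del: upt_Suc)
  qed
  with p(1) show ?thesis by (intro exI[of _ p] exI[of _ "\<lambda>m. map (a m) [0..<n + n]"]) blast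
qed

end


section \<open>Assembly of the finite element matrices\<close>

lemma mult_mat_vec_form:
  fixes f :: "nat \<Rightarrow> nat \<Rightarrow> real"
  assumes "v \<in> carrier_vec n"
  shows "(Matrix.mat n n (\<lambda>(l, k). f l k) *\<^sub>v v) \<bullet> v = (\<Sum>l<n. \<Sum>k<n. f l k * v $ k * v $ l)"
  using assms by (auto simp: scalar_prod_def lessThan_atLeast0 sum_distrib_right intro!: sum.cong)

text \<open>The element matrix is \<open>a / 2\<close> times identity plus all-ones; the all-ones
  part contributes the squared sum.\<close>

lemma local_mass_form:
  fixes a :: real and v :: "nat \<Rightarrow> real"
  assumes "L \<subseteq> {..<n}"
  shows "(\<Sum>l<n. \<Sum>k<n. (if k \<in> L \<and> l \<in> L then if k = l then a else a / 2 else 0) * v k * v l) =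
    a / 2 * ((\<Sum>k\<in>L. v k)\<^sup>2 + (\<Sum>k\<in>L. (v k)\<^sup>2))"
proof -
  have fin: "finite L" using assms finite_subset by blast
  have "(\<Sum>l<n. \<Sum>k<n. (if k \<in> L \<and> l \<in> L then if k = l then a else a / 2 else 0) * v k * v l) =
    (\<Sum>l\<in>L. \<Sum>k\<in>L. (if k = l then a else a / 2) * v k * v l)"
  proof -
    have "(\<Sum>l<n. \<Sum>k<n. (if k \<in> L \<and> l \<in> L then if k = l then a else a / 2 else 0) * v k * v l) =
      (\<Sum>l\<in>L. \<Sum>k<n. (if k \<in> L \<and> l \<in> L then if k = l then a else a / 2 else 0) * v k * v l)"
      using assms by (intro sum.mono_neutral_right) auto
    also have "\<dots> = (\<Sum>l\<in>L. \<Sum>k\<in>L. (if k \<in> L \<and> l \<in> L then if k = l then a else a / 2 else 0) * v k * v l)"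
      using assms by (intro sum.cong refl sum.mono_neutral_right) auto
    finally show ?thesis by simp
  qed
  also have "\<dots> = (\<Sum>l\<in>L. \<Sum>k\<in>L. a / 2 * (v k * v l) + (if k = l then a / 2 * (v k)\<^sup>2 else 0))"
    by (intro sum.cong refl) (auto simp: power2_eq_square algebra_simps)
  also have "\<dots> = a / 2 * (\<Sum>l\<in>L. \<Sum>k\<in>L. v k * v l) + (\<Sum>l\<in>L. a / 2 * (v l)\<^sup>2)"
    using fin by (simp add: sum.distrib sum_distrib_left)
  also have "(\<Sum>l\<in>L. \<Sum>k\<in>L. v k * v l) = (\<Sum>k\<in>L. v k)\<^sup>2"
    by (simp add: power2_eq_square sum_product) (rule sum.swap)
  finally show ?thesis by (simp add: distrib_left sum_distrib_left)
qed

lemma sum_squared_le_card: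
  fixes v :: "'b \<Rightarrow> real"
  shows "(\<Sum>k\<in>L. v k)\<^sup>2 \<le> real (card L) * (\<Sum>k\<in>L. (v k)\<^sup>2)"
  using Cauchy_Schwarz_ineq_sum[of "\<lambda>_. 1" v L] by simp

section \<open>Geometry of the mesh and the data of a single element\<close>

locale p1_mesh =
  fixes \<Omega> :: "'a::euclidean_space set" and \<sigma> \<kappa> :: real and D :: "'a p1_discretization"
  assumes dim: "DIM('a) \<in> {1, 2, 3}" and dom: "bounded_lipschitz_domain \<Omega>"
    and D: "D \<in> p1_family \<Omega> \<sigma> \<kappa>"
begin

abbreviation "T \<equiv> elements D"
abbreviation "n \<equiv> num_dofs D"
abbreviation "h \<equiv> meshwidth D"

text \<open>Vertices on the boundary of the domain carry no degree of freedom, so an element may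
  contribute fewer indices than it has vertices.\<close>

definition local_dofs :: "'a set \<Rightarrow> nat set" where
  "local_dofs \<tau> = {k. k < n \<and> node D k extreme_point_of \<tau>}"

lemma mesh:
  shows fin: "finite T" and simplex: "\<tau> \<in> T \<Longrightarrow> int DIM('a) simplex \<tau>"
    and face: "\<tau> \<in> T \<Longrightarrow> \<tau>' \<in> T \<Longrightarrow> (\<tau> \<inter> \<tau>') face_of \<tau>"
    and union: "\<Union>T = closure \<Omega>"
    and node_inj: "inj_on (node D) {..<n}"
    and nodes: "node D ` {..<n} = (\<Union>\<tau>\<in>T. {x. x extreme_point_of \<tau>}) \<inter> \<Omega>"
    and hat: "k < n \<Longrightarrow> hat D k \<in> p1_space \<Omega> T"
    and hat_node: "k < n \<Longrightarrow> l < n \<Longrightarrow> hat D k (node D l) = (if l = k then 1 else 0)"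
  using D by (auto simp: p1_family_def admissible_mesh_def triangulation_def interior_nodes_def bij_betw_def)

lemma domain: "open \<Omega>" "bounded \<Omega>" "\<Omega> \<noteq> {}" "compact (closure \<Omega>)"
  using dom by (auto simp: bounded_lipschitz_domain_def compact_closure)

lemma T_nonempty: "T \<noteq> {}"
  using union domain(3) closure_subset[of \<Omega>] by auto

lemma compact_element: "\<tau> \<in> T \<Longrightarrow> compact \<tau>" and convex_element: "\<tau> \<in> T \<Longrightarrow> convex \<tau>"
  using simplex compact_simplex convex_simplex by blast+

lemma diameter_le_h: "\<tau> \<in> T \<Longrightarrow> diameter \<tau> \<le> h"
  unfolding mesh_size_def using fin by (intro Max_ge) auto

text \<open>Shape regularity bounds the radius below by the diameter of the element,
  quasi-uniformity that diameter by \<open>h\<close>. So every element contains a ball of radius at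
  least \<open>h / (\<kappa> * \<sigma>)\<close>.\<close>

lemma inball:
  assumes "\<tau> \<in> T"
  obtains z r where "0 < r" "cball z r \<subseteq> \<tau>" "h \<le> \<kappa> * \<sigma> * r" "0 < h"
proof -
  obtain z r where zr: "0 < r" "cball z r \<subseteq> \<tau>" "diameter \<tau> \<le> \<sigma> * r"
    using D assms by (auto simp: p1_family_def shape_regular_def)
  have q: "h \<le> \<kappa> * diameter \<tau>" using D assms by (auto simp: p1_family_def quasi_uniform_def)
  \<comment> \<open>A point at distance \<open>r\<close> from the centre shows
    \<open>r \<le> diameter \<tau>\<close>; the positivity of \<open>h\<close>, and from it that of
    \<open>\<kappa>\<close>, is derived from this.\<close>
  have "dist z (z + r *\<^sub>R (SOME b. b \<in> Basis)) \<le> diameter \<tau>"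
    using zr some_in_eq[of Basis] norm_Basis[of "SOME b. b \<in> Basis"]
    by (intro diameter_bounded_bound compact_imp_bounded compact_element[OF assms] subsetD[OF zr(2)])
      (auto simp: dist_norm)
  then have "r \<le> diameter \<tau>"
    using zr(1) norm_Basis[of "SOME b. b \<in> Basis"] some_in_eq[of "Basis::'a set"] by (auto simp: dist_norm)
  then have hd: "r \<le> diameter \<tau>" "0 < diameter \<tau>" "0 < h" using zr(1) diameter_le_h[OF assms] by auto
  have "0 < \<kappa> * diameter \<tau>" using q hd by linarith
  then have "0 < \<kappa>" using hd by (simp add: zero_less_mult_iff)
  then have "h \<le> \<kappa> * (\<sigma> * r)" using q zr(3) by (meson mult_left_mono less_imp_le order_trans)
  then show ?thesis using zr hd diameter_le_h[OF assms] that[of r z] by (simp add: mult.assoc)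
qed

text \<open>A proper face has smaller affine dimension, hence empty interior, and convexity makes it
  a null set. The intersection cannot be all of both elements unless they coincide.\<close>

lemma intersection_negligible:
  assumes "\<tau> \<in> T" "\<tau>' \<in> T" "\<tau> \<noteq> \<tau>'"
  shows "negligible (\<tau> \<inter> \<tau>')"
proof -
  have *: "negligible (\<tau> \<inter> \<tau>')" if "\<tau> \<in> T" "\<tau>' \<in> T" "\<tau> \<inter> \<tau>' \<noteq> \<tau>" for \<tau> \<tau>'
  proof -
    have "aff_dim (\<tau> \<inter> \<tau>') < aff_dim \<tau>"
      using face_of_aff_dim_lt[OF convex_element face] that by blast
    also have "\<dots> = int DIM('a)" using simplex[OF that(1)] aff_dim_simplex by blast
    finally have "interior (\<tau> \<inter> \<tau>') = {}" by (metis aff_dim_nonempty_interior less_irrefl)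
    then show ?thesis using convex_element that by (simp add: negligible_convex_interior convex_Int)
  qed
  show ?thesis using *[OF assms(1,2)] *[OF assms(2,1)] assms(3) by (metis Int_commute)
qed

lemma interior_disjoint:
  assumes "\<tau> \<in> T" "\<tau>' \<in> T" "\<tau> \<noteq> \<tau>'"
  shows "interior \<tau> \<inter> interior \<tau>' = {}"
proof (rule ccontr)
  assume "interior \<tau> \<inter> interior \<tau>' \<noteq> {}"
  then have "\<not> negligible (interior \<tau> \<inter> interior \<tau>')" by (intro open_not_negligible) auto
  moreover have "negligible (interior \<tau> \<inter> interior \<tau>')"
    by (rule negligible_subset[OF intersection_negligible[OF assms]]) (meson Int_mono interior_subset)
  ultimately show False by simp
qed

text \<open>Everything the assembly takes from one element is packed into one existential statement,
  so that \<open>a\<close> and \<open>\<gamma>\<close> can be chosen for all elements at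
  once.\<close>

lemma element_data:
  assumes \<tau>: "\<tau> \<in> T"
  shows "\<exists>a \<gamma>. 0 < a \<and> measure lebesgue \<tau> = (real DIM('a) + 1) * (real DIM('a) + 2) / 2 * a \<and>
     (\<forall>k<n. \<forall>l<n. integral \<tau> (\<lambda>x. hat D k x * hat D l x) =
        (if k \<in> local_dofs \<tau> \<and> l \<in> local_dofs \<tau> then if k = l then a else a / 2 else 0)) \<and>
     (\<forall>k<n. \<forall>x\<in>interior \<tau>. grad (hat D k) x = \<gamma> k) \<and> (\<forall>k. k \<notin> local_dofs \<tau> \<longrightarrow> \<gamma> k = 0) \<and>
     (\<forall>k. h * norm (\<gamma> k) \<le> \<kappa> * \<sigma>) \<and> card (local_dofs \<tau>) \<le> DIM('a) + 1"
proof -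
  obtain C where C: "\<not> affine_dependent C" "int (card C) = int DIM('a) + 1" "\<tau> = convex hull C"
    using simplex[OF \<tau>] by (auto simp: simplex_def)
  have finC: "finite C" using C(2) by (auto intro: card_ge_0_finite)
  have ext: "x extreme_point_of \<tau> \<longleftrightarrow> x \<in> C" for x
    using extreme_point_of_convex_hull_affine_independent[OF C(1)] C(3) by simp
  have "\<exists>g h. \<forall>c'\<in>C. inner g c' + h = (if c' = c then 1 else 0)" if "c \<in> C" for c
    by (rule barycentric_coordinate_exists[OF C(1) that])
  then obtain g b where gb: "\<And>c c'. c \<in> C \<Longrightarrow> c' \<in> C \<Longrightarrow> inner (g c) c' + b c = (if c' = c then 1 else 0)"
    by metis
  interpret simplex_coordinates C g b by unfold_locales (use finC gb in auto)
  obtain z r where zr: "0 < r" "cball z r \<subseteq> \<tau>" "h \<le> \<kappa> * \<sigma> * r" "0 < h" using inball[OF \<tau>] by metis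
  have vol: "0 < measure lebesgue (convex hull C)"
  proof -
    have "0 < measure lborel (cball z r)" by (rule content_cball_pos[OF zr(1)])
    also have "\<dots> = measure lebesgue (cball z r)" by simp
    also have "\<dots> \<le> measure lebesgue \<tau>"
      by (rule measure_mono_fmeasurable[OF zr(2)]) (use compact_element[OF \<tau>] in \<open>auto simp: lmeasurable_compact\<close>)
    finally show ?thesis using C(3) by simp
  qed
  obtain a where a: "0 < a" "\<And>i j. i \<in> C \<Longrightarrow> j \<in> C \<Longrightarrow>
      integral (convex hull C) (\<lambda>x. lam i x * lam j x) = (if i = j then a else a / 2)"
    "measure lebesgue (convex hull C) = real (card C) * (real (card C) + 1) / 2 * a"
    using second_moments[OF dim vol] by blast
  have cardC: "card C = DIM('a) + 1" using C(2) by linarith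
  have loc: "k \<in> local_dofs \<tau> \<longleftrightarrow> k < n \<and> node D k \<in> C" for k by (auto simp: local_dofs_def ext)
  have C_\<tau>: "c \<in> \<tau>" if "c \<in> C" for c using that C(3) hull_inc by metis
  \<comment> \<open>A vertex inside the domain is a node, where the nodal condition decides; at any
    other vertex the hat function vanishes, and such a vertex is no node.\<close>
  have hat_vertex: "hat D k c = (if c = node D k then 1 else 0)" if k: "k < n" and c: "c \<in> C" for k c
  proof (cases "c \<in> \<Omega>")
    case True
    then have "c \<in> node D ` {..<n}" unfolding nodes using c \<tau> ext by auto
    then obtain l where l: "l < n" "c = node D l" by auto
    then show ?thesis using hat_node[OF k l(1)] node_inj k by (auto simp: inj_on_def)
  next
    case False
    moreover have "node D k \<in> \<Omega>" using nodes k by blast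
    ultimately show ?thesis using hat[OF k] by (auto simp: p1_space_def)
  qed
  have hat_lam: "hat D k x = (if k \<in> local_dofs \<tau> then lam (node D k) x else 0)" if k: "k < n" and x: "x \<in> \<tau>" for k x
  proof -
    obtain u w where uw: "\<forall>x\<in>\<tau>. hat D k x = inner u x + w"
      using hat[OF k] \<tau> unfolding p1_space_def by blast
    have "hat D k x = (\<Sum>c\<in>C. (inner u c + w) * lam c x)"
      using uw x affine_eq_lam[of x u w] C(3) by simp
    also have "\<dots> = (\<Sum>c\<in>C. hat D k c * lam c x)" using uw C_\<tau> by (intro sum.cong) auto
    also have "\<dots> = (\<Sum>c\<in>C. if c = node D k then lam c x else 0)"
      using hat_vertex[OF k] by (intro sum.cong) auto
    also have "\<dots> = (if k \<in> local_dofs \<tau> then lam (node D k) x else 0)"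
      using finC k by (simp add: loc)
    finally show ?thesis .
  qed
  define \<gamma> where "\<gamma> k = (if k \<in> local_dofs \<tau> then g (node D k) else 0)" for k
  have "integral \<tau> (\<lambda>x. hat D k x * hat D l x) =
        (if k \<in> local_dofs \<tau> \<and> l \<in> local_dofs \<tau> then if k = l then a else a / 2 else 0)" if kl: "k < n" "l < n" for k l
  proof -
    have "integral \<tau> (\<lambda>x. hat D k x * hat D l x) =
      integral \<tau> (\<lambda>x. if k \<in> local_dofs \<tau> \<and> l \<in> local_dofs \<tau> then lam (node D k) x * lam (node D l) x else 0)"
      using hat_lam kl by (intro integral_cong) auto
    then show ?thesis
      using a(2)[of "node D k" "node D l"] kl node_inj by (auto simp: loc C(3)[symmetric] inj_on_def)
  qed
  moreover have "grad (hat D k) x = \<gamma> k" if k: "k < n" and x: "x \<in> interior \<tau>" for k x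
  proof -
    have "GDERIV (hat D k) x :> \<gamma> k"
    proof -
      have "((\<lambda>x. inner (\<gamma> k) x + (if k \<in> local_dofs \<tau> then b (node D k) else 0)) has_derivative (\<lambda>y. inner y (\<gamma> k))) (at x)"
        by (auto intro!: derivative_eq_intros simp: inner_commute)
      then show ?thesis
        unfolding gderiv_def
        by (rule has_derivative_transform_within_open[OF _ open_interior x])
          (use hat_lam[OF k subsetD[OF interior_subset]] in \<open>auto simp: \<gamma>_def lam_def\<close>)
    qed
    \<comment> \<open>\<open>grad\<close> is a definite description, so uniqueness has to be shown
      along with existence.\<close>
    moreover have "g' = \<gamma> k" if "GDERIV (hat D k) x :> g'" for g'
    proof -
      have "(\<lambda>y. inner y g') = (\<lambda>y. inner y (\<gamma> k))"
        using that \<open>GDERIV (hat D k) x :> \<gamma> k\<close> unfolding gderiv_def by (rule has_derivative_unique)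
      then have "\<forall>y. inner y g' = inner y (\<gamma> k)" by (simp add: fun_eq_iff)
      then show ?thesis by (simp only: vector_eq_ldot)
    qed
    ultimately show ?thesis unfolding grad_def by (rule the_equality)
  qed
  moreover have "h * norm (\<gamma> k) \<le> \<kappa> * \<sigma>" for k
  proof -
    have ks: "0 < \<kappa> * \<sigma>" using zr by (metis less_le_trans zero_less_mult_pos2)
    have "r * norm (\<gamma> k) \<le> 1"
    proof (cases "k \<in> local_dofs \<tau> \<and> \<gamma> k \<noteq> 0")
      case False
      then show ?thesis by (auto simp: \<gamma>_def)
    next
      case True
      \<comment> \<open>From the centre of the inscribed ball, go the distance \<open>r\<close> up
        the gradient: the coordinate grows by \<open>r * norm (\<gamma> k)\<close> while staying
        between 0 and 1.\<close>
      define y where "y = z + (r / norm (\<gamma> k)) *\<^sub>R \<gamma> k"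
      have c: "node D k \<in> C" and \<gamma>: "\<gamma> k = g (node D k)" using True by (auto simp: loc \<gamma>_def)
      have in_\<tau>: "y \<in> \<tau>" "z \<in> \<tau>" using zr(1,2) True by (auto simp: y_def dist_norm)
      have "lam (node D k) y - lam (node D k) z = r / norm (\<gamma> k) * inner (\<gamma> k) (\<gamma> k)"
        by (simp add: lam_def y_def \<gamma> inner_simps)
      also have "\<dots> = r * norm (\<gamma> k)" using True by (simp add: dot_square_norm power2_eq_square)
      finally show ?thesis
        using lam_le_1[of y, OF _ c] hull_lam(1)[of z, OF _ c] in_\<tau> C(3) by simp
    qed
    then have "\<kappa> * \<sigma> * (r * norm (\<gamma> k)) \<le> \<kappa> * \<sigma>"
      using ks mult_left_mono[of "r * norm (\<gamma> k)" 1 "\<kappa> * \<sigma>"] by linarith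
    moreover have "h * norm (\<gamma> k) \<le> \<kappa> * \<sigma> * r * norm (\<gamma> k)" using zr(3) by (intro mult_right_mono) auto
    ultimately show ?thesis by (simp add: mult.assoc)
  qed
  moreover have "card (local_dofs \<tau>) \<le> DIM('a) + 1"
  proof -
    have "card (local_dofs \<tau>) = card (node D ` local_dofs \<tau>)"
      by (rule card_image[symmetric]) (use node_inj in \<open>auto simp: inj_on_def local_dofs_def\<close>)
    also have "\<dots> \<le> card C" by (rule card_mono[OF finC]) (auto simp: loc)
    finally show ?thesis using cardC by simp
  qed
  ultimately show ?thesis
    using a(1,3) cardC C(3) by (intro exI[of _ a] exI[of _ \<gamma>]) (auto simp: \<gamma>_def algebra_simps)
qed

text \<open>Passing from the domain to its closure is harmless because the hat functions vanish
  outside the domain. The closure is the union of the elements, and these overlap only in null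
  sets.\<close>

lemma mass_entry:
  assumes k: "k < n" and l: "l < n"
  shows "(LINT x:\<Omega>|lebesgue. hat D k x * hat D l x) = (\<Sum>\<tau>\<in>T. integral \<tau> (\<lambda>x. hat D k x * hat D l x))"
proof -
  let ?F = "\<lambda>x. hat D k x * hat D l x"
  have cont: "continuous_on (closure \<Omega>) ?F"
    using hat[OF k] hat[OF l] by (auto simp: p1_space_def intro: continuous_on_mult)
  have zero: "hat D k x = 0" if "x \<notin> \<Omega>" for x using hat[OF k] that by (auto simp: p1_space_def)
  note lb = borel_integrable_compact[OF domain(4) cont]
  have int: "set_integrable lebesgue (closure \<Omega>) ?F"
    using lb integrable_completion[OF borel_measurable_integrable[OF lb]] by (simp add: set_integrable_def)
  have "(LINT x:\<Omega>|lebesgue. ?F x) = (LINT x:closure \<Omega>|lebesgue. ?F x)"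
    unfolding set_lebesgue_integral_def
    using zero closure_subset[of \<Omega>] by (intro Bochner_Integration.integral_cong) (auto simp: indicator_def)
  also have "\<dots> = integral (closure \<Omega>) ?F" by (rule set_lebesgue_integral_eq_integral(2)[OF int])
  also have "\<dots> = (\<Sum>\<tau>\<in>T. integral \<tau> ?F)"
  proof -
    have "(?F has_integral (\<Sum>\<tau>\<in>T. integral \<tau> ?F)) (\<Union>T)"
    proof (rule has_integral_Union[OF fin])
      fix \<tau> assume \<tau>: "\<tau> \<in> T"
      then have "\<tau> \<subseteq> closure \<Omega>" using union by auto
      then show "(?F has_integral integral \<tau> ?F) \<tau>"
        by (intro integrable_integral integrable_on_compact compact_element \<tau> continuous_on_subset[OF cont])
    qed (use intersection_negligible in \<open>auto simp: pairwise_def\<close>)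
    then show ?thesis unfolding union by (rule integral_unique)
  qed
  finally show ?thesis .
qed

text \<open>Gradients are known in element interiors only, hence the weight
  \<open>\<Omega> \<inter> interior \<tau>\<close>; the rest of the domain lies in the frontiers of
  convex sets, which are null. Of this weight only nonnegativity and the bound by the element volume
  are used later.\<close>

lemma stiffness_entry:
  assumes k: "k < n" and l: "l < n"
    and \<gamma>: "\<And>\<tau> k x. \<tau> \<in> T \<Longrightarrow> k < n \<Longrightarrow> x \<in> interior \<tau> \<Longrightarrow> grad (hat D k) x = \<gamma> \<tau> k"
  shows "(LINT x:\<Omega>|lebesgue. inner (grad (hat D k) x) (grad (hat D l) x)) =
    (\<Sum>\<tau>\<in>T. measure lebesgue (\<Omega> \<inter> interior \<tau>) * inner (\<gamma> \<tau> k) (\<gamma> \<tau> l))"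
proof -
  let ?f = "\<lambda>x. indicator \<Omega> x *\<^sub>R inner (grad (hat D k) x) (grad (hat D l) x)"
  let ?g = "\<lambda>x. \<Sum>\<tau>\<in>T. indicator (\<Omega> \<inter> interior \<tau>) x * inner (\<gamma> \<tau> k) (\<gamma> \<tau> l)"
  have meas: "\<Omega> \<inter> interior \<tau> \<in> lmeasurable" for \<tau>
    using domain(1,2) by (intro bounded_set_imp_lmeasurable bounded_Int) (auto simp: open_Int borel_open)
  have "negligible (\<Union>\<tau>\<in>T. frontier \<tau>)"
    using fin convex_element by (intro negligible_Union) (auto intro: negligible_convex_frontier)
  then have "(\<Union>\<tau>\<in>T. frontier \<tau>) \<in> null_sets lebesgue" by (simp add: negligible_iff_null_sets)
  then have ae: "AE x in lebesgue. ?g x = ?f x"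
  proof (rule AE_I')
    show "{x \<in> space lebesgue. ?g x \<noteq> ?f x} \<subseteq> (\<Union>\<tau>\<in>T. frontier \<tau>)"
    proof (intro subsetI, rule ccontr)
      fix x assume "x \<in> {x \<in> space lebesgue. ?g x \<noteq> ?f x}" and nf: "x \<notin> (\<Union>\<tau>\<in>T. frontier \<tau>)"
      then have ne: "?g x \<noteq> ?f x" by simp
      show False
      proof (cases "x \<in> \<Omega>")
        case False
        then show False using ne by simp
      next
        case True
        then have "x \<in> \<Union>T" using union closure_subset[of \<Omega>] by auto
        then obtain \<tau> where \<tau>: "\<tau> \<in> T" "x \<in> \<tau>" by auto
        then have xi: "x \<in> interior \<tau>" using nf closure_subset[of \<tau>] by (auto simp: frontier_def)
        have "?g x = (\<Sum>\<tau>'\<in>T. if \<tau>' = \<tau> then inner (\<gamma> \<tau> k) (\<gamma> \<tau> l) else 0)"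
          using True xi interior_disjoint[OF \<tau>(1)] by (intro sum.cong) (auto simp: indicator_def)
        also have "\<dots> = ?f x" using fin \<tau>(1) True \<gamma>[OF \<tau>(1) k xi] \<gamma>[OF \<tau>(1) l xi] by simp
        finally show False using ne by simp
      qed
    qed
  qed
  have gm: "?g \<in> borel_measurable lebesgue"
    using meas by (intro borel_measurable_sum borel_measurable_times) (auto simp: fmeasurableD)
  have "(LINT x|lebesgue. ?f x) = (LINT x|lebesgue. ?g x)"
    using ae borel_measurable_AE[OF gm ae] gm by (intro integral_cong_AE) auto
  also have "\<dots> = (\<Sum>\<tau>\<in>T. measure lebesgue (\<Omega> \<inter> interior \<tau>) * inner (\<gamma> \<tau> k) (\<gamma> \<tau> l))"
    using meas[unfolded lmeasurable_iff_integrable]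
    by (subst Bochner_Integration.integral_sum) auto
  finally show ?thesis by (simp add: set_lebesgue_integral_def)
qed

text \<open>A packing argument: the elements at a node lie in the ball of radius \<open>h\<close>
  around it and contain disjoint balls of radius \<open>h / (\<kappa> * \<sigma>)\<close>; volumes
  are compared.\<close>

lemma elements_at_node:
  assumes k: "k < n"
  shows "real (card {\<tau> \<in> T. k \<in> local_dofs \<tau>}) \<le> (\<kappa> * \<sigma>) ^ DIM('a)"
proof -
  let ?S = "{\<tau> \<in> T. k \<in> local_dofs \<tau>}"
  have "\<exists>z. ball z (h / (\<kappa> * \<sigma>)) \<subseteq> \<tau> \<and> 0 < h \<and> 0 < \<kappa> * \<sigma>" if \<tau>: "\<tau> \<in> T" for \<tau>
  proof -
    obtain z r where zr: "0 < r" "cball z r \<subseteq> \<tau>" "h \<le> \<kappa> * \<sigma> * r" "0 < h" using inball[OF \<tau>] by metis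
    then have ks: "0 < \<kappa> * \<sigma>" by (metis less_le_trans zero_less_mult_pos2)
    then have "h / (\<kappa> * \<sigma>) \<le> r" using zr by (simp add: divide_le_eq mult.commute)
    then have "ball z (h / (\<kappa> * \<sigma>)) \<subseteq> cball z r" by auto
    then show ?thesis using zr ks by blast
  qed
  then obtain z where z: "\<And>\<tau>. \<tau> \<in> T \<Longrightarrow> ball (z \<tau>) (h / (\<kappa> * \<sigma>)) \<subseteq> \<tau>" and pos: "0 < h" "0 < \<kappa> * \<sigma>"
    using T_nonempty by (metis all_not_in_conv)
  let ?r = "h / (\<kappa> * \<sigma>)"
  have r: "0 < ?r" using pos by simp
  have disj: "disjoint_family_on (\<lambda>\<tau>. ball (z \<tau>) ?r) ?S"
    unfolding disjoint_family_on_def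
  proof (intro ballI impI)
    fix \<tau> \<tau>' assume "\<tau> \<in> ?S" "\<tau>' \<in> ?S" "\<tau> \<noteq> \<tau>'"
    then have t: "\<tau> \<in> T" "\<tau>' \<in> T" and "interior \<tau> \<inter> interior \<tau>' = {}" using interior_disjoint by auto
    moreover have "ball (z \<tau>) ?r \<subseteq> interior \<tau>" "ball (z \<tau>') ?r \<subseteq> interior \<tau>'"
      using z t by (simp_all add: interior_maximal)
    ultimately show "ball (z \<tau>) ?r \<inter> ball (z \<tau>') ?r = {}" by blast
  qed
  have sub: "(\<Union>\<tau>\<in>?S. ball (z \<tau>) ?r) \<subseteq> cball (node D k) h"
  proof
    fix y assume "y \<in> (\<Union>\<tau>\<in>?S. ball (z \<tau>) ?r)"
    then obtain \<tau> where \<tau>: "\<tau> \<in> T" "k \<in> local_dofs \<tau>" "y \<in> \<tau>" using z by blast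
    then have "node D k \<in> \<tau>" by (auto simp: local_dofs_def extreme_point_of_def)
    then have "dist (node D k) y \<le> diameter \<tau>"
      using \<tau> by (intro diameter_bounded_bound compact_imp_bounded compact_element)
    then show "y \<in> cball (node D k) h" using diameter_le_h[OF \<tau>(1)] by simp
  qed
  let ?u = "unit_ball_vol (real DIM('a))"
  have "real (card ?S) * (?u * ?r ^ DIM('a)) = (\<Sum>\<tau>\<in>?S. measure lborel (ball (z \<tau>) ?r))"
    using r by (simp add: content_ball)
  also have "\<dots> = measure lborel (\<Union>\<tau>\<in>?S. ball (z \<tau>) ?r)"
    using fin disj by (intro measure_finite_Union[symmetric]) (auto simp: emeasure_ball r less_imp_le)
  also have "\<dots> \<le> measure lborel (cball (node D k) h)"
    by (rule measure_mono_fmeasurable[OF sub])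
      (auto intro!: sets.finite_UN fin fmeasurableI simp: emeasure_cball less_imp_le[OF pos(1)])
  also have "\<dots> = ?u * h ^ DIM('a)" using pos by (simp add: content_cball)
  finally have "real (card ?S) * ?r ^ DIM('a) \<le> h ^ DIM('a)" by (simp add: mult.left_commute)
  then have "real (card ?S) * h ^ DIM('a) \<le> (\<kappa> * \<sigma>) ^ DIM('a) * h ^ DIM('a)"
    using pos by (simp add: power_divide divide_le_eq mult.commute)
  then show ?thesis using pos by simp
qed

end


section \<open>Stability and sparsity of the assembled matrices\<close>

lemma sum_form_swap:
  fixes F :: "'b \<Rightarrow> nat \<Rightarrow> nat \<Rightarrow> real"
  shows "(\<Sum>l<n. \<Sum>k<n. (\<Sum>\<tau>\<in>T. F \<tau> l k) * v k * v l) = (\<Sum>\<tau>\<in>T. \<Sum>l<n. \<Sum>k<n. F \<tau> l k * v k * v l)"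
proof -
  have "(\<Sum>l<n. \<Sum>k<n. (\<Sum>\<tau>\<in>T. F \<tau> l k) * v k * v l) = (\<Sum>l<n. \<Sum>\<tau>\<in>T. \<Sum>k<n. F \<tau> l k * v k * v l)"
    by (intro sum.cong refl) (subst sum.swap, simp add: sum_distrib_right)
  then show ?thesis by (subst (asm) sum.swap)
qed

context p1_mesh
begin

text \<open>With \<open>d\<close> the dimension, the first summand bounds \<open>M\<close>, from
  \<open>a / 2 * (d + 2)\<close> against \<open>a / 4\<close>. The second bounds
  \<open>h\<^sup>2 K\<close>: the volume formula gives \<open>(d + 1) * (d + 2) / 2\<close>,
  Cauchy-Schwarz another \<open>d + 1\<close>, and the scale \<open>a / 4\<close> of
  \<open>C\<close> a factor 4.\<close>

definition stability_const :: real where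
  "stability_const = 2 * (real DIM('a) + 2) + 2 * (\<kappa> * \<sigma>)\<^sup>2 * (real DIM('a) + 1)\<^sup>2 * (real DIM('a) + 2)"

text \<open>The rounded power bounds the number of elements at a node, the other factor the indices
  of each.\<close>

definition row_bound :: nat where
  "row_bound = (DIM('a) + 1) * nat \<lceil>(\<kappa> * \<sigma>) ^ DIM('a)\<rceil>"

definition neighbours :: "nat \<Rightarrow> nat set" where
  "neighbours i = {j. \<exists>\<tau>\<in>T. i \<in> local_dofs \<tau> \<and> j \<in> local_dofs \<tau>}"

lemma local_dofs_sub: "local_dofs \<tau> \<subseteq> {..<n}"
  by (auto simp: local_dofs_def)

lemma assembly:
  obtains a m :: "'a set \<Rightarrow> real" and \<gamma> :: "'a set \<Rightarrow> nat \<Rightarrow> 'a" where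
    "\<And>\<tau>. \<tau> \<in> T \<Longrightarrow> 0 < a \<tau>"
    "\<And>\<tau>. \<tau> \<in> T \<Longrightarrow> 0 \<le> m \<tau> \<and> m \<tau> \<le> (real DIM('a) + 1) * (real DIM('a) + 2) / 2 * a \<tau>"
    "\<And>\<tau> k. \<tau> \<in> T \<Longrightarrow> k \<notin> local_dofs \<tau> \<Longrightarrow> \<gamma> \<tau> k = 0"
    "\<And>\<tau> k. \<tau> \<in> T \<Longrightarrow> h * norm (\<gamma> \<tau> k) \<le> \<kappa> * \<sigma>"
    "\<And>\<tau>. \<tau> \<in> T \<Longrightarrow> card (local_dofs \<tau>) \<le> DIM('a) + 1"
    "mass_matrix \<Omega> D = Matrix.mat n n (\<lambda>(l, k). \<Sum>\<tau>\<in>T.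
       if k \<in> local_dofs \<tau> \<and> l \<in> local_dofs \<tau> then if k = l then a \<tau> else a \<tau> / 2 else 0)"
    "stiffness_matrix \<Omega> D = Matrix.mat n n (\<lambda>(l, k). \<Sum>\<tau>\<in>T. m \<tau> * inner (\<gamma> \<tau> k) (\<gamma> \<tau> l))"
proof -
  define Q where "Q \<tau> a \<gamma> \<longleftrightarrow> 0 < a \<and> measure lebesgue \<tau> = (real DIM('a) + 1) * (real DIM('a) + 2) / 2 * a \<and>
     (\<forall>k<n. \<forall>l<n. integral \<tau> (\<lambda>x. hat D k x * hat D l x) =
        (if k \<in> local_dofs \<tau> \<and> l \<in> local_dofs \<tau> then if k = l then a else a / 2 else 0)) \<and>
     (\<forall>k<n. \<forall>x\<in>interior \<tau>. grad (hat D k) x = \<gamma> k) \<and> (\<forall>k. k \<notin> local_dofs \<tau> \<longrightarrow> \<gamma> k = 0) \<and>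
     (\<forall>k. h * norm (\<gamma> k) \<le> \<kappa> * \<sigma>) \<and> card (local_dofs \<tau>) \<le> DIM('a) + 1" for \<tau> a \<gamma>
  have "\<forall>\<tau>\<in>T. \<exists>a \<gamma>. Q \<tau> a \<gamma>" unfolding Q_def by (intro ballI element_data)
  then obtain a \<gamma> where Q: "\<And>\<tau>. \<tau> \<in> T \<Longrightarrow> Q \<tau> (a \<tau>) (\<gamma> \<tau>)" by metis
  have 1: "0 < a \<tau>" "measure lebesgue \<tau> = (real DIM('a) + 1) * (real DIM('a) + 2) / 2 * a \<tau>" if "\<tau> \<in> T" for \<tau>
    using Q[OF that] by (simp_all add: Q_def)
  have 2: "integral \<tau> (\<lambda>x. hat D k x * hat D l x) =
        (if k \<in> local_dofs \<tau> \<and> l \<in> local_dofs \<tau> then if k = l then a \<tau> else a \<tau> / 2 else 0)"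
    if "\<tau> \<in> T" "k < n" "l < n" for \<tau> k l
    using Q[OF that(1)] that(2,3) unfolding Q_def by blast
  have 3: "grad (hat D k) x = \<gamma> \<tau> k" if "\<tau> \<in> T" "k < n" "x \<in> interior \<tau>" for \<tau> k x
    using Q[OF that(1)] that(2,3) unfolding Q_def by blast
  have 4: "\<And>k. k \<notin> local_dofs \<tau> \<Longrightarrow> \<gamma> \<tau> k = 0" "\<And>k. h * norm (\<gamma> \<tau> k) \<le> \<kappa> * \<sigma>"
    "card (local_dofs \<tau>) \<le> DIM('a) + 1" if "\<tau> \<in> T" for \<tau>
    using Q[OF that] unfolding Q_def by blast+
  define m where "m \<tau> = measure lebesgue (\<Omega> \<inter> interior \<tau>)" for \<tau>
  have "m \<tau> \<le> measure lebesgue \<tau>" if "\<tau> \<in> T" for \<tau>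
    unfolding m_def
  proof (rule measure_mono_fmeasurable)
    show "\<Omega> \<inter> interior \<tau> \<subseteq> \<tau>" using interior_subset by auto
    show "\<Omega> \<inter> interior \<tau> \<in> sets lebesgue" using domain(1) by (auto intro: borel_open)
    show "\<tau> \<in> lmeasurable" by (intro lmeasurable_compact compact_element that)
  qed
  moreover have "mass_matrix \<Omega> D = Matrix.mat n n (\<lambda>(l, k). \<Sum>\<tau>\<in>T.
       if k \<in> local_dofs \<tau> \<and> l \<in> local_dofs \<tau> then if k = l then a \<tau> else a \<tau> / 2 else 0)"
    unfolding mass_matrix_def by (intro cong_mat) (auto simp: mass_entry 2 intro!: sum.cong)
  moreover have "stiffness_matrix \<Omega> D = Matrix.mat n n (\<lambda>(l, k). \<Sum>\<tau>\<in>T. m \<tau> * inner (\<gamma> \<tau> k) (\<gamma> \<tau> l))"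
    unfolding stiffness_matrix_def m_def by (intro cong_mat) (auto intro!: stiffness_entry 3)
  ultimately show ?thesis using 1 4 by (intro that[of a m \<gamma>]) (auto simp: m_def)
qed

text \<open>All forms are sums of local quantities over the elements, so each inequality is proved
  summand by summand against \<open>a \<tau> / 4 * S \<tau> v\<close>, the local share of the form
  of \<open>C\<close>.\<close>

lemma fem_matrices: "fem_matrices n (mass_matrix \<Omega> D) (stiffness_matrix \<Omega> D) h stability_const"
proof -
  obtain a m :: "'a set \<Rightarrow> real" and \<gamma> :: "'a set \<Rightarrow> nat \<Rightarrow> 'a" where a: "\<And>\<tau>. \<tau> \<in> T \<Longrightarrow> 0 < a \<tau>"
    and m: "\<And>\<tau>. \<tau> \<in> T \<Longrightarrow> 0 \<le> m \<tau> \<and> m \<tau> \<le> (real DIM('a) + 1) * (real DIM('a) + 2) / 2 * a \<tau>"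
    and \<gamma>0: "\<And>\<tau> k. \<tau> \<in> T \<Longrightarrow> k \<notin> local_dofs \<tau> \<Longrightarrow> \<gamma> \<tau> k = 0"
    and \<gamma>: "\<And>\<tau> k. \<tau> \<in> T \<Longrightarrow> h * norm (\<gamma> \<tau> k) \<le> \<kappa> * \<sigma>"
    and card: "\<And>\<tau>. \<tau> \<in> T \<Longrightarrow> card (local_dofs \<tau>) \<le> DIM('a) + 1"
    and M: "mass_matrix \<Omega> D = Matrix.mat n n (\<lambda>(l, k). \<Sum>\<tau>\<in>T.
       if k \<in> local_dofs \<tau> \<and> l \<in> local_dofs \<tau> then if k = l then a \<tau> else a \<tau> / 2 else 0)"
    and K: "stiffness_matrix \<Omega> D = Matrix.mat n n (\<lambda>(l, k). \<Sum>\<tau>\<in>T. m \<tau> * inner (\<gamma> \<tau> k) (\<gamma> \<tau> l))"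
    by (rule assembly) blast
  let ?M = "mass_matrix \<Omega> D" and ?K = "stiffness_matrix \<Omega> D" and ?d = "real DIM('a)"
  define S where "S \<tau> v = (\<Sum>k\<in>local_dofs \<tau>. (v $ k)\<^sup>2)" for \<tau> and v :: "real vec"
  have S0: "0 \<le> S \<tau> v" for \<tau> v by (auto simp: S_def intro: sum_nonneg)
  have Mii: "?M $$ (i, i) = (\<Sum>\<tau>\<in>T. if i \<in> local_dofs \<tau> then a \<tau> else 0)" if "i < n" for i
    using that by (simp add: M cong: if_cong)
  have diag: "(\<Sum>i<n. ?M $$ (i, i) / 4 * (v $ i)\<^sup>2) = (\<Sum>\<tau>\<in>T. a \<tau> / 4 * S \<tau> v)" for v :: "real vec"
  proof -
    have "(\<Sum>i<n. ?M $$ (i, i) / 4 * (v $ i)\<^sup>2) = (\<Sum>i<n. \<Sum>\<tau>\<in>T. if i \<in> local_dofs \<tau> then a \<tau> / 4 * (v $ i)\<^sup>2 else 0)"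
      by (intro sum.cong refl) (auto simp: Mii sum_divide_distrib sum_distrib_right intro!: sum.cong)
    also have "\<dots> = (\<Sum>\<tau>\<in>T. \<Sum>i<n. if i \<in> local_dofs \<tau> then a \<tau> / 4 * (v $ i)\<^sup>2 else 0)" by (rule sum.swap)
    also have "\<dots> = (\<Sum>\<tau>\<in>T. \<Sum>i\<in>local_dofs \<tau>. a \<tau> / 4 * (v $ i)\<^sup>2)"
    proof (rule sum.cong[OF refl])
      fix \<tau>
      have "(\<Sum>i<n. if i \<in> local_dofs \<tau> then a \<tau> / 4 * (v $ i)\<^sup>2 else 0) =
        (\<Sum>i\<in>local_dofs \<tau>. if i \<in> local_dofs \<tau> then a \<tau> / 4 * (v $ i)\<^sup>2 else 0)"
        using local_dofs_sub by (intro sum.mono_neutral_right) auto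
      then show "(\<Sum>i<n. if i \<in> local_dofs \<tau> then a \<tau> / 4 * (v $ i)\<^sup>2 else 0) =
        (\<Sum>i\<in>local_dofs \<tau>. a \<tau> / 4 * (v $ i)\<^sup>2)" by simp
    qed
    finally show ?thesis by (simp add: S_def sum_distrib_left)
  qed
  have Mform: "(?M *\<^sub>v v) \<bullet> v = (\<Sum>\<tau>\<in>T. a \<tau> / 2 * ((\<Sum>k\<in>local_dofs \<tau>. v $ k)\<^sup>2 + S \<tau> v))"
    if "v \<in> carrier_vec n" for v
    unfolding M mult_mat_vec_form[OF that] sum_form_swap local_mass_form[OF local_dofs_sub] S_def ..
  have Kform: "(?K *\<^sub>v v) \<bullet> v = (\<Sum>\<tau>\<in>T. m \<tau> * (norm (\<Sum>k<n. v $ k *\<^sub>R \<gamma> \<tau> k))\<^sup>2)"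
    if "v \<in> carrier_vec n" for v
    unfolding K mult_mat_vec_form[OF that] sum_form_swap
    by (intro sum.cong refl) (simp add: power2_norm_eq_inner inner_sum_left inner_sum_right sum_distrib_left mult_ac inner_commute)
  have sq: "(\<Sum>k\<in>local_dofs \<tau>. u k)\<^sup>2 \<le> (?d + 1) * (\<Sum>k\<in>local_dofs \<tau>. (u k)\<^sup>2)" if "\<tau> \<in> T" for \<tau> and u :: "nat \<Rightarrow> real"
  proof -
    have "(\<Sum>k\<in>local_dofs \<tau>. u k)\<^sup>2 \<le> real (card (local_dofs \<tau>)) * (\<Sum>k\<in>local_dofs \<tau>. (u k)\<^sup>2)"
      by (rule sum_squared_le_card)
    also have "\<dots> \<le> (?d + 1) * (\<Sum>k\<in>local_dofs \<tau>. (u k)\<^sup>2)"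
      using card[OF that] by (intro mult_right_mono sum_nonneg) auto
    finally show ?thesis .
  qed
  have c1: "2 * (?d + 2) \<le> stability_const"
    and c2: "2 * (\<kappa> * \<sigma>)\<^sup>2 * (?d + 1)\<^sup>2 * (?d + 2) \<le> stability_const" by (auto simp: stability_const_def)
  show ?thesis
  proof
    show "?M \<in> carrier_mat n n" "?K \<in> carrier_mat n n" by (simp_all add: M K)
    show "transpose_mat ?M = ?M" unfolding M by (intro eq_matI) (auto intro!: sum.cong)
    show "transpose_mat ?K = ?K" unfolding K by (intro eq_matI) (auto intro!: sum.cong simp: inner_commute)
    show "0 < stability_const" using c1 by (simp add: stability_const_def add_pos_nonneg)
    show "0 < ?M $$ (i, i)" if i: "i < n" for i
    proof -
      have "node D i \<in> (\<Union>\<tau>\<in>T. {x. x extreme_point_of \<tau>})" using nodes i by blast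
      then obtain \<tau> where \<tau>: "\<tau> \<in> T" "i \<in> local_dofs \<tau>" using i by (auto simp: local_dofs_def)
      then show ?thesis unfolding Mii[OF i] using fin a
        by (intro sum_pos2[OF fin \<tau>(1)]) (auto simp: less_imp_le)
    qed
    fix v :: "real vec" assume v: "v \<in> carrier_vec n"
    show "2 * (\<Sum>i<n. ?M $$ (i, i) / 4 * (v $ i)\<^sup>2) \<le> (?M *\<^sub>v v) \<bullet> v"
      unfolding diag Mform[OF v] sum_distrib_left
    proof (rule sum_mono)
      fix \<tau> assume "\<tau> \<in> T"
      \<comment> \<open>Dropping the squared sum leaves exactly twice the local form of
        \<open>C\<close>, the origin of the 2 in \<open>M_lower\<close>.\<close>
      then have "0 \<le> a \<tau> / 2 * (\<Sum>k\<in>local_dofs \<tau>. v $ k)\<^sup>2" using a[of \<tau>] by simp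
      then show "2 * (a \<tau> / 4 * S \<tau> v) \<le> a \<tau> / 2 * ((\<Sum>k\<in>local_dofs \<tau>. v $ k)\<^sup>2 + S \<tau> v)"
        by (simp add: distrib_left)
    qed
    show "(?M *\<^sub>v v) \<bullet> v \<le> stability_const * (\<Sum>i<n. ?M $$ (i, i) / 4 * (v $ i)\<^sup>2)"
      unfolding diag Mform[OF v] sum_distrib_left
    proof (rule sum_mono)
      fix \<tau> assume \<tau>: "\<tau> \<in> T"
      have "a \<tau> / 2 * ((\<Sum>k\<in>local_dofs \<tau>. v $ k)\<^sup>2 + S \<tau> v) \<le> a \<tau> / 2 * ((?d + 1) * S \<tau> v + S \<tau> v)"
        using sq[OF \<tau>, of "\<lambda>k. v $ k"] a[OF \<tau>] by (intro mult_left_mono) (auto simp: S_def)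
      also have "\<dots> = 2 * (?d + 2) * (a \<tau> / 4 * S \<tau> v)" by (simp add: algebra_simps)
      also have "\<dots> \<le> stability_const * (a \<tau> / 4 * S \<tau> v)"
        using c1 a[OF \<tau>] S0 by (intro mult_right_mono) auto
      finally show "a \<tau> / 2 * ((\<Sum>k\<in>local_dofs \<tau>. v $ k)\<^sup>2 + S \<tau> v) \<le> stability_const * (a \<tau> / 4 * S \<tau> v)" .
    qed
    show "0 \<le> (?K *\<^sub>v v) \<bullet> v" unfolding Kform[OF v] using m by (intro sum_nonneg) auto
    show "h\<^sup>2 * ((?K *\<^sub>v v) \<bullet> v) \<le> stability_const * (\<Sum>i<n. ?M $$ (i, i) / 4 * (v $ i)\<^sup>2)"
      unfolding diag Kform[OF v] sum_distrib_left
    proof (rule sum_mono)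
      fix \<tau> assume \<tau>: "\<tau> \<in> T"
      obtain z r where "0 < h" using inball[OF \<tau>] by metis
      have "(\<Sum>k<n. v $ k *\<^sub>R \<gamma> \<tau> k) = (\<Sum>k\<in>local_dofs \<tau>. v $ k *\<^sub>R \<gamma> \<tau> k)"
        using local_dofs_sub \<gamma>0[OF \<tau>] by (intro sum.mono_neutral_right) auto
      \<comment> \<open>The inverse inequality on one element: each
        \<open>h * norm (\<gamma> \<tau> k)\<close> is at most \<open>\<kappa> * \<sigma>\<close>,
        so the factor \<open>h\<close> is used up by the gradients.\<close>
      then have "h * norm (\<Sum>k<n. v $ k *\<^sub>R \<gamma> \<tau> k) \<le> h * (\<Sum>k\<in>local_dofs \<tau>. \<bar>v $ k\<bar> * norm (\<gamma> \<tau> k))"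
        using \<open>0 < h\<close> norm_sum[of "\<lambda>k. v $ k *\<^sub>R \<gamma> \<tau> k" "local_dofs \<tau>"] by (intro mult_left_mono) auto
      also have "\<dots> \<le> (\<Sum>k\<in>local_dofs \<tau>. \<kappa> * \<sigma> * \<bar>v $ k\<bar>)"
        unfolding sum_distrib_left
      proof (rule sum_mono)
        fix k
        show "h * (\<bar>v $ k\<bar> * norm (\<gamma> \<tau> k)) \<le> \<kappa> * \<sigma> * \<bar>v $ k\<bar>"
          using mult_left_mono[OF \<gamma>[OF \<tau>, of k], of "\<bar>v $ k\<bar>"] by (simp add: mult_ac)
      qed
      finally have "(h * norm (\<Sum>k<n. v $ k *\<^sub>R \<gamma> \<tau> k))\<^sup>2 \<le> (\<Sum>k\<in>local_dofs \<tau>. \<kappa> * \<sigma> * \<bar>v $ k\<bar>)\<^sup>2"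
        using \<open>0 < h\<close> by (intro power_mono) auto
      also have "\<dots> \<le> (?d + 1) * (\<Sum>k\<in>local_dofs \<tau>. (\<kappa> * \<sigma> * \<bar>v $ k\<bar>)\<^sup>2)" by (rule sq[OF \<tau>])
      also have "\<dots> = (?d + 1) * ((\<kappa> * \<sigma>)\<^sup>2 * S \<tau> v)"
        by (simp add: S_def sum_distrib_left power_mult_distrib)
      finally have e: "(h * norm (\<Sum>k<n. v $ k *\<^sub>R \<gamma> \<tau> k))\<^sup>2 \<le> (?d + 1) * ((\<kappa> * \<sigma>)\<^sup>2 * S \<tau> v)" .
      have "h\<^sup>2 * (m \<tau> * (norm (\<Sum>k<n. v $ k *\<^sub>R \<gamma> \<tau> k))\<^sup>2) = m \<tau> * (h * norm (\<Sum>k<n. v $ k *\<^sub>R \<gamma> \<tau> k))\<^sup>2"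
        by (simp add: power_mult_distrib)
      also have "\<dots> \<le> ((?d + 1) * (?d + 2) / 2 * a \<tau>) * ((?d + 1) * ((\<kappa> * \<sigma>)\<^sup>2 * S \<tau> v))"
        using m[OF \<tau>] a[OF \<tau>] by (intro mult_mono e) (auto intro!: mult_nonneg_nonneg less_imp_le)
      also have "\<dots> = 2 * (\<kappa> * \<sigma>)\<^sup>2 * (?d + 1)\<^sup>2 * (?d + 2) * (a \<tau> / 4 * S \<tau> v)"
        by (simp add: power2_eq_square[of "?d + 1"])
      also have "\<dots> \<le> stability_const * (a \<tau> / 4 * S \<tau> v)"
        using c2 a[OF \<tau>] S0 by (intro mult_right_mono) auto
      finally show "h\<^sup>2 * (m \<tau> * (norm (\<Sum>k<n. v $ k *\<^sub>R \<gamma> \<tau> k))\<^sup>2) \<le> stability_const * (a \<tau> / 4 * S \<tau> v)" .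
    qed
  qed
qed

text \<open>Two indices interact only through a common element; for the stiffness matrix this is
  because the gradient of a hat function vanishes in the interior of elements that do not have its
  node as a vertex.\<close>

lemma sparsity:
  assumes i: "i < n"
  shows "neighbours i \<subseteq> {..<n}" "card (neighbours i) \<le> row_bound"
    and "j < n \<Longrightarrow> j \<notin> neighbours i \<Longrightarrow> mass_matrix \<Omega> D $$ (i, j) = 0 \<and> stiffness_matrix \<Omega> D $$ (i, j) = 0"
proof -
  obtain a m :: "'a set \<Rightarrow> real" and \<gamma> :: "'a set \<Rightarrow> nat \<Rightarrow> 'a" where
    "\<And>\<tau>. \<tau> \<in> T \<Longrightarrow> 0 < a \<tau>"
    "\<And>\<tau>. \<tau> \<in> T \<Longrightarrow> 0 \<le> m \<tau> \<and> m \<tau> \<le> (real DIM('a) + 1) * (real DIM('a) + 2) / 2 * a \<tau>"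
    and \<gamma>0: "\<And>\<tau> k. \<tau> \<in> T \<Longrightarrow> k \<notin> local_dofs \<tau> \<Longrightarrow> \<gamma> \<tau> k = 0"
    and "\<And>\<tau> k. \<tau> \<in> T \<Longrightarrow> h * norm (\<gamma> \<tau> k) \<le> \<kappa> * \<sigma>"
    and card: "\<And>\<tau>. \<tau> \<in> T \<Longrightarrow> card (local_dofs \<tau>) \<le> DIM('a) + 1"
    and M: "mass_matrix \<Omega> D = Matrix.mat n n (\<lambda>(l, k). \<Sum>\<tau>\<in>T.
       if k \<in> local_dofs \<tau> \<and> l \<in> local_dofs \<tau> then if k = l then a \<tau> else a \<tau> / 2 else 0)"
    and K: "stiffness_matrix \<Omega> D = Matrix.mat n n (\<lambda>(l, k). \<Sum>\<tau>\<in>T. m \<tau> * inner (\<gamma> \<tau> k) (\<gamma> \<tau> l))"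
    by (rule assembly) blast
  show "neighbours i \<subseteq> {..<n}" using local_dofs_sub by (auto simp: neighbours_def)
  let ?S = "{\<tau> \<in> T. i \<in> local_dofs \<tau>}"
  have "card (neighbours i) \<le> (\<Sum>\<tau>\<in>?S. card (local_dofs \<tau>))"
  proof -
    have "neighbours i = (\<Union>\<tau>\<in>?S. local_dofs \<tau>)" by (auto simp: neighbours_def)
    then show ?thesis using fin by (simp add: card_UN_le)
  qed
  also have "\<dots> \<le> card ?S * (DIM('a) + 1)" using card sum_bounded_above[of ?S "\<lambda>\<tau>. card (local_dofs \<tau>)" "DIM('a) + 1"] by simp
  also have "\<dots> \<le> row_bound"
  proof -
    have "real (card ?S) \<le> (\<kappa> * \<sigma>) ^ DIM('a)" by (rule elements_at_node[OF i])
    then have "card ?S \<le> nat \<lceil>(\<kappa> * \<sigma>) ^ DIM('a)\<rceil>" by linarith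
    then show ?thesis unfolding row_bound_def by (metis mult.commute mult_le_mono1)
  qed
  finally show "card (neighbours i) \<le> row_bound" .
  show "mass_matrix \<Omega> D $$ (i, j) = 0 \<and> stiffness_matrix \<Omega> D $$ (i, j) = 0" if "j < n" "j \<notin> neighbours i"
  proof -
    have no: "\<not> (i \<in> local_dofs \<tau> \<and> j \<in> local_dofs \<tau>)" if "\<tau> \<in> T" for \<tau>
      using \<open>j \<notin> neighbours i\<close> that by (auto simp: neighbours_def)
    have "mass_matrix \<Omega> D $$ (i, j) = 0"
      unfolding M using i that no by (auto intro!: sum.neutral)
    moreover have "stiffness_matrix \<Omega> D $$ (i, j) = 0"
    proof -
      have "inner (\<gamma> \<tau> j) (\<gamma> \<tau> i) = 0" if "\<tau> \<in> T" for \<tau>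
        using no[OF that] \<gamma>0[OF that, of i] \<gamma>0[OF that, of j] by (cases "i \<in> local_dofs \<tau>") auto
      then show ?thesis unfolding K using i that by simp
    qed
    ultimately show ?thesis by simp
  qed
qed

lemma fem_program:
  assumes "0 < n"
  shows "fem_program n (mass_matrix \<Omega> D) (stiffness_matrix \<Omega> D) h stability_const
     (carrier_vec n \<times> carrier_vec (n + n)) (\<lambda>(f, x0). bp_env \<Omega> D f x0) row_bound neighbours"
proof -
  interpret fem_matrices n "mass_matrix \<Omega> D" "stiffness_matrix \<Omega> D" h stability_const
    by (rule fem_matrices)
  show ?thesis
    using assms sparsity by unfold_locales auto
qed

lemma bp_eq:
  "bp_system \<Omega> D = fem_matrices.A (mass_matrix \<Omega> D) (stiffness_matrix \<Omega> D) h"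
  "bp_precond \<Omega> D = fem_matrices.P n (mass_matrix \<Omega> D)"
proof -
  interpret fem_matrices n "mass_matrix \<Omega> D" "stiffness_matrix \<Omega> D" h stability_const
    by (rule fem_matrices)
  show "bp_system \<Omega> D = A" "bp_precond \<Omega> D = P"
    by (simp_all add: bp_system_def bp_precond_def A_def P_def Let_def)
qed

end

section \<open>Iteration count and conclusion\<close>

lemma geometric_iteration_count:
  fixes q \<epsilon> \<epsilon>0 :: real
  assumes q: "0 < q" "q < 1" and \<epsilon>: "0 < \<epsilon>" "\<epsilon> \<le> \<epsilon>0" "\<epsilon>0 < 1"
  obtains k :: nat where "q ^ k \<le> \<epsilon>" "real k + 1 \<le> (1 / ln (1 / q) + 2 / ln (1 / \<epsilon>0)) * ln (1 / \<epsilon>)"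
proof -
  define k where "k = nat \<lceil>ln (1 / \<epsilon>) / ln (1 / q)\<rceil>"
  have L: "0 < ln (1 / q)" "0 < ln (1 / \<epsilon>0)" "ln (1 / \<epsilon>0) \<le> ln (1 / \<epsilon>)"
    using q \<epsilon> by (auto intro!: ln_gt_zero divide_left_mono simp: less_divide_eq)
  then have p: "0 \<le> ln (1 / \<epsilon>) / ln (1 / q)" by (intro divide_nonneg_pos) auto
  have k1: "ln (1 / \<epsilon>) / ln (1 / q) \<le> real k" "real k \<le> ln (1 / \<epsilon>) / ln (1 / q) + 1"
    using p unfolding k_def by linarith+
  have "ln (q ^ k) = - (real k * ln (1 / q))" using q by (simp add: ln_realpow ln_div)
  also have "\<dots> \<le> - ln (1 / \<epsilon>)" using k1(1) L by (simp add: divide_le_eq)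
  also have "\<dots> = ln \<epsilon>" using \<epsilon> by (simp add: ln_div)
  finally have "q ^ k \<le> \<epsilon>" using q \<epsilon> by simp
  \<comment> \<open>One unit is lost by rounding up and one by the \<open>+ 1\<close>; since
    \<open>\<epsilon> \<le> \<epsilon>0 < 1\<close>, the logarithm stays away from 0 and absorbs
    both.\<close>
  moreover have "2 \<le> 2 / ln (1 / \<epsilon>0) * ln (1 / \<epsilon>)" using L by (simp add: le_divide_eq)
  then have "real k + 1 \<le> (1 / ln (1 / q) + 2 / ln (1 / \<epsilon>0)) * ln (1 / \<epsilon>)"
    using k1(2) by (simp add: distrib_right)
  ultimately show ?thesis by (rule that)
qed

theorem mainTheorem6:
  fixes \<Omega> :: "'a::euclidean_space set" and \<sigma> \<kappa> :: real
  assumes "DIM('a) \<in> {1, 2, 3}"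
    and "bounded_lipschitz_domain \<Omega>"
  shows "spectrally_equivalent (p1_family \<Omega> \<sigma> \<kappa>) (bp_precond \<Omega>) (bp_system \<Omega>) \<and>
    (\<exists>q. 0 < q \<and> q < 1 \<and>
      (\<forall>D \<in> p1_family \<Omega> \<sigma> \<kappa>.
       \<forall>f \<in> carrier_vec (num_dofs D).
       \<forall>x0 \<in> carrier_vec (2 * num_dofs D).
       \<forall>x \<in> carrier_vec (2 * num_dofs D).
         bp_system \<Omega> D *\<^sub>v x = bp_rhs f \<longrightarrow>
         (\<forall>n. energy_norm (bp_system \<Omega> D) (x - pcg (bp_system \<Omega> D) (bp_precond \<Omega> D) (bp_rhs f) x0 n)
              \<le> 2 * q ^ n * energy_norm (bp_system \<Omega> D) (x - x0)))) \<and>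
    (\<forall>\<epsilon>0. 0 < \<epsilon>0 \<and> \<epsilon>0 < 1 \<longrightarrow>
      (\<exists>c. \<forall>D \<in> p1_family \<Omega> \<sigma> \<kappa>. \<forall>\<epsilon>. 0 < \<epsilon> \<and> \<epsilon> \<le> \<epsilon>0 \<longrightarrow>
        (\<exists>n prog outs.
           performs_pcg \<Omega> D n prog outs \<and>
           real (length prog) \<le> c * real (num_dofs D) * ln (1 / \<epsilon>) \<and>
           (\<forall>f \<in> carrier_vec (num_dofs D).
            \<forall>x0 \<in> carrier_vec (2 * num_dofs D).
            \<forall>x \<in> carrier_vec (2 * num_dofs D).
              bp_system \<Omega> D *\<^sub>v x = bp_rhs f \<longrightarrow>
              energy_norm (bp_system \<Omega> D) (x - pcg (bp_system \<Omega> D) (bp_precond \<Omega> D) (bp_rhs f) x0 n)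
              \<le> \<epsilon> * energy_norm (bp_system \<Omega> D) (x - x0)))))"
proof -
  \<comment> \<open>\<open>c\<close> and \<open>s\<close> repeat \<open>stability_const\<close> and
    \<open>row_bound\<close> outside the mesh locale, so that they are visibly fixed before
    \<open>D\<close>.\<close>
  define c where "c = 2 * (real DIM('a) + 2) + 2 * (\<kappa> * \<sigma>)\<^sup>2 * (real DIM('a) + 1)\<^sup>2 * (real DIM('a) + 2)"
  define s where "s = (DIM('a) + 1) * nat \<lceil>(\<kappa> * \<sigma>) ^ DIM('a)\<rceil>"
  define c1 where "c1 = 1 / (2 * c\<^sup>2 + 3 * c + 1)"
  \<comment> \<open>This is the factor \<open>sqrt (1 - c1 / c2)\<close> with \<open>c2 = 2\<close>;
    \<open>c1 \<le> 1\<close> keeps it positive.\<close>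
  define q where "q = sqrt (1 - c1 / 2)"
  have mesh: "p1_mesh \<Omega> \<sigma> \<kappa> D" if "D \<in> p1_family \<Omega> \<sigma> \<kappa>" for D
    using assms that by unfold_locales
  have setting: "pcg_setting (bp_system \<Omega> D) (bp_precond \<Omega> D) (num_dofs D + num_dofs D) c1 2"
    if D: "D \<in> p1_family \<Omega> \<sigma> \<kappa>" for D
  proof -
    interpret p1_mesh \<Omega> \<sigma> \<kappa> D by (rule mesh[OF D])
    interpret fem: fem_matrices "num_dofs D" "mass_matrix \<Omega> D" "stiffness_matrix \<Omega> D" "meshwidth D" stability_const
      by (rule fem_matrices)
    show ?thesis using fem.pcg_setting_axioms by (simp add: bp_eq c1_def c_def stability_const_def)
  qed
  have c0: "0 < c" by (simp add: c_def add_pos_nonneg)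
  then have c1: "0 < c1" "c1 \<le> 1" by (auto simp: c1_def divide_le_eq add_pos_pos)
  then have q: "0 < q" "q < 1" by (auto simp: q_def)
  have conv: "energy_norm (bp_system \<Omega> D) (x - pcg (bp_system \<Omega> D) (bp_precond \<Omega> D) (bp_rhs f) x0 n)
      \<le> q ^ n * energy_norm (bp_system \<Omega> D) (x - x0)"
    if D: "D \<in> p1_family \<Omega> \<sigma> \<kappa>" and f: "f \<in> carrier_vec (num_dofs D)"
      and x: "x0 \<in> carrier_vec (2 * num_dofs D)" "x \<in> carrier_vec (2 * num_dofs D)"
      "bp_system \<Omega> D *\<^sub>v x = bp_rhs f" for D and f x0 x :: "real vec" and n :: nat
  proof -
    interpret pcg_setting "bp_system \<Omega> D" "bp_precond \<Omega> D" "num_dofs D + num_dofs D" c1 2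
      by (rule setting[OF D])
    show ?thesis using pcg_converges[of "bp_rhs f" x0 x n] f x by (simp add: q_def bp_rhs_def mult_2)
  qed
  have nonneg: "0 \<le> energy_norm (bp_system \<Omega> D) v"
    if D: "D \<in> p1_family \<Omega> \<sigma> \<kappa>" and v: "v \<in> carrier_vec (2 * num_dofs D)" for D v
  proof -
    interpret pcg_setting "bp_system \<Omega> D" "bp_precond \<Omega> D" "num_dofs D + num_dofs D" c1 2
      by (rule setting[OF D])
    show ?thesis using sym_pos_def_nonneg[OF spd(1) carrier(1), of v] v by (simp add: energy_norm_def mult_2)
  qed
  have "spectrally_equivalent (p1_family \<Omega> \<sigma> \<kappa>) (bp_precond \<Omega>) (bp_system \<Omega>)"
    unfolding spectrally_equivalent_def
  proof (intro conjI ballI exI)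
    fix D assume D: "D \<in> p1_family \<Omega> \<sigma> \<kappa>"
    interpret pcg_setting "bp_system \<Omega> D" "bp_precond \<Omega> D" "num_dofs D + num_dofs D" c1 2
      by (rule setting[OF D])
    show "sym_pos_def (bp_precond \<Omega> D)" "sym_pos_def (bp_system \<Omega> D)"
      "dim_row (bp_precond \<Omega> D) = dim_row (bp_system \<Omega> D)" using spd carrier by auto
    fix v :: "real vec" assume "v \<in> carrier_vec (dim_row (bp_system \<Omega> D))"
    then have "v \<in> carrier_vec (num_dofs D + num_dofs D)" using carrier by simp
    then show "c1 * ((bp_system \<Omega> D *\<^sub>v v) \<bullet> v) \<le> (bp_precond \<Omega> D *\<^sub>v v) \<bullet> v"
      "(bp_precond \<Omega> D *\<^sub>v v) \<bullet> v \<le> 2 * ((bp_system \<Omega> D *\<^sub>v v) \<bullet> v)"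
      using lower upper by auto
  qed (use c1 in auto)
  moreover have "\<exists>q. 0 < q \<and> q < 1 \<and>
      (\<forall>D \<in> p1_family \<Omega> \<sigma> \<kappa>.
       \<forall>f \<in> carrier_vec (num_dofs D).
       \<forall>x0 \<in> carrier_vec (2 * num_dofs D).
       \<forall>x \<in> carrier_vec (2 * num_dofs D).
         bp_system \<Omega> D *\<^sub>v x = bp_rhs f \<longrightarrow>
         (\<forall>n. energy_norm (bp_system \<Omega> D) (x - pcg (bp_system \<Omega> D) (bp_precond \<Omega> D) (bp_rhs f) x0 n)
              \<le> 2 * q ^ n * energy_norm (bp_system \<Omega> D) (x - x0)))"
  proof (intro exI[of _ q] conjI ballI impI allI q)
    fix D and f x0 x :: "real vec" and n :: nat
    assume *: "D \<in> p1_family \<Omega> \<sigma> \<kappa>" "f \<in> carrier_vec (num_dofs D)" "x0 \<in> carrier_vec (2 * num_dofs D)"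
      "x \<in> carrier_vec (2 * num_dofs D)" "bp_system \<Omega> D *\<^sub>v x = bp_rhs f"
    have "0 \<le> q ^ n * energy_norm (bp_system \<Omega> D) (x - x0)"
      using nonneg[OF *(1), of "x - x0"] * q by (intro mult_nonneg_nonneg) auto
    then show "energy_norm (bp_system \<Omega> D) (x - pcg (bp_system \<Omega> D) (bp_precond \<Omega> D) (bp_rhs f) x0 n)
              \<le> 2 * q ^ n * energy_norm (bp_system \<Omega> D) (x - x0)"
      using conv[OF *, of n] by simp
  qed
  moreover have "\<exists>C. \<forall>D \<in> p1_family \<Omega> \<sigma> \<kappa>. \<forall>\<epsilon>. 0 < \<epsilon> \<and> \<epsilon> \<le> \<epsilon>0 \<longrightarrow>
        (\<exists>n prog outs.
           performs_pcg \<Omega> D n prog outs \<and>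
           real (length prog) \<le> C * real (num_dofs D) * ln (1 / \<epsilon>) \<and>
           (\<forall>f \<in> carrier_vec (num_dofs D).
            \<forall>x0 \<in> carrier_vec (2 * num_dofs D).
            \<forall>x \<in> carrier_vec (2 * num_dofs D).
              bp_system \<Omega> D *\<^sub>v x = bp_rhs f \<longrightarrow>
              energy_norm (bp_system \<Omega> D) (x - pcg (bp_system \<Omega> D) (bp_precond \<Omega> D) (bp_rhs f) x0 n)
              \<le> \<epsilon> * energy_norm (bp_system \<Omega> D) (x - x0)))"
    if \<epsilon>0: "0 < \<epsilon>0 \<and> \<epsilon>0 < 1" for \<epsilon>0
  proof (intro exI[of _ "(12 * real s + 49) * (1 / ln (1 / q) + 2 / ln (1 / \<epsilon>0))"] ballI allI impI)
    fix D and \<epsilon> :: real assume D: "D \<in> p1_family \<Omega> \<sigma> \<kappa>" and \<epsilon>: "0 < \<epsilon> \<and> \<epsilon> \<le> \<epsilon>0"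
    let ?N = "num_dofs D" and ?C = "1 / ln (1 / q) + 2 / ln (1 / \<epsilon>0)"
    obtain k where k: "q ^ k \<le> \<epsilon>" "real k + 1 \<le> ?C * ln (1 / \<epsilon>)"
      using geometric_iteration_count[OF q] \<epsilon> \<epsilon>0 by blast
    have "\<exists>p outs. length p \<le> ?N * (12 * s + 49) * (k + 1) \<and> performs_pcg \<Omega> D k p outs"
    \<comment> \<open>A mesh may have no interior node; all vectors are then empty, and so is the
      program.\<close>
    proof (cases "?N = 0")
      case True
      interpret pcg_setting "bp_system \<Omega> D" "bp_precond \<Omega> D" "num_dofs D + num_dofs D" c1 2
        by (rule setting[OF D])
      have "pcg (bp_system \<Omega> D) (bp_precond \<Omega> D) (bp_rhs f) x0 m \<in> carrier_vec 0"
        if "f \<in> carrier_vec ?N" "x0 \<in> carrier_vec (2 * ?N)" for f x0 m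
        using pcg_inv_iterate[of "bp_rhs f" x0 m] that True
        by (auto simp: pcg_def pcg_inv_def bp_rhs_def split: prod.splits)
      moreover have "program_output e [] [] = v" if "v \<in> carrier_vec 0" for e :: "bp_input \<Rightarrow> real" and v
        using that by (intro eq_vecI) (auto simp: program_output_def)
      ultimately have "performs_pcg \<Omega> D k [] (\<lambda>_. [])"
        unfolding performs_pcg_def by blast
      then show ?thesis by (intro exI[of _ "[]"]) auto
    next
      case False
      interpret p1_mesh \<Omega> \<sigma> \<kappa> D by (rule mesh[OF D])
      interpret fem: fem_program ?N "mass_matrix \<Omega> D" "stiffness_matrix \<Omega> D" "meshwidth D" stability_const
        "carrier_vec ?N \<times> carrier_vec (?N + ?N)" "\<lambda>(f, x0). bp_env \<Omega> D f x0" row_bound neighbours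
        using False by (intro fem_program) simp
      show ?thesis
        using fem.pcg_program[of k] by (simp add: performs_pcg_def bp_eq mult_2 row_bound_def s_def)
    qed
    then obtain p outs where p: "length p \<le> ?N * (12 * s + 49) * (k + 1)" "performs_pcg \<Omega> D k p outs" by blast
    have "real (length p) \<le> real (?N * (12 * s + 49) * (k + 1))" using p(1) by (rule of_nat_mono)
    also have "\<dots> = (12 * real s + 49) * real ?N * (real k + 1)" by (simp add: algebra_simps)
    also have "\<dots> \<le> (12 * real s + 49) * real ?N * (?C * ln (1 / \<epsilon>))"
      using k(2) by (intro mult_left_mono) auto
    finally have len: "real (length p) \<le> (12 * real s + 49) * ?C * real ?N * ln (1 / \<epsilon>)" by (simp add: mult_ac)
    have "energy_norm (bp_system \<Omega> D) (x - pcg (bp_system \<Omega> D) (bp_precond \<Omega> D) (bp_rhs f) x0 k)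
              \<le> \<epsilon> * energy_norm (bp_system \<Omega> D) (x - x0)"
      if *: "f \<in> carrier_vec ?N" "x0 \<in> carrier_vec (2 * ?N)" "x \<in> carrier_vec (2 * ?N)" "bp_system \<Omega> D *\<^sub>v x = bp_rhs f" for f x0 x :: "real vec"
      using conv[OF D *, of k] mult_right_mono[OF k(1) nonneg[OF D, of "x - x0"]] * by simp
    then show "\<exists>n prog outs.
           performs_pcg \<Omega> D n prog outs \<and>
           real (length prog) \<le> (12 * real s + 49) * ?C * real ?N * ln (1 / \<epsilon>) \<and>
           (\<forall>f \<in> carrier_vec ?N.
            \<forall>x0 \<in> carrier_vec (2 * ?N).
            \<forall>x \<in> carrier_vec (2 * ?N).
              bp_system \<Omega> D *\<^sub>v x = bp_rhs f \<longrightarrow>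
              energy_norm (bp_system \<Omega> D) (x - pcg (bp_system \<Omega> D) (bp_precond \<Omega> D) (bp_rhs f) x0 n)
              \<le> \<epsilon> * energy_norm (bp_system \<Omega> D) (x - x0))"
      using p(2) len by blast
  qed
  ultimately show ?thesis by blast
qed

end
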